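(* Let $A(B)^H$ be a cleft Hopf Galois extension with (convolution invertible) total integral $f\colon H\to A$. Then $A_B=A/[A,B]$ is a left-right stable anti Yetter-Drinfeld module over $H$, with the coaction induced from that of $A$, by the action given by $$ha=f(h^{(2)})\,a\,f^{-1}(h^{(1)}).$$
   Context: All Hopf algebras, algebras and coalgebras are over a field; every Hopf algebra $H$ has an invertible antipode $S$. Sweedler notation: $\Delta(h)=h^{(1)}\otimes h^{(2)}$, and right coactions are $a\mapsto a_{\langle 0\rangle}\otimes a_{\langle 1\rangle}$. For a right $H$-comodule algebra $A$ with coinvariants $B=\{a\in A: a_{\langle 0\rangle}\otimes a_{\langle 1\rangle}=a\otimes 1_H\}$, the extension $A(B)^H$ is (right) Hopf Galois if $can\colon A\otimes_B A\to A\otimes H$, $a\otimes a'\mapsto aa'_{\langle 0\rangle}\otimes a'_{\langle 1\rangle}$, is bijective. $[A,B]$ is the linear span of all $ab-ba$, $a\in A$, $b\in B$. A total integral $f\colon H\to A$ is a linear map with $f(1)=1$ and $f(h^{(1)})\otimes h^{(2)}=f(h)_{\langle 0\rangle}\otimes f(h)_{\langle 1\rangle}$. A Hopf Galois extension is cleft if there is a total integral that is convolution invertible; $f^{-1}$ denotes the convolution inverse. A left $H$-module and right $H$-comodule $M$ (coaction $\rho$) is a left-right anti Yetter-Drinfeld module if $\rho(hm)=h^{(2)}m_{\langle 0\rangle}\otimes h^{(3)}m_{\langle 1\rangle}S(h^{(1)})$; it is stable if $m_{\langle 1\rangle}m_{\langle 0\rangle}=m$ for all $m$. *)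

theory Defs
  imports "HOL-Algebra.Module" "HOL-Algebra.QuotRing" "HOL-Algebra.Free_Abelian_Groups"
begin

section \<open>Vector spaces, algebras and linear maps\<close>

locale vspace = field K + module K V
  for K :: "'k ring" and V :: "('k, 'v) module"

text \<open>The \<open>algebra\<close> locale of the library is restricted to commutative algebras.\<close>

locale k_algebra = vspace K A + A?: ring A
  for K :: "'k ring" and A :: "('k, 'a) module" +
  assumes smult_mult_left:
      "\<lbrakk>c \<in> carrier K; x \<in> carrier A; y \<in> carrier A\<rbrakk> \<Longrightarrow>
        (c \<odot>\<^bsub>A\<^esub> x) \<otimes>\<^bsub>A\<^esub> y = c \<odot>\<^bsub>A\<^esub> (x \<otimes>\<^bsub>A\<^esub> y)"
    and smult_mult_right:
      "\<lbrakk>c \<in> carrier K; x \<in> carrier A; y \<in> carrier A\<rbrakk> \<Longrightarrow>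
        x \<otimes>\<^bsub>A\<^esub> (c \<odot>\<^bsub>A\<^esub> y) = c \<odot>\<^bsub>A\<^esub> (x \<otimes>\<^bsub>A\<^esub> y)"

definition linear_maps ::
  "'k ring \<Rightarrow> ('k, 'v) module \<Rightarrow> ('k, 'w) module \<Rightarrow> ('v \<Rightarrow> 'w) set" where
  "linear_maps K V W = {f \<in> carrier V \<rightarrow> carrier W.
     (\<forall>x\<in>carrier V. \<forall>y\<in>carrier V. f (x \<oplus>\<^bsub>V\<^esub> y) = f x \<oplus>\<^bsub>W\<^esub> f y) \<and>
     (\<forall>c\<in>carrier K. \<forall>x\<in>carrier V. f (c \<odot>\<^bsub>V\<^esub> x) = c \<odot>\<^bsub>W\<^esub> f x)}"

definition ground_module :: "'k ring \<Rightarrow> ('k, 'k) module" where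
  "ground_module K = \<lparr>carrier = carrier K, mult = mult K, one = one K,
     ring.zero = ring.zero K, add = add K, smult = mult K\<rparr>"

definition linear_span :: "'k ring \<Rightarrow> ('k, 'v) module \<Rightarrow> 'v set \<Rightarrow> 'v set" where
  "linear_span K V X = \<Inter>{N. submodule N K V \<and> X \<subseteq> N}"

text \<open>Quotient modules and tensor product groups carry no multiplication; the unused
  multiplicative fields of their records are left undefined.\<close>

definition quotient_module :: "('k, 'v) module \<Rightarrow> 'v set \<Rightarrow> ('k, 'v set) module" where
  "quotient_module V N = \<lparr>carrier = a_rcosets\<^bsub>V\<^esub> N, mult = undefined, one = undefined,
     ring.zero = N, add = (\<lambda>X Y. X <+>\<^bsub>V\<^esub> Y),
     smult = (\<lambda>c X. \<Union>x\<in>X. N +>\<^bsub>V\<^esub> (c \<odot>\<^bsub>V\<^esub> x))\<rparr>"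


section \<open>Tensor products\<close>

text \<open>The tensor product of a right module \<open>V\<close> and a left module \<open>W\<close> over the scalars \<open>R\<close>,
  where \<open>ra\<close> and \<open>la\<close> are the two actions: the free abelian group on
  \<open>carrier V \<times> carrier W\<close> modulo the subgroup generated by the usual relations. Its elements
  are cosets of formal \<open>\<int>\<close>-linear combinations of pairs.\<close>

definition tensor_relations ::
  "'r set \<Rightarrow> ('k, 'v) module \<Rightarrow> ('k, 'w) module \<Rightarrow> ('v \<Rightarrow> 'r \<Rightarrow> 'v) \<Rightarrow> ('r \<Rightarrow> 'w \<Rightarrow> 'w)
    \<Rightarrow> ('v \<times> 'w \<Rightarrow>\<^sub>0 int) set" where
  "tensor_relations R V W ra la = generate (free_Abelian_group (carrier V \<times> carrier W))
    ({frag_of (v \<oplus>\<^bsub>V\<^esub> v', w) - frag_of (v, w) - frag_of (v', w) | v v' w.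
        v \<in> carrier V \<and> v' \<in> carrier V \<and> w \<in> carrier W} \<union>
     {frag_of (v, w \<oplus>\<^bsub>W\<^esub> w') - frag_of (v, w) - frag_of (v, w') | v w w'.
        v \<in> carrier V \<and> w \<in> carrier W \<and> w' \<in> carrier W} \<union>
     {frag_of (ra v r, w) - frag_of (v, la r w) | v r w.
        v \<in> carrier V \<and> r \<in> R \<and> w \<in> carrier W})"

definition tensor_group ::
  "'r set \<Rightarrow> ('k, 'v) module \<Rightarrow> ('k, 'w) module \<Rightarrow> ('v \<Rightarrow> 'r \<Rightarrow> 'v) \<Rightarrow> ('r \<Rightarrow> 'w \<Rightarrow> 'w)
    \<Rightarrow> ('v \<times> 'w \<Rightarrow>\<^sub>0 int) set ring" where
  "tensor_group R V W ra la =
    (let Q = free_Abelian_group (carrier V \<times> carrier W) Mod tensor_relations R V W ra la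
     in \<lparr>carrier = carrier Q, mult = undefined, one = undefined,
         ring.zero = one Q, add = mult Q\<rparr>)"

text \<open>\<open>tensor_lift G \<beta>\<close> is the additive map from a tensor product to the abelian group \<open>G\<close> with
  \<open>v \<otimes> w \<mapsto> \<beta> v w\<close>, for any \<open>\<beta>\<close> that respects the relations (the image below is then a
  singleton). It renders Sweedler notation: an expression \<open>\<beta>(h\<^sup>1, h\<^sup>2)\<close> with
  \<open>\<Delta>(h) = h\<^sup>1 \<otimes> h\<^sup>2\<close> is \<open>tensor_lift G \<beta> (\<Delta> h)\<close>.\<close>

definition tensor_lift ::
  "('b, 'm) ring_scheme \<Rightarrow> ('v \<Rightarrow> 'w \<Rightarrow> 'b) \<Rightarrow> ('v \<times> 'w \<Rightarrow>\<^sub>0 int) set \<Rightarrow> 'b" where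
  "tensor_lift G \<beta> X = the_elem
    ((\<lambda>x. \<Oplus>\<^bsub>G\<^esub>p\<in>Poly_Mapping.keys x.
        [Poly_Mapping.lookup x p] \<cdot>\<^bsub>G\<^esub> \<beta> (fst p) (snd p)) ` X)"

definition pure ::
  "'k ring \<Rightarrow> ('k, 'v) module \<Rightarrow> ('k, 'w) module \<Rightarrow> 'v \<Rightarrow> 'w \<Rightarrow> ('v \<times> 'w \<Rightarrow>\<^sub>0 int) set" where
  "pure K V W v w =
    tensor_relations (carrier K) V W (\<lambda>x c. c \<odot>\<^bsub>V\<^esub> x) (smult W)
      #>\<^bsub>free_Abelian_group (carrier V \<times> carrier W)\<^esub> frag_of (v, w)"

text \<open>The tensor product over the ground field. The multiplicative fields are those of the
  tensor product of two algebras, \<open>(v \<otimes> w)(v' \<otimes> w') = vv' \<otimes> ww'\<close>; they are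
  meaningless when \<open>V\<close> or \<open>W\<close> is a mere vector space.\<close>

definition tensor ::
  "'k ring \<Rightarrow> ('k, 'v) module \<Rightarrow> ('k, 'w) module \<Rightarrow> ('k, ('v \<times> 'w \<Rightarrow>\<^sub>0 int) set) module" where
  "tensor K V W =
    (let T = tensor_group (carrier K) V W (\<lambda>x c. c \<odot>\<^bsub>V\<^esub> x) (smult W)
     in \<lparr>carrier = carrier T,
         mult = (\<lambda>X Y. tensor_lift T (\<lambda>v w. tensor_lift T
                   (\<lambda>v' w'. pure K V W (v \<otimes>\<^bsub>V\<^esub> v') (w \<otimes>\<^bsub>W\<^esub> w')) Y) X),
         one = pure K V W \<one>\<^bsub>V\<^esub> \<one>\<^bsub>W\<^esub>,
         ring.zero = ring.zero T,
         add = add T,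
         smult = (\<lambda>c. tensor_lift T (\<lambda>v w. pure K V W (c \<odot>\<^bsub>V\<^esub> v) w))\<rparr>)"


section \<open>Hopf algebras\<close>

locale coalgebra = vspace K H
  for K :: "'k ring" and H :: "('k, 'h) module"
    and \<Delta> :: "'h \<Rightarrow> ('h \<times> 'h \<Rightarrow>\<^sub>0 int) set" and \<epsilon> :: "'h \<Rightarrow> 'k" +
  assumes comult_linear: "\<Delta> \<in> linear_maps K H (tensor K H H)"
    and counit_linear: "\<epsilon> \<in> linear_maps K H (ground_module K)"
    and coassoc: "h \<in> carrier H \<Longrightarrow>
      tensor_lift (tensor K H (tensor K H H))
        (\<lambda>x y. pure K H (tensor K H H) x (\<Delta> y)) (\<Delta> h) =
      tensor_lift (tensor K H (tensor K H H))
        (\<lambda>x y. tensor_lift (tensor K H (tensor K H H))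
          (\<lambda>x1 x2. pure K H (tensor K H H) x1 (pure K H H x2 y)) (\<Delta> x)) (\<Delta> h)"
    and counit_left: "h \<in> carrier H \<Longrightarrow> tensor_lift H (\<lambda>x y. \<epsilon> x \<odot>\<^bsub>H\<^esub> y) (\<Delta> h) = h"
    and counit_right: "h \<in> carrier H \<Longrightarrow> tensor_lift H (\<lambda>x y. \<epsilon> y \<odot>\<^bsub>H\<^esub> x) (\<Delta> h) = h"

locale bialgebra = coalgebra K H \<Delta> \<epsilon> + k_algebra K H
  for K :: "'k ring" and H :: "('k, 'h) module"
    and \<Delta> :: "'h \<Rightarrow> ('h \<times> 'h \<Rightarrow>\<^sub>0 int) set" and \<epsilon> :: "'h \<Rightarrow> 'k" +
  assumes comult_ring_hom: "\<Delta> \<in> ring_hom H (tensor K H H)"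
    and counit_ring_hom: "\<epsilon> \<in> ring_hom H K"

text \<open>Invertibility of the antipode is a standing assumption, not part of the usual definition.\<close>

locale hopf_algebra = bialgebra K H \<Delta> \<epsilon>
  for K :: "'k ring" and H :: "('k, 'h) module"
    and \<Delta> :: "'h \<Rightarrow> ('h \<times> 'h \<Rightarrow>\<^sub>0 int) set" and \<epsilon> :: "'h \<Rightarrow> 'k"
    and S :: "'h \<Rightarrow> 'h" +
  assumes antipode_linear: "S \<in> linear_maps K H H"
    and antipode_left: "h \<in> carrier H \<Longrightarrow>
      tensor_lift H (\<lambda>x y. S x \<otimes>\<^bsub>H\<^esub> y) (\<Delta> h) = \<epsilon> h \<odot>\<^bsub>H\<^esub> \<one>\<^bsub>H\<^esub>"
    and antipode_right: "h \<in> carrier H \<Longrightarrow>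
      tensor_lift H (\<lambda>x y. x \<otimes>\<^bsub>H\<^esub> S y) (\<Delta> h) = \<epsilon> h \<odot>\<^bsub>H\<^esub> \<one>\<^bsub>H\<^esub>"
    and antipode_bij: "bij_betw S (carrier H) (carrier H)"


section \<open>Modules, comodules and comodule algebras\<close>

locale left_H_module = k_algebra K H + M: vspace K M
  for K :: "'k ring" and H :: "('k, 'h) module" and M :: "('k, 'm) module"
    and act :: "'h \<Rightarrow> 'm \<Rightarrow> 'm" +
  assumes act_linear_right: "h \<in> carrier H \<Longrightarrow> act h \<in> linear_maps K M M"
    and act_linear_left: "m \<in> carrier M \<Longrightarrow> (\<lambda>h. act h m) \<in> linear_maps K H M"
    and act_mult: "\<lbrakk>g \<in> carrier H; h \<in> carrier H; m \<in> carrier M\<rbrakk> \<Longrightarrow>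
      act (g \<otimes>\<^bsub>H\<^esub> h) m = act g (act h m)"
    and act_one: "m \<in> carrier M \<Longrightarrow> act \<one>\<^bsub>H\<^esub> m = m"

locale right_comodule = coalgebra K H \<Delta> \<epsilon> + M: vspace K M
  for K :: "'k ring" and H :: "('k, 'h) module"
    and \<Delta> :: "'h \<Rightarrow> ('h \<times> 'h \<Rightarrow>\<^sub>0 int) set" and \<epsilon> :: "'h \<Rightarrow> 'k"
    and M :: "('k, 'm) module" and \<rho> :: "'m \<Rightarrow> ('m \<times> 'h \<Rightarrow>\<^sub>0 int) set" +
  assumes coaction_linear: "\<rho> \<in> linear_maps K M (tensor K M H)"
    and coaction_coassoc: "m \<in> carrier M \<Longrightarrow>
      tensor_lift (tensor K M (tensor K H H))
        (\<lambda>x y. pure K M (tensor K H H) x (\<Delta> y)) (\<rho> m) =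
      tensor_lift (tensor K M (tensor K H H))
        (\<lambda>x y. tensor_lift (tensor K M (tensor K H H))
          (\<lambda>x0 x1. pure K M (tensor K H H) x0 (pure K H H x1 y)) (\<rho> x)) (\<rho> m)"
    and coaction_counit: "m \<in> carrier M \<Longrightarrow>
      tensor_lift M (\<lambda>x y. \<epsilon> y \<odot>\<^bsub>M\<^esub> x) (\<rho> m) = m"

locale right_comodule_algebra = 
  hopf_algebra K H \<Delta> \<epsilon> S + right_comodule K H \<Delta> \<epsilon> A \<rho> + A: k_algebra K A
  for K :: "'k ring" and H :: "('k, 'h) module"
    and \<Delta> :: "'h \<Rightarrow> ('h \<times> 'h \<Rightarrow>\<^sub>0 int) set" and \<epsilon> :: "'h \<Rightarrow> 'k" and S :: "'h \<Rightarrow> 'h"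
    and A :: "('k, 'a) module" and \<rho> :: "'a \<Rightarrow> ('a \<times> 'h \<Rightarrow>\<^sub>0 int) set" +
  assumes coaction_ring_hom: "\<rho> \<in> ring_hom A (tensor K A H)"


section \<open>Hopf Galois extensions\<close>

definition coinvariants ::
  "'k ring \<Rightarrow> ('k, 'h) module \<Rightarrow> ('k, 'a) module \<Rightarrow> ('a \<Rightarrow> ('a \<times> 'h \<Rightarrow>\<^sub>0 int) set) \<Rightarrow> 'a set"
  where
  "coinvariants K H A \<rho> = {a \<in> carrier A. \<rho> a = pure K A H a \<one>\<^bsub>H\<^esub>}"

text \<open>The source of the canonical map is the tensor product \<open>A \<otimes>\<^sub>B A\<close> over the coinvariants.\<close>

definition canonical_map ::
  "'k ring \<Rightarrow> ('k, 'h) module \<Rightarrow> ('k, 'a) module \<Rightarrow> ('a \<Rightarrow> ('a \<times> 'h \<Rightarrow>\<^sub>0 int) set)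
    \<Rightarrow> ('a \<times> 'a \<Rightarrow>\<^sub>0 int) set \<Rightarrow> ('a \<times> 'h \<Rightarrow>\<^sub>0 int) set" where
  "canonical_map K H A \<rho> = tensor_lift (tensor K A H)
    (\<lambda>a a'. tensor_lift (tensor K A H) (\<lambda>x y. pure K A H (a \<otimes>\<^bsub>A\<^esub> x) y) (\<rho> a'))"

locale hopf_galois_extension = right_comodule_algebra K H \<Delta> \<epsilon> S A \<rho>
  for K :: "'k ring" and H :: "('k, 'h) module"
    and \<Delta> :: "'h \<Rightarrow> ('h \<times> 'h \<Rightarrow>\<^sub>0 int) set" and \<epsilon> :: "'h \<Rightarrow> 'k" and S :: "'h \<Rightarrow> 'h"
    and A :: "('k, 'a) module" and \<rho> :: "'a \<Rightarrow> ('a \<times> 'h \<Rightarrow>\<^sub>0 int) set" +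
  assumes canonical_bij: "bij_betw (canonical_map K H A \<rho>)
    (carrier (tensor_group (coinvariants K H A \<rho>) A A (mult A) (mult A)))
    (carrier (tensor K A H))"

definition total_integral ::
  "'k ring \<Rightarrow> ('k, 'h) module \<Rightarrow> ('h \<Rightarrow> ('h \<times> 'h \<Rightarrow>\<^sub>0 int) set)
    \<Rightarrow> ('k, 'a) module \<Rightarrow> ('a \<Rightarrow> ('a \<times> 'h \<Rightarrow>\<^sub>0 int) set) \<Rightarrow> ('h \<Rightarrow> 'a) \<Rightarrow> bool" where
  "total_integral K H \<Delta> A \<rho> f \<longleftrightarrow>
    f \<in> linear_maps K H A \<and> f \<one>\<^bsub>H\<^esub> = \<one>\<^bsub>A\<^esub> \<and>
    (\<forall>h\<in>carrier H. tensor_lift (tensor K A H) (\<lambda>x y. pure K A H (f x) y) (\<Delta> h) = \<rho> (f h))"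

definition convolution_inverse ::
  "'k ring \<Rightarrow> ('k, 'h) module \<Rightarrow> ('h \<Rightarrow> ('h \<times> 'h \<Rightarrow>\<^sub>0 int) set) \<Rightarrow> ('h \<Rightarrow> 'k)
    \<Rightarrow> ('k, 'a) module \<Rightarrow> ('h \<Rightarrow> 'a) \<Rightarrow> ('h \<Rightarrow> 'a) \<Rightarrow> bool" where
  "convolution_inverse K H \<Delta> \<epsilon> A f g \<longleftrightarrow>
    f \<in> linear_maps K H A \<and> g \<in> linear_maps K H A \<and>
    (\<forall>h\<in>carrier H.
      tensor_lift A (\<lambda>x y. f x \<otimes>\<^bsub>A\<^esub> g y) (\<Delta> h) = \<epsilon> h \<odot>\<^bsub>A\<^esub> \<one>\<^bsub>A\<^esub> \<and>
      tensor_lift A (\<lambda>x y. g x \<otimes>\<^bsub>A\<^esub> f y) (\<Delta> h) = \<epsilon> h \<odot>\<^bsub>A\<^esub> \<one>\<^bsub>A\<^esub>)"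

definition commutator_space :: "'k ring \<Rightarrow> ('k, 'a) module \<Rightarrow> 'a set \<Rightarrow> 'a set" where
  "commutator_space K A B =
    linear_span K A {a \<otimes>\<^bsub>A\<^esub> b \<ominus>\<^bsub>A\<^esub> b \<otimes>\<^bsub>A\<^esub> a | a b. a \<in> carrier A \<and> b \<in> B}"


section \<open>Stable anti Yetter-Drinfeld modules\<close>

locale anti_yetter_drinfeld =
  hopf_algebra K H \<Delta> \<epsilon> S + left_H_module K H M act + right_comodule K H \<Delta> \<epsilon> M \<rho>
  for K :: "'k ring" and H :: "('k, 'h) module"
    and \<Delta> :: "'h \<Rightarrow> ('h \<times> 'h \<Rightarrow>\<^sub>0 int) set" and \<epsilon> :: "'h \<Rightarrow> 'k" and S :: "'h \<Rightarrow> 'h"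
    and M :: "('k, 'm) module" and act :: "'h \<Rightarrow> 'm \<Rightarrow> 'm"
    and \<rho> :: "'m \<Rightarrow> ('m \<times> 'h \<Rightarrow>\<^sub>0 int) set" +
  assumes ayd: "\<lbrakk>h \<in> carrier H; m \<in> carrier M\<rbrakk> \<Longrightarrow>
    \<rho> (act h m) =
      tensor_lift (tensor K M H) (\<lambda>h1 h'.
        tensor_lift (tensor K M H) (\<lambda>h2 h3.
          tensor_lift (tensor K M H) (\<lambda>m0 m1.
            pure K M H (act h2 m0) (h3 \<otimes>\<^bsub>H\<^esub> m1 \<otimes>\<^bsub>H\<^esub> S h1))
          (\<rho> m))
        (\<Delta> h'))
      (\<Delta> h)"

locale stable_anti_yetter_drinfeld = anti_yetter_drinfeld K H \<Delta> \<epsilon> S M act \<rho>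
  for K :: "'k ring" and H :: "('k, 'h) module"
    and \<Delta> :: "'h \<Rightarrow> ('h \<times> 'h \<Rightarrow>\<^sub>0 int) set" and \<epsilon> :: "'h \<Rightarrow> 'k" and S :: "'h \<Rightarrow> 'h"
    and M :: "('k, 'm) module" and act :: "'h \<Rightarrow> 'm \<Rightarrow> 'm"
    and \<rho> :: "'m \<Rightarrow> ('m \<times> 'h \<Rightarrow>\<^sub>0 int) set" +
  assumes stable: "m \<in> carrier M \<Longrightarrow> tensor_lift M (\<lambda>m0 m1. act m1 m0) (\<rho> m) = m"

end

theory Submission
  imports Defs
begin

text \<open>Write \<open>g\<close> for the convolution inverse of \<open>f\<close> and \<open>B\<close> for the coinvariants. The idea is that the
  action is the Miyashita-Ulbrich action. Since \<open>f\<close> is colinear, the canonical map sends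
  \<open>g(h\<^sup>1) \<otimes>\<^sub>B f(h\<^sup>2)\<close> to \<open>1 \<otimes> h\<close>, so this element of \<open>A \<otimes>\<^sub>B A\<close> is determined by
  its canonical image. On the other hand, for fixed \<open>a\<close> the assignment
  \<open>x \<otimes> y \<mapsto> y a x\<close> is well defined on \<open>A \<otimes>\<^sub>B A\<close> with values in \<open>A/[A,B]\<close>, and it sends
  that element to \<open>f(h\<^sup>2) a g(h\<^sup>1)\<close>. Because the canonical map is injective,
  an identity between such expressions in \<open>A/[A,B]\<close> may be checked after applying the canonical map
  to tensors that represent its two sides (\<open>balanced_factors_through_can\<close>).

  With the formula \<open>can_translation\<close> for the canonical images, this gives in the same way that
  the action descends to \<open>A/[A,B]\<close> (both sides become \<open>b \<otimes> h\<close>, \<open>act0_commute\<close>), that it is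
  multiplicative (both become \<open>1 \<otimes> h k\<close>, \<open>act0_mult\<close>) and that it is stable
  (both become \<open>\<rho>(a)\<close>, \<open>act0_stable\<close>). The coaction descends because elements of \<open>B\<close> are
  coinvariant (\<open>coact0_commute\<close>).

  The anti Yetter-Drinfeld condition uses \<open>\<rho>(g(h)) = g(h\<^sup>2) \<otimes> S(h\<^sup>1)\<close>
  (\<open>coaction_g\<close>), which is uniqueness of convolution inverses. Together with multiplicativity of
  the coaction it yields
  \<open>\<rho>(f(h\<^sup>2) a g(h\<^sup>1)) = f(h\<^sup>3) a\<^sub>0 g(h\<^sup>2) \<otimes> h\<^sup>4 a\<^sub>1 S(h\<^sup>1)\<close>,
  and coassociativity rewrites this as the required expression (\<open>ayd_Q\<close>).

  Sweedler notation is made precise by choosing, for each tensor, a finite list of pairs that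
  represents it. Sums of multilinear maps over such lists are independent of the choice, and
  coassociativity, counit and multiplicativity become rewriting rules for them.\<close>


section \<open>Sums over lists of pairs\<close>

text \<open>Elements of a tensor product are handled through finite lists of pairs, read as sums of
  elementary tensors. A Sweedler expression then becomes an ordinary finite sum, and identities
  between such sums can be proved term by term.\<close>

definition pair_sum :: "('b, 'm) ring_scheme \<Rightarrow> ('v \<Rightarrow> 'w \<Rightarrow> 'b) \<Rightarrow> ('v \<times> 'w) list \<Rightarrow> 'b" where
  "pair_sum G \<beta> ps = foldr (\<lambda>p s. \<beta> (fst p) (snd p) \<oplus>\<^bsub>G\<^esub> s) ps \<zero>\<^bsub>G\<^esub>"

lemma pair_sum_Nil [simp]: "pair_sum G \<beta> [] = \<zero>\<^bsub>G\<^esub>"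
  and pair_sum_Cons [simp]: "pair_sum G \<beta> (p # ps) = \<beta> (fst p) (snd p) \<oplus>\<^bsub>G\<^esub> pair_sum G \<beta> ps"
  by (simp_all add: pair_sum_def)

lemma pair_sum_cong:
  assumes "set ps \<subseteq> V \<times> W" "\<And>x y. \<lbrakk>x \<in> V; y \<in> W\<rbrakk> \<Longrightarrow> \<beta> x y = \<gamma> x y"
  shows "pair_sum G \<beta> ps = pair_sum G \<gamma> ps"
  using assms(1) by (induction ps) (auto simp: assms(2))

lemma pair_sum_map:
  "pair_sum G \<beta> (map (\<lambda>(x, y). (\<phi> x y, \<psi> x y)) ps) = pair_sum G (\<lambda>x y. \<beta> (\<phi> x y) (\<psi> x y)) ps"
  by (induction ps) (auto simp: case_prod_unfold)

context abelian_group
begin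

lemma pair_sum_closed:
  assumes "set ps \<subseteq> V \<times> W" "\<And>x y. \<lbrakk>x \<in> V; y \<in> W\<rbrakk> \<Longrightarrow> \<beta> x y \<in> carrier G"
  shows "pair_sum G \<beta> ps \<in> carrier G"
  using assms(1) by (induction ps) (auto simp: assms(2))

lemma pair_sum_append:
  assumes "set ps \<subseteq> V \<times> W" "set qs \<subseteq> V \<times> W" "\<And>x y. \<lbrakk>x \<in> V; y \<in> W\<rbrakk> \<Longrightarrow> \<beta> x y \<in> carrier G"
  shows "pair_sum G \<beta> (ps @ qs) = pair_sum G \<beta> ps \<oplus> pair_sum G \<beta> qs"
  using assms(1)
proof (induction ps)
  case Nil then show ?case using pair_sum_closed[OF assms(2,3)] by simp
next
  case (Cons p ps)
  have "pair_sum G \<beta> ps \<in> carrier G" "pair_sum G \<beta> qs \<in> carrier G"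
    using Cons.prems pair_sum_closed[of ps V W \<beta>] pair_sum_closed[OF assms(2,3)] assms(3) by auto
  then show ?case using Cons by (auto simp: a_assoc assms(3))
qed

lemma pair_sum_add:
  assumes "set ps \<subseteq> V \<times> W"
    "\<And>x y. \<lbrakk>x \<in> V; y \<in> W\<rbrakk> \<Longrightarrow> \<beta> x y \<in> carrier G"
    "\<And>x y. \<lbrakk>x \<in> V; y \<in> W\<rbrakk> \<Longrightarrow> \<gamma> x y \<in> carrier G"
  shows "pair_sum G (\<lambda>x y. \<beta> x y \<oplus> \<gamma> x y) ps = pair_sum G \<beta> ps \<oplus> pair_sum G \<gamma> ps"
  using assms(1)
proof (induction ps)
  case (Cons p ps)
  have "pair_sum G \<beta> ps \<in> carrier G" "pair_sum G \<gamma> ps \<in> carrier G"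
    using Cons.prems by (auto intro!: pair_sum_closed[of ps V W] assms(2,3))
  then show ?case using Cons by (auto simp: assms(2,3) a_ac)
qed simp

lemma pair_sum_zero: "pair_sum G (\<lambda>x y. \<zero>) ps = \<zero>"
  by (induction ps) auto

lemma pair_sum_swap:
  assumes "set ps \<subseteq> V \<times> W" "set qs \<subseteq> V' \<times> W'"
    "\<And>x y u v. \<lbrakk>x \<in> V; y \<in> W; u \<in> V'; v \<in> W'\<rbrakk> \<Longrightarrow> \<beta> x y u v \<in> carrier G"
  shows "pair_sum G (\<lambda>x y. pair_sum G (\<lambda>u v. \<beta> x y u v) qs) ps =
    pair_sum G (\<lambda>u v. pair_sum G (\<lambda>x y. \<beta> x y u v) ps) qs"
  using assms(1)
proof (induction ps)
  case Nil then show ?case by (simp add: pair_sum_zero)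
next
  case (Cons p ps)
  then show ?case
    by (auto intro!: pair_sum_add[symmetric, OF assms(2)] pair_sum_closed[of ps V W] assms(3))
qed

end

definition additive_map :: "('a, 'm) ring_scheme \<Rightarrow> ('b, 'n) ring_scheme \<Rightarrow> ('a \<Rightarrow> 'b) \<Rightarrow> bool" where
  "additive_map G G' \<phi> \<longleftrightarrow> \<phi> \<in> carrier G \<rightarrow> carrier G' \<and>
    (\<forall>x\<in>carrier G. \<forall>y\<in>carrier G. \<phi> (x \<oplus>\<^bsub>G\<^esub> y) = \<phi> x \<oplus>\<^bsub>G'\<^esub> \<phi> y)"

lemma additive_map_zero:
  assumes "abelian_group G" "abelian_group G'" "additive_map G G' \<phi>"
  shows "\<phi> \<zero>\<^bsub>G\<^esub> = \<zero>\<^bsub>G'\<^esub>"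
proof -
  interpret G: abelian_group G by fact
  interpret G': abelian_group G' by fact
  have z: "\<phi> \<zero>\<^bsub>G\<^esub> \<in> carrier G'" using assms(3) by (auto simp: additive_map_def)
  have "\<phi> \<zero>\<^bsub>G\<^esub> = \<phi> (\<zero>\<^bsub>G\<^esub> \<oplus>\<^bsub>G\<^esub> \<zero>\<^bsub>G\<^esub>)" by simp
  also have "\<dots> = \<phi> \<zero>\<^bsub>G\<^esub> \<oplus>\<^bsub>G'\<^esub> \<phi> \<zero>\<^bsub>G\<^esub>"
    using assms(3) G.zero_closed unfolding additive_map_def by blast
  finally show ?thesis using z G'.add.l_cancel_one' by metis
qed

lemma additive_map_minus:
  assumes "abelian_group G" "abelian_group G'" "additive_map G G' \<phi>" "x \<in> carrier G"
  shows "\<phi> (\<ominus>\<^bsub>G\<^esub> x) = \<ominus>\<^bsub>G'\<^esub> \<phi> x"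
proof -
  interpret G: abelian_group G by fact
  interpret G': abelian_group G' by fact
  have c: "\<phi> x \<in> carrier G'" "\<phi> (\<ominus>\<^bsub>G\<^esub> x) \<in> carrier G'"
    using assms(3,4) by (auto simp: additive_map_def)
  have "\<phi> (\<ominus>\<^bsub>G\<^esub> x) \<oplus>\<^bsub>G'\<^esub> \<phi> x = \<phi> (\<ominus>\<^bsub>G\<^esub> x \<oplus>\<^bsub>G\<^esub> x)"
    using assms(3,4) unfolding additive_map_def by simp
  also have "\<dots> = \<zero>\<^bsub>G'\<^esub>"
    using additive_map_zero[OF assms(1-3)] assms(4) by (simp add: G.l_neg)
  finally show ?thesis using c G'.minus_equality by metis
qed

lemma additive_map_pair_sum:
  assumes "abelian_group G" "abelian_group G'" "additive_map G G' \<phi>"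
    "set ps \<subseteq> V \<times> W" "\<And>x y. \<lbrakk>x \<in> V; y \<in> W\<rbrakk> \<Longrightarrow> \<beta> x y \<in> carrier G"
  shows "\<phi> (pair_sum G \<beta> ps) = pair_sum G' (\<lambda>x y. \<phi> (\<beta> x y)) ps"
  using assms(4)
proof (induction ps)
  case Nil then show ?case using additive_map_zero[OF assms(1-3)] by simp
next
  case (Cons p ps)
  have "pair_sum G \<beta> ps \<in> carrier G"
    using abelian_group.pair_sum_closed[OF assms(1), of ps V W] Cons.prems assms(5) by auto
  then show ?case using Cons assms(3,5) by (auto simp: additive_map_def)
qed


section \<open>The universal property of tensor products\<close>

text \<open>Balanced maps are only required to be additive: the tensor product over the coinvariants
  is a bare abelian group without scalars.\<close>

definition balanced ::
  "'r set \<Rightarrow> ('k, 'v) module \<Rightarrow> ('k, 'w) module \<Rightarrow> ('v \<Rightarrow> 'r \<Rightarrow> 'v) \<Rightarrow> ('r \<Rightarrow> 'w \<Rightarrow> 'w)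
    \<Rightarrow> ('b, 'm) ring_scheme \<Rightarrow> ('v \<Rightarrow> 'w \<Rightarrow> 'b) \<Rightarrow> bool" where
  "balanced R V W ra la G \<beta> \<longleftrightarrow>
    (\<forall>v\<in>carrier V. additive_map W G (\<beta> v)) \<and>
    (\<forall>w\<in>carrier W. additive_map V G (\<lambda>v. \<beta> v w)) \<and>
    (\<forall>v\<in>carrier V. \<forall>r\<in>R. \<forall>w\<in>carrier W. \<beta> (ra v r) w = \<beta> v (la r w))"

text \<open>The analogue of \<open>pure\<close> for arbitrary scalars.\<close>

definition elementary_tensor ::
  "'r set \<Rightarrow> ('k, 'v) module \<Rightarrow> ('k, 'w) module \<Rightarrow> ('v \<Rightarrow> 'r \<Rightarrow> 'v) \<Rightarrow> ('r \<Rightarrow> 'w \<Rightarrow> 'w)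
    \<Rightarrow> 'v \<Rightarrow> 'w \<Rightarrow> ('v \<times> 'w \<Rightarrow>\<^sub>0 int) set" where
  "elementary_tensor R V W ra la v w =
    tensor_relations R V W ra la #>\<^bsub>free_Abelian_group (carrier V \<times> carrier W)\<^esub> frag_of (v, w)"

locale tensor_factors = V: abelian_group V + W: abelian_group W
  for V :: "('k, 'v) module" and W :: "('k, 'w) module" +
  fixes R :: "'r set" and ra :: "'v \<Rightarrow> 'r \<Rightarrow> 'v" and la :: "'r \<Rightarrow> 'w \<Rightarrow> 'w"
  assumes ra_closed: "\<lbrakk>v \<in> carrier V; r \<in> R\<rbrakk> \<Longrightarrow> ra v r \<in> carrier V"
    and la_closed: "\<lbrakk>r \<in> R; w \<in> carrier W\<rbrakk> \<Longrightarrow> la r w \<in> carrier W"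
begin

abbreviation F where "F \<equiv> free_Abelian_group (carrier V \<times> carrier W)"
abbreviation Rel where "Rel \<equiv> tensor_relations R V W ra la"
abbreviation T where "T \<equiv> tensor_group R V W ra la"
abbreviation et where "et \<equiv> elementary_tensor R V W ra la"

lemma keys_frag_diff: "\<lbrakk>Poly_Mapping.keys a \<subseteq> C; Poly_Mapping.keys b \<subseteq> C\<rbrakk> \<Longrightarrow> Poly_Mapping.keys (a - b) \<subseteq> C"
  for a b :: "'c \<Rightarrow>\<^sub>0 int"
  using keys_diff[of a b] by blast

lemma keys_frag_add: "\<lbrakk>Poly_Mapping.keys a \<subseteq> C; Poly_Mapping.keys b \<subseteq> C\<rbrakk> \<Longrightarrow> Poly_Mapping.keys (a + b) \<subseteq> C"
  for a b :: "'c \<Rightarrow>\<^sub>0 int"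
  using keys_add[of a b] by blast

definition gens where "gens =
    {frag_of (v \<oplus>\<^bsub>V\<^esub> v', w) - frag_of (v, w) - frag_of (v', w) | v v' w.
        v \<in> carrier V \<and> v' \<in> carrier V \<and> w \<in> carrier W} \<union>
     {frag_of (v, w \<oplus>\<^bsub>W\<^esub> w') - frag_of (v, w) - frag_of (v, w') | v w w'.
        v \<in> carrier V \<and> w \<in> carrier W \<and> w' \<in> carrier W} \<union>
     {frag_of (ra v r, w) - frag_of (v, la r w) | v r w.
        v \<in> carrier V \<and> r \<in> R \<and> w \<in> carrier W}"

lemma Rel_generate: "Rel = generate F gens"
  by (simp add: tensor_relations_def gens_def)

lemma gens_subset: "gens \<subseteq> carrier F"
  unfolding gens_def
  by (intro Un_least subsetI; elim CollectE exE conjE; hypsubst; unfold carrier_free_Abelian_group_iff)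
    (intro keys_frag_diff; simp add: ra_closed la_closed)+

lemma subgroup_Rel: "subgroup Rel F"
  unfolding Rel_generate by (rule group.generate_is_subgroup[OF group_free_Abelian_group gens_subset])

lemma normal_Rel: "Rel \<lhd> F"
  using subgroup_Rel abelian_free_Abelian_group comm_group.normal_iff_subgroup by blast

lemma tensor_group_simps:
  "carrier T = carrier (F Mod Rel)" "add T = mult (F Mod Rel)" "\<zero>\<^bsub>T\<^esub> = Rel"
  by (simp_all add: tensor_group_def Let_def)

lemma abelian_group_T: "abelian_group T"
proof -
  have c: "comm_group (F Mod Rel)"
    using comm_group.abelian_FactGroup[OF abelian_free_Abelian_group subgroup_Rel] .
  show ?thesis
    by (rule comm_group_abelian_groupI)
      (use c in \<open>simp add: tensor_group_def Let_def FactGroup_def\<close>)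
qed

lemma coset_add: "\<lbrakk>x \<in> carrier F; y \<in> carrier F\<rbrakk> \<Longrightarrow> (Rel #>\<^bsub>F\<^esub> x) \<oplus>\<^bsub>T\<^esub> (Rel #>\<^bsub>F\<^esub> y) = Rel #>\<^bsub>F\<^esub> (x + y)"
  using normal.rcos_sum[OF normal_Rel, of x y] by (simp add: tensor_group_simps)

lemma coset_closed: "x \<in> carrier F \<Longrightarrow> Rel #>\<^bsub>F\<^esub> x \<in> carrier T"
  by (auto simp: tensor_group_simps carrier_FactGroup)

lemma coset_eq:
  assumes "x \<in> carrier F" "y \<in> carrier F" "x - y \<in> Rel"
  shows "Rel #>\<^bsub>F\<^esub> x = Rel #>\<^bsub>F\<^esub> y"
proof -
  have "x \<in> Rel #>\<^bsub>F\<^esub> y" using assms unfolding r_coset_def by (force simp: algebra_simps)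
  then show ?thesis
    using group.repr_independence[OF group_free_Abelian_group _ _ subgroup_Rel] assms(2) by metis
qed

lemma et_closed: "\<lbrakk>v \<in> carrier V; w \<in> carrier W\<rbrakk> \<Longrightarrow> et v w \<in> carrier T"
  unfolding elementary_tensor_def by (rule coset_closed) simp

lemma gens_Rel: "x \<in> gens \<Longrightarrow> x \<in> Rel"
  unfolding Rel_generate by (rule generate.incl)

lemma et_balanced: "balanced R V W ra la T et"
  unfolding balanced_def additive_map_def
proof (intro conjI ballI)
  fix v w w' assume a: "v \<in> carrier V" "w \<in> carrier W" "w' \<in> carrier W"
  show "et v (w \<oplus>\<^bsub>W\<^esub> w') = et v w \<oplus>\<^bsub>T\<^esub> et v w'"
    unfolding elementary_tensor_def using a
    by (subst coset_add, simp, simp, intro coset_eq gens_Rel, simp,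
        unfold carrier_free_Abelian_group_iff, intro keys_frag_add)
      (simp_all only: gens_def diff_diff_eq[symmetric], (simp | blast)+)
next
  fix w v v' assume a: "v \<in> carrier V" "v' \<in> carrier V" "w \<in> carrier W"
  show "et (v \<oplus>\<^bsub>V\<^esub> v') w = et v w \<oplus>\<^bsub>T\<^esub> et v' w"
    unfolding elementary_tensor_def using a
    by (subst coset_add, simp, simp, intro coset_eq gens_Rel, simp,
        unfold carrier_free_Abelian_group_iff, intro keys_frag_add)
      (simp_all only: gens_def diff_diff_eq[symmetric], (simp | blast)+)
next
  fix v r w assume a: "v \<in> carrier V" "r \<in> R" "w \<in> carrier W"
  show "et (ra v r) w = et v (la r w)"
    unfolding elementary_tensor_def using a
    by (intro coset_eq gens_Rel) (simp_all only: gens_def, (simp add: ra_closed la_closed | blast)+)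
qed (use et_closed in auto)

text \<open>Lists of pairs without integer coefficients suffice, because a minus sign can be absorbed
  into the left factor.\<close>

lemma tensor_exhaust:
  assumes "X \<in> carrier T"
  obtains ps where "set ps \<subseteq> carrier V \<times> carrier W" "X = pair_sum T et ps"
proof -
  interpret T: abelian_group T by (rule abelian_group_T)
  obtain x where x: "x \<in> carrier F" "X = Rel #>\<^bsub>F\<^esub> x"
    using assms by (auto simp: tensor_group_simps carrier_FactGroup)
  have "Poly_Mapping.keys x \<subseteq> carrier V \<times> carrier W" using x by simp
  then have "\<exists>ps. set ps \<subseteq> carrier V \<times> carrier W \<and> Rel #>\<^bsub>F\<^esub> x = pair_sum T et ps"
  proof (rule free_Abelian_group_induct, goal_cases)
    case 1
    have "Rel #>\<^bsub>F\<^esub> 0 = \<zero>\<^bsub>T\<^esub>"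
      using group.coset_mult_one[OF group_free_Abelian_group subgroup.subset[OF subgroup_Rel]]
      by (simp add: tensor_group_simps)
    then show ?case by (intro exI[of _ "[]"]) simp
  next
    case (2 x y)
    obtain ps qs where p: "set ps \<subseteq> carrier V \<times> carrier W" "Rel #>\<^bsub>F\<^esub> x = pair_sum T et ps"
      and q: "set qs \<subseteq> carrier V \<times> carrier W" "Rel #>\<^bsub>F\<^esub> y = pair_sum T et qs"
      using 2 by blast
    let ?qs = "map (\<lambda>(v, w). (\<ominus>\<^bsub>V\<^esub> v, w)) qs"
    have q': "set ?qs \<subseteq> carrier V \<times> carrier W" using q(1) by auto
    have "pair_sum T et ?qs = pair_sum T (\<lambda>v w. \<ominus>\<^bsub>T\<^esub> et v w) qs"
      unfolding pair_sum_map
      by (rule pair_sum_cong[OF q(1)], rule additive_map_minus[OF V.abelian_group_axioms abelian_group_T])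
        (use et_balanced in \<open>auto simp: balanced_def\<close>)
    also have "\<dots> = \<ominus>\<^bsub>T\<^esub> pair_sum T et qs"
      by (rule additive_map_pair_sum[OF abelian_group_T abelian_group_T _ q(1), symmetric])
        (auto simp: additive_map_def T.minus_add et_closed)
    finally have m: "pair_sum T et ?qs = \<ominus>\<^bsub>T\<^esub> pair_sum T et qs" .
    have "(Rel #>\<^bsub>F\<^esub> (x - y)) \<oplus>\<^bsub>T\<^esub> (Rel #>\<^bsub>F\<^esub> y) = Rel #>\<^bsub>F\<^esub> x"
      using coset_add[of "x - y" y] 2 keys_frag_diff[of x _ y] by simp
    then have "Rel #>\<^bsub>F\<^esub> (x - y) = pair_sum T et ps \<oplus>\<^bsub>T\<^esub> pair_sum T et ?qs"
      unfolding m p(2)[symmetric] q(2)[symmetric]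
      using 2 keys_frag_diff[of x _ y] coset_closed
      by (metis T.add.inv_solve_right carrier_free_Abelian_group_iff)
    then show ?case
      using T.pair_sum_append[OF p(1) q', of et] et_closed p(1) q'
      by (intro exI[of _ "ps @ ?qs"]) auto
  next
    case (3 a)
    then have "et (fst a) (snd a) \<in> carrier T" by (auto intro: et_closed)
    with 3 show ?case
      by (intro exI[of _ "[a]"]) (auto simp: elementary_tensor_def)
  qed
  then show thesis using that x by blast
qed

context
  fixes G :: "('b, 'm) ring_scheme" and \<beta> :: "'v \<Rightarrow> 'w \<Rightarrow> 'b"
  assumes G: "abelian_group G" and \<beta>: "balanced R V W ra la G \<beta>"
begin

interpretation G: abelian_group G by (rule G)

lemma balanced_closed: "\<lbrakk>v \<in> carrier V; w \<in> carrier W\<rbrakk> \<Longrightarrow> \<beta> v w \<in> carrier G"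
  using \<beta> by (auto simp: balanced_def additive_map_def)

text \<open>The additive extension of \<open>\<beta>\<close> to formal sums, which is what \<open>tensor_lift\<close> evaluates
  on the representatives of a coset.\<close>

definition free_ext :: "('v \<times> 'w \<Rightarrow>\<^sub>0 int) \<Rightarrow> 'b" where
  "free_ext x = (\<Oplus>\<^bsub>G\<^esub>p\<in>Poly_Mapping.keys x. [Poly_Mapping.lookup x p] \<cdot>\<^bsub>G\<^esub> \<beta> (fst p) (snd p))"

lemma add_pow_closed: "a \<in> carrier G \<Longrightarrow> [n] \<cdot>\<^bsub>G\<^esub> a \<in> carrier G" for n :: int
  using G.add.int_pow_closed by blast

text \<open>Formal sums have different supports; summing over any finite set that contains the support
  makes additivity a termwise statement.\<close>

lemma free_ext_superset:
  assumes "finite S" "Poly_Mapping.keys x \<subseteq> S" "S \<subseteq> carrier V \<times> carrier W"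
  shows "free_ext x = (\<Oplus>\<^bsub>G\<^esub>p\<in>S. [Poly_Mapping.lookup x p] \<cdot>\<^bsub>G\<^esub> \<beta> (fst p) (snd p))"
  unfolding free_ext_def
proof (rule G.add.finprod_mono_neutral_cong_left[OF assms(1,2)])
  fix i assume "i \<in> S - Poly_Mapping.keys x"
  then have "Poly_Mapping.lookup x i = 0" by (simp add: in_keys_iff)
  then show "[Poly_Mapping.lookup x i] \<cdot>\<^bsub>G\<^esub> \<beta> (fst i) (snd i) = \<zero>\<^bsub>G\<^esub>"
    by (simp add: add_pow_def int_pow_def)
qed (use assms balanced_closed add_pow_closed in auto)

lemma free_ext_add:
  assumes "x \<in> carrier F" "y \<in> carrier F"
  shows "free_ext (x + y) = free_ext x \<oplus>\<^bsub>G\<^esub> free_ext y"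
proof -
  let ?S = "Poly_Mapping.keys x \<union> Poly_Mapping.keys y"
  have S: "finite ?S" "?S \<subseteq> carrier V \<times> carrier W" using assms by auto
  have b: "p \<in> ?S \<Longrightarrow> \<beta> (fst p) (snd p) \<in> carrier G" for p
    using S(2) balanced_closed by (metis mem_Times_iff subsetD)
  have "free_ext (x + y) = (\<Oplus>\<^bsub>G\<^esub>p\<in>?S. [Poly_Mapping.lookup x p] \<cdot>\<^bsub>G\<^esub> \<beta> (fst p) (snd p) \<oplus>\<^bsub>G\<^esub>
      [Poly_Mapping.lookup y p] \<cdot>\<^bsub>G\<^esub> \<beta> (fst p) (snd p))"
    using keys_add[of x y] S b
    by (subst free_ext_superset[of ?S])
      (auto simp: lookup_add G.add.int_pow_mult add_pow_closed Pi_def intro!: G.finsum_cong')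
  also have "\<dots> = free_ext x \<oplus>\<^bsub>G\<^esub> free_ext y"
    using S b
    by (subst (1 2) free_ext_superset[of ?S]) (auto simp: add_pow_closed Pi_def intro!: G.finsum_addf)
  finally show ?thesis .
qed

lemma free_ext_closed: "x \<in> carrier F \<Longrightarrow> free_ext x \<in> carrier G"
  unfolding free_ext_def
  by (rule G.finsum_closed) (auto simp: Pi_def intro!: add_pow_closed balanced_closed)

lemma free_ext_hom: "free_ext \<in> hom F (add_monoid G)"
  by (rule homI) (auto simp: free_ext_add free_ext_closed simp del: carrier_free_Abelian_group_iff)

lemma free_ext_frag: "\<lbrakk>v \<in> carrier V; w \<in> carrier W\<rbrakk> \<Longrightarrow> free_ext (frag_of (v, w)) = \<beta> v w"
  unfolding free_ext_def using balanced_closed[of v w] G.add.int_pow_1 by simp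

lemma free_ext_diff:
  assumes "x \<in> carrier F" "y \<in> carrier F"
  shows "free_ext (x - y) = free_ext x \<ominus>\<^bsub>G\<^esub> free_ext y"
proof -
  have d: "x - y \<in> carrier F" using assms keys_frag_diff[of x _ y] by simp
  have "free_ext x = free_ext (x - y) \<oplus>\<^bsub>G\<^esub> free_ext y"
    using free_ext_add[OF d assms(2)] by simp
  then show ?thesis
    using free_ext_closed d assms by (simp add: G.add.inv_solve_right a_minus_def del: carrier_free_Abelian_group_iff)
qed

lemma free_ext_gens:
  assumes "x \<in> gens" shows "free_ext x = \<zero>\<^bsub>G\<^esub>"
proof -
  have z: "(a \<oplus>\<^bsub>G\<^esub> b) \<ominus>\<^bsub>G\<^esub> a \<ominus>\<^bsub>G\<^esub> b = \<zero>\<^bsub>G\<^esub>" if "a \<in> carrier G" "b \<in> carrier G" for a b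
  proof -
    have "(a \<oplus>\<^bsub>G\<^esub> b) \<ominus>\<^bsub>G\<^esub> a \<ominus>\<^bsub>G\<^esub> b = (a \<oplus>\<^bsub>G\<^esub> b) \<oplus>\<^bsub>G\<^esub> \<ominus>\<^bsub>G\<^esub> (a \<oplus>\<^bsub>G\<^esub> b)"
      using that by (simp add: G.minus_eq G.a_assoc G.minus_add)
    then show ?thesis using that by (simp add: G.r_neg)
  qed
  have b1: "\<beta> (v \<oplus>\<^bsub>V\<^esub> v') w = \<beta> v w \<oplus>\<^bsub>G\<^esub> \<beta> v' w" if "v \<in> carrier V" "v' \<in> carrier V" "w \<in> carrier W" for v v' w
    using \<beta> that by (simp add: balanced_def additive_map_def)
  have b2: "\<beta> v (w \<oplus>\<^bsub>W\<^esub> w') = \<beta> v w \<oplus>\<^bsub>G\<^esub> \<beta> v w'" if "v \<in> carrier V" "w \<in> carrier W" "w' \<in> carrier W" for v w w'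
    using \<beta> that by (simp add: balanced_def additive_map_def)
  have b3: "\<beta> (ra v r) w = \<beta> v (la r w)" if "v \<in> carrier V" "r \<in> R" "w \<in> carrier W" for v r w
    using \<beta> that by (simp add: balanced_def)
  have d3: "free_ext (frag_of p - frag_of q - frag_of s) =
      free_ext (frag_of p) \<ominus>\<^bsub>G\<^esub> free_ext (frag_of q) \<ominus>\<^bsub>G\<^esub> free_ext (frag_of s)"
    if "p \<in> carrier V \<times> carrier W" "q \<in> carrier V \<times> carrier W" "s \<in> carrier V \<times> carrier W" for p q s
    using that keys_frag_diff[of "frag_of p" "carrier V \<times> carrier W" "frag_of q"]
    by (simp add: free_ext_diff)
  show ?thesis
    using assms unfolding gens_def
    by (auto simp: d3 free_ext_diff free_ext_frag ra_closed la_closed b1 b2 b3 z balanced_closed G.r_neg G.minus_eq[of "\<beta> _ _" "\<beta> _ _"])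
qed

lemma free_ext_Rel:
  assumes "x \<in> Rel" shows "free_ext x = \<zero>\<^bsub>G\<^esub>"
proof -
  interpret h: group_hom F "add_monoid G" free_ext
    by (simp add: group_hom_def group_hom_axioms_def G.a_group free_ext_hom)
  have "Rel \<subseteq> kernel F (add_monoid G) free_ext"
    unfolding Rel_generate
    by (rule group.generate_subgroup_incl[OF group_free_Abelian_group _ h.subgroup_kernel])
      (use gens_subset free_ext_gens in \<open>auto simp: kernel_def simp del: carrier_free_Abelian_group_iff\<close>)
  then show ?thesis using assms by (auto simp: kernel_def)
qed

text \<open>The extension vanishes on the relations, so its image of a coset is a singleton and
  \<open>the_elem\<close> in the definition of \<open>tensor_lift\<close> picks a meaningful value.\<close>

lemma tensor_lift_coset:
  assumes "x \<in> carrier F" shows "tensor_lift G \<beta> (Rel #>\<^bsub>F\<^esub> x) = free_ext x"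
proof -
  have "free_ext ` (Rel #>\<^bsub>F\<^esub> x) = {free_ext x}"
  proof (intro equalityI subsetI)
    fix z assume "z \<in> free_ext ` (Rel #>\<^bsub>F\<^esub> x)"
    then obtain r where r: "r \<in> Rel" "z = free_ext (r + x)" by (auto simp: r_coset_def)
    have "r \<in> carrier F" using r(1) subgroup.subset[OF subgroup_Rel] by blast
    then show "z \<in> {free_ext x}"
      using r assms by (simp add: free_ext_add free_ext_Rel free_ext_closed del: carrier_free_Abelian_group_iff)
  next
    fix z assume "z \<in> {free_ext x}"
    moreover have "x \<in> Rel #>\<^bsub>F\<^esub> x"
      by (rule group.rcos_self[OF group_free_Abelian_group assms subgroup_Rel])
    ultimately show "z \<in> free_ext ` (Rel #>\<^bsub>F\<^esub> x)" by blast
  qed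
  then show ?thesis
    unfolding tensor_lift_def free_ext_def[abs_def, symmetric] by simp
qed

lemma tensor_lift_additive: "additive_map T G (tensor_lift G \<beta>)"
  unfolding additive_map_def
proof (intro conjI ballI)
  show "tensor_lift G \<beta> \<in> carrier T \<rightarrow> carrier G"
    by (auto simp: tensor_group_simps(1) carrier_FactGroup tensor_lift_coset free_ext_closed simp del: carrier_free_Abelian_group_iff)
  fix X Y assume "X \<in> carrier T" "Y \<in> carrier T"
  then obtain x y where xy: "x \<in> carrier F" "X = Rel #>\<^bsub>F\<^esub> x" "y \<in> carrier F" "Y = Rel #>\<^bsub>F\<^esub> y"
    by (auto simp: tensor_group_simps(1) carrier_FactGroup simp del: carrier_free_Abelian_group_iff)
  moreover have "x + y \<in> carrier F" using xy keys_add[of x y] by auto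
  ultimately show "tensor_lift G \<beta> (X \<oplus>\<^bsub>T\<^esub> Y) = tensor_lift G \<beta> X \<oplus>\<^bsub>G\<^esub> tensor_lift G \<beta> Y"
    by (simp add: coset_add tensor_lift_coset free_ext_add del: carrier_free_Abelian_group_iff)
qed

lemma tensor_lift_et: "\<lbrakk>v \<in> carrier V; w \<in> carrier W\<rbrakk> \<Longrightarrow> tensor_lift G \<beta> (et v w) = \<beta> v w"
  unfolding elementary_tensor_def by (subst tensor_lift_coset) (auto simp: free_ext_frag)

lemma tensor_lift_pair_sum:
  assumes "set ps \<subseteq> carrier V \<times> carrier W"
  shows "tensor_lift G \<beta> (pair_sum T et ps) = pair_sum G \<beta> ps"
proof -
  have "tensor_lift G \<beta> (pair_sum T et ps) = pair_sum G (\<lambda>x y. tensor_lift G \<beta> (et x y)) ps"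
    by (rule additive_map_pair_sum[OF abelian_group_T G tensor_lift_additive assms et_closed])
  also have "\<dots> = pair_sum G \<beta> ps" by (rule pair_sum_cong[OF assms]) (rule tensor_lift_et)
  finally show ?thesis .
qed

end

end


section \<open>Linear and bilinear maps\<close>

lemma vspace_abelian_group: "vspace K V \<Longrightarrow> abelian_group V"
  by (simp add: vspace_def module_def)

lemma vspace_module: "vspace K V \<Longrightarrow> module K V"
  by (simp add: vspace_def)

lemma linear_mapsI:
  assumes "\<And>x. x \<in> carrier V \<Longrightarrow> \<phi> x \<in> carrier W"
    "\<And>x y. \<lbrakk>x \<in> carrier V; y \<in> carrier V\<rbrakk> \<Longrightarrow> \<phi> (x \<oplus>\<^bsub>V\<^esub> y) = \<phi> x \<oplus>\<^bsub>W\<^esub> \<phi> y"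
    "\<And>c x. \<lbrakk>c \<in> carrier K; x \<in> carrier V\<rbrakk> \<Longrightarrow> \<phi> (c \<odot>\<^bsub>V\<^esub> x) = c \<odot>\<^bsub>W\<^esub> \<phi> x"
  shows "\<phi> \<in> linear_maps K V W"
  using assms by (auto simp: linear_maps_def)

lemma linear_maps_closed: "\<lbrakk>\<phi> \<in> linear_maps K V W; x \<in> carrier V\<rbrakk> \<Longrightarrow> \<phi> x \<in> carrier W"
  and linear_maps_add: "\<lbrakk>\<phi> \<in> linear_maps K V W; x \<in> carrier V; y \<in> carrier V\<rbrakk> \<Longrightarrow>
    \<phi> (x \<oplus>\<^bsub>V\<^esub> y) = \<phi> x \<oplus>\<^bsub>W\<^esub> \<phi> y"
  and linear_maps_smult: "\<lbrakk>\<phi> \<in> linear_maps K V W; c \<in> carrier K; x \<in> carrier V\<rbrakk> \<Longrightarrow>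
    \<phi> (c \<odot>\<^bsub>V\<^esub> x) = c \<odot>\<^bsub>W\<^esub> \<phi> x"
  by (auto simp: linear_maps_def)

text \<open>Linearity depends only on the values on the carrier. Choices of representatives give maps
  that agree with linear ones there but behave arbitrarily elsewhere.\<close>

lemma linear_maps_cong:
  assumes "vspace K V" "\<phi> \<in> linear_maps K V W" "\<And>x. x \<in> carrier V \<Longrightarrow> \<phi> x = \<psi> x"
  shows "\<psi> \<in> linear_maps K V W"
proof -
  interpret vspace K V by fact
  show ?thesis using assms(2) by (auto simp: linear_maps_def Pi_def simp flip: assms(3))
qed

lemma linear_maps_additive: "\<phi> \<in> linear_maps K V W \<Longrightarrow> additive_map V W \<phi>"
  by (auto simp: linear_maps_def additive_map_def)

lemma linear_maps_zero:
  "\<lbrakk>vspace K V; vspace K W; \<phi> \<in> linear_maps K V W\<rbrakk> \<Longrightarrow> \<phi> \<zero>\<^bsub>V\<^esub> = \<zero>\<^bsub>W\<^esub>"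
  using additive_map_zero linear_maps_additive vspace_abelian_group by metis

lemma linear_maps_minus:
  "\<lbrakk>vspace K V; vspace K W; \<phi> \<in> linear_maps K V W; x \<in> carrier V\<rbrakk> \<Longrightarrow> \<phi> (\<ominus>\<^bsub>V\<^esub> x) = \<ominus>\<^bsub>W\<^esub> \<phi> x"
  using additive_map_minus linear_maps_additive vspace_abelian_group by metis

lemma linear_pair_sum:
  assumes "vspace K V" "vspace K W" "\<phi> \<in> linear_maps K V W" "set ps \<subseteq> P \<times> Q"
    "\<And>x y. \<lbrakk>x \<in> P; y \<in> Q\<rbrakk> \<Longrightarrow> \<beta> x y \<in> carrier V"
  shows "\<phi> (pair_sum V \<beta> ps) = pair_sum W (\<lambda>x y. \<phi> (\<beta> x y)) ps"
  by (rule additive_map_pair_sum[OF vspace_abelian_group[OF assms(1)] vspace_abelian_group[OF assms(2)]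
        linear_maps_additive[OF assms(3)] assms(4,5)])

lemma linear_id: "(\<lambda>x. x) \<in> linear_maps K V V"
  by (rule linear_mapsI) auto

lemma linear_comp:
  "\<lbrakk>\<phi> \<in> linear_maps K W G; \<psi> \<in> linear_maps K V W\<rbrakk> \<Longrightarrow> (\<lambda>x. \<phi> (\<psi> x)) \<in> linear_maps K V G"
  by (rule linear_mapsI) (simp_all add: linear_maps_closed linear_maps_add linear_maps_smult)

lemma linear_smult:
  assumes "vspace K V" "c \<in> carrier K" shows "smult V c \<in> linear_maps K V V"
proof -
  interpret vspace K V by fact
  show ?thesis
    using assms(2)
    by (intro linear_mapsI) (simp_all add: smult_r_distr smult_assoc1[symmetric] m_comm)
qed

lemma linear_sum:
  assumes G: "vspace K G" and ps: "set ps \<subseteq> P \<times> Q"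
    and \<beta>: "\<And>x y. \<lbrakk>x \<in> P; y \<in> Q\<rbrakk> \<Longrightarrow> (\<lambda>v. \<beta> v x y) \<in> linear_maps K V G"
  shows "(\<lambda>v. pair_sum G (\<beta> v) ps) \<in> linear_maps K V G"
proof (rule linear_mapsI)
  interpret G: vspace K G by fact
  have cl: "\<beta> v x y \<in> carrier G" if "v \<in> carrier V" "x \<in> P" "y \<in> Q" for v x y
    using linear_maps_closed[OF \<beta>] that by blast
  show "pair_sum G (\<beta> v) ps \<in> carrier G" if "v \<in> carrier V" for v
    using G.pair_sum_closed[OF ps] cl that by metis
  show "pair_sum G (\<beta> (v \<oplus>\<^bsub>V\<^esub> v')) ps = pair_sum G (\<beta> v) ps \<oplus>\<^bsub>G\<^esub> pair_sum G (\<beta> v') ps"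
    if "v \<in> carrier V" "v' \<in> carrier V" for v v'
    using pair_sum_cong[OF ps linear_maps_add[OF \<beta> that], where G=G]
      G.pair_sum_add[OF ps cl[OF that(1)] cl[OF that(2)]] by simp
  show "pair_sum G (\<beta> (c \<odot>\<^bsub>V\<^esub> v)) ps = c \<odot>\<^bsub>G\<^esub> pair_sum G (\<beta> v) ps"
    if "c \<in> carrier K" "v \<in> carrier V" for c v
    using pair_sum_cong[OF ps linear_maps_smult[OF \<beta> that], where G=G]
      linear_pair_sum[OF G G linear_smult[OF G that(1)] ps cl[OF that(2)]] by simp
qed

definition bilinear ::
  "'k ring \<Rightarrow> ('k, 'v) module \<Rightarrow> ('k, 'w) module \<Rightarrow> ('k, 'b) module \<Rightarrow> ('v \<Rightarrow> 'w \<Rightarrow> 'b) \<Rightarrow> bool" where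
  "bilinear K V W G \<beta> \<longleftrightarrow> (\<forall>v\<in>carrier V. \<beta> v \<in> linear_maps K W G) \<and>
     (\<forall>w\<in>carrier W. (\<lambda>v. \<beta> v w) \<in> linear_maps K V G)"

lemma bilinearI:
  assumes "\<And>v. v \<in> carrier V \<Longrightarrow> \<beta> v \<in> linear_maps K W G"
    "\<And>w. w \<in> carrier W \<Longrightarrow> (\<lambda>v. \<beta> v w) \<in> linear_maps K V G"
  shows "bilinear K V W G \<beta>"
  using assms by (simp add: bilinear_def)

lemma bilinear_right: "\<lbrakk>bilinear K V W G \<beta>; v \<in> carrier V\<rbrakk> \<Longrightarrow> \<beta> v \<in> linear_maps K W G"
  and bilinear_left: "\<lbrakk>bilinear K V W G \<beta>; w \<in> carrier W\<rbrakk> \<Longrightarrow> (\<lambda>v. \<beta> v w) \<in> linear_maps K V G"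
  by (simp_all add: bilinear_def)

lemma bilinear_closed: "\<lbrakk>bilinear K V W G \<beta>; v \<in> carrier V; w \<in> carrier W\<rbrakk> \<Longrightarrow> \<beta> v w \<in> carrier G"
  using linear_maps_closed bilinear_right by metis

lemma linear_bilinear_right:
  "\<lbrakk>bilinear K V W G \<beta>; v \<in> carrier V; \<phi> \<in> linear_maps K U W\<rbrakk> \<Longrightarrow> (\<lambda>u. \<beta> v (\<phi> u)) \<in> linear_maps K U G"
  by (rule linear_comp[OF bilinear_right])

lemma linear_bilinear_left:
  assumes "bilinear K V W G \<beta>" "w \<in> carrier W" "\<phi> \<in> linear_maps K U V"
  shows "(\<lambda>u. \<beta> (\<phi> u) w) \<in> linear_maps K U G"
  using linear_comp[OF bilinear_left[OF assms(1,2)] assms(3)] .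

lemma bilinear_balanced:
  assumes "bilinear K V W G \<beta>"
  shows "balanced (carrier K) V W (\<lambda>x c. c \<odot>\<^bsub>V\<^esub> x) (smult W) G \<beta>"
  unfolding balanced_def
proof (intro conjI ballI)
  fix v c w assume a: "v \<in> carrier V" "c \<in> carrier K" "w \<in> carrier W"
  show "\<beta> (c \<odot>\<^bsub>V\<^esub> v) w = \<beta> v (c \<odot>\<^bsub>W\<^esub> w)"
    using linear_maps_smult[OF bilinear_left[OF assms a(3)] a(2,1)]
      linear_maps_smult[OF bilinear_right[OF assms a(1)] a(2,3)] by simp
qed (use assms in \<open>auto simp: bilinear_def intro: linear_maps_additive\<close>)

lemma bilinear_smult:
  assumes "vspace K V" shows "bilinear K (ground_module K) V V (smult V)"
proof -
  interpret vspace K V by fact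
  show ?thesis
    using linear_smult[OF assms]
    by (intro bilinearI) (auto simp: ground_module_def smult_l_distr smult_assoc1 intro!: linear_mapsI)
qed

lemma bilinear_mult:
  assumes "k_algebra K A" shows "bilinear K A A A (mult A)"
proof -
  interpret k_algebra K A by fact
  show ?thesis
    by (intro bilinearI linear_mapsI)
      (simp_all add: smult_mult_left smult_mult_right A.l_distr A.r_distr)
qed


section \<open>Tensor products over the ground field\<close>

lemma pure_elementary: "pure K V W = elementary_tensor (carrier K) V W (\<lambda>x c. c \<odot>\<^bsub>V\<^esub> x) (smult W)"
  by (intro ext) (simp add: pure_def elementary_tensor_def)

lemma tensor_simps:
  "carrier (tensor K V W) = carrier (tensor_group (carrier K) V W (\<lambda>x c. c \<odot>\<^bsub>V\<^esub> x) (smult W))"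
  "add (tensor K V W) = add (tensor_group (carrier K) V W (\<lambda>x c. c \<odot>\<^bsub>V\<^esub> x) (smult W))"
  "\<zero>\<^bsub>tensor K V W\<^esub> = \<zero>\<^bsub>tensor_group (carrier K) V W (\<lambda>x c. c \<odot>\<^bsub>V\<^esub> x) (smult W)\<^esub>"
  by (simp_all add: tensor_def Let_def)

lemma pair_sum_tensor:
  "pair_sum (tensor K V W) = pair_sum (tensor_group (carrier K) V W (\<lambda>x c. c \<odot>\<^bsub>V\<^esub> x) (smult W))"
  by (intro ext) (simp add: pair_sum_def tensor_simps)

lemma additive_map_tensor:
  "additive_map (tensor K V W) = additive_map (tensor_group (carrier K) V W (\<lambda>x c. c \<odot>\<^bsub>V\<^esub> x) (smult W))"
  "additive_map G (tensor K V W) = additive_map G (tensor_group (carrier K) V W (\<lambda>x c. c \<odot>\<^bsub>V\<^esub> x) (smult W))"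
  by (intro ext; simp add: additive_map_def tensor_simps)+

locale vspace_pair = V: vspace K V + W: vspace K W
  for K :: "'k ring" and V :: "('k, 'v) module" and W :: "('k, 'w) module"
begin

sublocale T: tensor_factors V W "carrier K" "\<lambda>x c. c \<odot>\<^bsub>V\<^esub> x" "smult W"
  by unfold_locales simp_all

lemma tensor_abelian_group: "abelian_group (tensor K V W)"
  by (rule abelian_groupI; unfold tensor_simps; rule abelian_groupE[OF T.abelian_group_T])

lemma pure_closed: "\<lbrakk>v \<in> carrier V; w \<in> carrier W\<rbrakk> \<Longrightarrow> pure K V W v w \<in> carrier (tensor K V W)"
  using T.et_closed by (simp add: pure_elementary tensor_simps)

lemma pure_add_left: "\<lbrakk>v \<in> carrier V; v' \<in> carrier V; w \<in> carrier W\<rbrakk> \<Longrightarrow>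
    pure K V W (v \<oplus>\<^bsub>V\<^esub> v') w = pure K V W v w \<oplus>\<^bsub>tensor K V W\<^esub> pure K V W v' w"
  and pure_add_right: "\<lbrakk>v \<in> carrier V; w \<in> carrier W; w' \<in> carrier W\<rbrakk> \<Longrightarrow>
    pure K V W v (w \<oplus>\<^bsub>W\<^esub> w') = pure K V W v w \<oplus>\<^bsub>tensor K V W\<^esub> pure K V W v w'"
  and pure_middle: "\<lbrakk>v \<in> carrier V; c \<in> carrier K; w \<in> carrier W\<rbrakk> \<Longrightarrow>
    pure K V W (c \<odot>\<^bsub>V\<^esub> v) w = pure K V W v (c \<odot>\<^bsub>W\<^esub> w)"
  using T.et_balanced unfolding balanced_def additive_map_def pure_elementary tensor_simps by blast+

lemma tensor_exhaust:
  assumes "X \<in> carrier (tensor K V W)"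
  obtains ps where "set ps \<subseteq> carrier V \<times> carrier W" "X = pair_sum (tensor K V W) (pure K V W) ps"
  using T.tensor_exhaust assms unfolding pair_sum_tensor pure_elementary tensor_simps by metis

text \<open>Scalars act on a tensor product by the lift of this map.\<close>

lemma balanced_scaled_pure:
  assumes "c \<in> carrier K"
  shows "balanced (carrier K) V W (\<lambda>x c. c \<odot>\<^bsub>V\<^esub> x) (smult W) T.T (\<lambda>v w. pure K V W (c \<odot>\<^bsub>V\<^esub> v) w)"
proof -
  have "c \<odot>\<^bsub>V\<^esub> (d \<odot>\<^bsub>V\<^esub> v) = d \<odot>\<^bsub>V\<^esub> (c \<odot>\<^bsub>V\<^esub> v)" if "d \<in> carrier K" "v \<in> carrier V" for d v
    using assms that by (simp add: V.smult_assoc1[symmetric] V.m_comm)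
  then show ?thesis
    using assms unfolding balanced_def additive_map_def
    by (auto simp: V.smult_r_distr pure_add_left pure_add_right pure_middle[symmetric] tensor_simps[symmetric] intro: pure_closed)
qed

lemma smult_additive: "c \<in> carrier K \<Longrightarrow> additive_map (tensor K V W) (tensor K V W) (smult (tensor K V W) c)"
  using T.tensor_lift_additive[OF T.abelian_group_T balanced_scaled_pure]
  unfolding additive_map_tensor by (simp add: tensor_def Let_def)

lemma smult_pure:
  "\<lbrakk>c \<in> carrier K; v \<in> carrier V; w \<in> carrier W\<rbrakk> \<Longrightarrow>
    c \<odot>\<^bsub>tensor K V W\<^esub> pure K V W v w = pure K V W (c \<odot>\<^bsub>V\<^esub> v) w"
  using T.tensor_lift_et[OF T.abelian_group_T balanced_scaled_pure]
  by (simp add: tensor_def Let_def flip: pure_elementary)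

lemma smult_pair_sum:
  assumes "c \<in> carrier K" "set ps \<subseteq> carrier V \<times> carrier W"
  shows "c \<odot>\<^bsub>tensor K V W\<^esub> pair_sum (tensor K V W) (pure K V W) ps =
    pair_sum (tensor K V W) (\<lambda>v w. pure K V W (c \<odot>\<^bsub>V\<^esub> v) w) ps"
  using additive_map_pair_sum[OF tensor_abelian_group tensor_abelian_group smult_additive[OF assms(1)]
      assms(2) pure_closed] pair_sum_cong[OF assms(2) smult_pure[OF assms(1)], where G="tensor K V W"] by simp

lemma tensor_vspace: "vspace K (tensor K V W)"
proof -
  let ?T = "tensor K V W"
  interpret G: abelian_group ?T by (rule tensor_abelian_group)
  have "module K ?T"
  proof (rule moduleI)
    show "cring K" by (rule V.is_cring)
    show "abelian_group ?T" by (rule tensor_abelian_group)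
    show "c \<odot>\<^bsub>?T\<^esub> X \<in> carrier ?T" if "c \<in> carrier K" "X \<in> carrier ?T" for c X
      using smult_additive[OF that(1)] that(2) by (auto simp: additive_map_def)
    show "c \<odot>\<^bsub>?T\<^esub> (X \<oplus>\<^bsub>?T\<^esub> Y) = c \<odot>\<^bsub>?T\<^esub> X \<oplus>\<^bsub>?T\<^esub> c \<odot>\<^bsub>?T\<^esub> Y"
      if "c \<in> carrier K" "X \<in> carrier ?T" "Y \<in> carrier ?T" for c X Y
      using smult_additive[OF that(1)] that(2,3) by (auto simp: additive_map_def)
  next
    fix c d X assume a: "c \<in> carrier K" "d \<in> carrier K" "X \<in> carrier ?T"
    obtain ps where ps: "set ps \<subseteq> carrier V \<times> carrier W" "X = pair_sum ?T (pure K V W) ps"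
      using tensor_exhaust a(3) by blast
    show "(c \<oplus>\<^bsub>K\<^esub> d) \<odot>\<^bsub>?T\<^esub> X = c \<odot>\<^bsub>?T\<^esub> X \<oplus>\<^bsub>?T\<^esub> d \<odot>\<^bsub>?T\<^esub> X"
      using a(1,2) unfolding ps(2)
      by (simp add: smult_pair_sum[OF _ ps(1)] G.pair_sum_add[OF ps(1), symmetric] pure_closed)
        (rule pair_sum_cong[OF ps(1)], simp add: V.smult_l_distr pure_add_left)
    have "set (map (\<lambda>(v, w). (d \<odot>\<^bsub>V\<^esub> v, w)) ps) \<subseteq> carrier V \<times> carrier W" using ps(1) a(2) by auto
    from smult_pair_sum[OF a(1) this]
    show "(c \<otimes>\<^bsub>K\<^esub> d) \<odot>\<^bsub>?T\<^esub> X = c \<odot>\<^bsub>?T\<^esub> (d \<odot>\<^bsub>?T\<^esub> X)"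
      using a(1,2) unfolding ps(2) pair_sum_map
      by (simp add: smult_pair_sum[OF _ ps(1)])
        (rule pair_sum_cong[OF ps(1)], simp add: V.smult_assoc1)
  next
    fix X assume "X \<in> carrier ?T"
    then obtain ps where ps: "set ps \<subseteq> carrier V \<times> carrier W" "X = pair_sum ?T (pure K V W) ps"
      using tensor_exhaust by blast
    show "\<one>\<^bsub>K\<^esub> \<odot>\<^bsub>?T\<^esub> X = X"
      unfolding ps(2) smult_pair_sum[OF V.one_closed ps(1)] by (rule pair_sum_cong[OF ps(1)]) simp
  qed
  then show ?thesis by (simp add: vspace_def V.field_axioms)
qed

lemma pure_bilinear: "bilinear K V W (tensor K V W) (pure K V W)"
  by (intro bilinearI linear_mapsI)
    (simp_all add: pure_closed pure_add_left pure_add_right smult_pure flip: pure_middle)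

lemma tensor_lift_pair_sum:
  assumes "vspace K G" "bilinear K V W G \<beta>" "set ps \<subseteq> carrier V \<times> carrier W"
  shows "tensor_lift G \<beta> (pair_sum (tensor K V W) (pure K V W) ps) = pair_sum G \<beta> ps"
  using T.tensor_lift_pair_sum[OF vspace_abelian_group[OF assms(1)] bilinear_balanced[OF assms(2)] assms(3)]
  by (simp add: pure_elementary pair_sum_tensor)

lemma tensor_lift_pure:
  assumes "vspace K G" "bilinear K V W G \<beta>" "v \<in> carrier V" "w \<in> carrier W"
  shows "tensor_lift G \<beta> (pure K V W v w) = \<beta> v w"
  using T.tensor_lift_et[OF vspace_abelian_group[OF assms(1)] bilinear_balanced[OF assms(2)] assms(3,4)]
  by (simp add: pure_elementary)

lemma tensor_lift_linear:
  assumes G: "vspace K G" and \<beta>: "bilinear K V W G \<beta>"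
  shows "tensor_lift G \<beta> \<in> linear_maps K (tensor K V W) G"
proof (rule linear_mapsI)
  have ad: "additive_map (tensor K V W) G (tensor_lift G \<beta>)"
    using T.tensor_lift_additive[OF vspace_abelian_group[OF G] bilinear_balanced[OF \<beta>]]
    by (simp add: additive_map_tensor)
  show "tensor_lift G \<beta> X \<in> carrier G" if "X \<in> carrier (tensor K V W)" for X
    using ad that by (auto simp: additive_map_def)
  show "tensor_lift G \<beta> (X \<oplus>\<^bsub>tensor K V W\<^esub> Y) = tensor_lift G \<beta> X \<oplus>\<^bsub>G\<^esub> tensor_lift G \<beta> Y"
    if "X \<in> carrier (tensor K V W)" "Y \<in> carrier (tensor K V W)" for X Y
    using ad that by (auto simp: additive_map_def)
  fix c X assume c: "c \<in> carrier K" and "X \<in> carrier (tensor K V W)"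
  then obtain ps where ps: "set ps \<subseteq> carrier V \<times> carrier W" "X = pair_sum (tensor K V W) (pure K V W) ps"
    using tensor_exhaust by blast
  have "tensor_lift G \<beta> (c \<odot>\<^bsub>tensor K V W\<^esub> X) = pair_sum G (\<lambda>v w. tensor_lift G \<beta> (pure K V W (c \<odot>\<^bsub>V\<^esub> v) w)) ps"
    unfolding ps(2) smult_pair_sum[OF c ps(1)]
    by (rule additive_map_pair_sum[OF tensor_abelian_group vspace_abelian_group[OF G] ad ps(1)])
      (simp add: c pure_closed)
  also have "\<dots> = pair_sum G (\<lambda>v w. c \<odot>\<^bsub>G\<^esub> \<beta> v w) ps"
    by (rule pair_sum_cong[OF ps(1)])
      (simp add: tensor_lift_pure[OF G \<beta>] c linear_maps_smult[OF bilinear_left[OF \<beta>]])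
  also have "\<dots> = c \<odot>\<^bsub>G\<^esub> tensor_lift G \<beta> X"
    unfolding ps(2) tensor_lift_pair_sum[OF G \<beta> ps(1)]
    by (rule linear_pair_sum[OF G G linear_smult[OF G c] ps(1), symmetric]) (rule bilinear_closed[OF \<beta>])
  finally show "tensor_lift G \<beta> (c \<odot>\<^bsub>tensor K V W\<^esub> X) = c \<odot>\<^bsub>G\<^esub> tensor_lift G \<beta> X" .
qed

end

text \<open>An arbitrary presentation of a tensor as a sum of elementary tensors. Only sums of
  bilinear maps over this list are meaningful; they do not depend on the choice.\<close>

definition terms :: "'k ring \<Rightarrow> ('k, 'v) module \<Rightarrow> ('k, 'w) module \<Rightarrow> ('v \<times> 'w \<Rightarrow>\<^sub>0 int) set \<Rightarrow> ('v \<times> 'w) list" where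
  "terms K V W X = (SOME ps. set ps \<subseteq> carrier V \<times> carrier W \<and> X = pair_sum (tensor K V W) (pure K V W) ps)"

context vspace_pair
begin

lemma terms:
  assumes "X \<in> carrier (tensor K V W)"
  shows "set (terms K V W X) \<subseteq> carrier V \<times> carrier W"
    and "pair_sum (tensor K V W) (pure K V W) (terms K V W X) = X"
  using someI_ex[of "\<lambda>ps. set ps \<subseteq> carrier V \<times> carrier W \<and> X = pair_sum (tensor K V W) (pure K V W) ps"]
    tensor_exhaust[OF assms] unfolding terms_def[symmetric] by metis+

lemma tensor_lift_terms:
  assumes "vspace K G" "bilinear K V W G \<beta>" "X \<in> carrier (tensor K V W)"
  shows "tensor_lift G \<beta> X = pair_sum G \<beta> (terms K V W X)"
  using tensor_lift_pair_sum[OF assms(1,2) terms(1)] terms(2) assms(3) by metis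

lemma linear_terms:
  assumes "vspace K G" "\<phi> \<in> linear_maps K (tensor K V W) G" "X \<in> carrier (tensor K V W)"
  shows "\<phi> X = pair_sum G (\<lambda>v w. \<phi> (pure K V W v w)) (terms K V W X)"
  by (subst terms(2)[OF assms(3), symmetric])
    (rule linear_pair_sum[OF tensor_vspace assms(1,2) terms(1)[OF assms(3)] pure_closed])

lemma linear_eq_on_pure:
  assumes "vspace K G" "\<phi> \<in> linear_maps K (tensor K V W) G" "\<psi> \<in> linear_maps K (tensor K V W) G"
    and eq: "\<And>v w. \<lbrakk>v \<in> carrier V; w \<in> carrier W\<rbrakk> \<Longrightarrow> \<phi> (pure K V W v w) = \<psi> (pure K V W v w)"
    and X: "X \<in> carrier (tensor K V W)"
  shows "\<phi> X = \<psi> X"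
  unfolding linear_terms[OF assms(1,2) X] linear_terms[OF assms(1,3) X]
  by (rule pair_sum_cong[OF terms(1)[OF X]]) (rule eq)

text \<open>The list chosen for \<open>\<phi> u\<close> does not depend on \<open>u\<close> in any regular way, but the sum over it
  is the value of a tensor lift, which is linear.\<close>

lemma linear_sum_terms:
  assumes "vspace K U" "vspace K G" "bilinear K V W G \<beta>" "\<phi> \<in> linear_maps K U (tensor K V W)"
  shows "(\<lambda>u. pair_sum G \<beta> (terms K V W (\<phi> u))) \<in> linear_maps K U G"
proof -
  have "(\<lambda>u. tensor_lift G \<beta> (\<phi> u)) \<in> linear_maps K U G"
    by (rule linear_comp[OF tensor_lift_linear[OF assms(2,3)] assms(4)])
  then show ?thesis
    by (rule linear_maps_cong[OF assms(1)])
      (rule tensor_lift_terms[OF assms(2,3) linear_maps_closed[OF assms(4)]])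
qed

end

context vspace_pair begin

text \<open>A nested Sweedler expression is a lift of a map that is known in closed form only for
  arguments in the carriers; this suffices.\<close>

lemma tensor_lift_terms_cong:
  assumes "vspace K G" "bilinear K V W G \<gamma>" "X \<in> carrier (tensor K V W)"
    and eq: "\<And>v w. \<lbrakk>v \<in> carrier V; w \<in> carrier W\<rbrakk> \<Longrightarrow> \<beta> v w = \<gamma> v w"
  shows "tensor_lift G \<beta> X = pair_sum G \<gamma> (terms K V W X)"
proof -
  have "bilinear K V W G \<beta>"
    using assms(2) unfolding bilinear_def
    by (auto simp: eq[symmetric] intro: linear_maps_cong[OF V.vspace_axioms] linear_maps_cong[OF W.vspace_axioms])
  then have "tensor_lift G \<beta> X = pair_sum G \<beta> (terms K V W X)"
    using assms by (intro tensor_lift_terms)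
  also have "\<dots> = pair_sum G \<gamma> (terms K V W X)"
    by (rule pair_sum_cong[OF terms(1)[OF assms(3)] eq])
  finally show ?thesis .
qed

text \<open>A presentation with other index sets may be used as well. This is the rule for tensors
  given by a formula, such as the coaction on \<open>f h\<close>.\<close>

lemma tensor_lift_sum_pure:
  assumes "vspace K G" "bilinear K V W G \<beta>" "set ps \<subseteq> P \<times> P'"
    and cl: "\<And>x y. \<lbrakk>x \<in> P; y \<in> P'\<rbrakk> \<Longrightarrow> \<phi> x y \<in> carrier V" "\<And>x y. \<lbrakk>x \<in> P; y \<in> P'\<rbrakk> \<Longrightarrow> \<psi> x y \<in> carrier W"
  shows "tensor_lift G \<beta> (pair_sum (tensor K V W) (\<lambda>x y. pure K V W (\<phi> x y) (\<psi> x y)) ps) =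
    pair_sum G (\<lambda>x y. \<beta> (\<phi> x y) (\<psi> x y)) ps"
proof -
  let ?ps = "map (\<lambda>(x, y). (\<phi> x y, \<psi> x y)) ps"
  have "set ?ps \<subseteq> carrier V \<times> carrier W" using assms(3) cl by auto
  from tensor_lift_pair_sum[OF assms(1,2) this] show ?thesis by (simp add: pair_sum_map)
qed

lemma pair_sum_terms_sum_pure:
  assumes "vspace K G" "bilinear K V W G \<beta>" "set ps \<subseteq> P \<times> P'"
    and cl: "\<And>x y. \<lbrakk>x \<in> P; y \<in> P'\<rbrakk> \<Longrightarrow> \<phi> x y \<in> carrier V" "\<And>x y. \<lbrakk>x \<in> P; y \<in> P'\<rbrakk> \<Longrightarrow> \<psi> x y \<in> carrier W"
    and X: "X = pair_sum (tensor K V W) (\<lambda>x y. pure K V W (\<phi> x y) (\<psi> x y)) ps"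
  shows "pair_sum G \<beta> (terms K V W X) = pair_sum G (\<lambda>x y. \<beta> (\<phi> x y) (\<psi> x y)) ps"
proof -
  have "X \<in> carrier (tensor K V W)"
    unfolding X by (rule abelian_group.pair_sum_closed[OF tensor_abelian_group assms(3)])
      (simp add: cl pure_closed)
  from tensor_lift_terms[OF assms(1,2) this] tensor_lift_sum_pure[OF assms(1-5)] X
  show ?thesis by simp
qed

lemma pair_sum_terms_pure:
  assumes "vspace K G" "bilinear K V W G \<beta>" "v \<in> carrier V" "w \<in> carrier W"
  shows "pair_sum G \<beta> (terms K V W (pure K V W v w)) = \<beta> v w"
  using tensor_lift_terms[OF assms(1,2) pure_closed[OF assms(3,4)]] tensor_lift_pure[OF assms] by simp

text \<open>The product of two tensors is defined by lifts into the underlying group of the tensor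
  product, a record different from the tensor product itself. Both lifts agree, being the same
  sum over a presentation.\<close>

lemma tensor_lift_into_group:
  assumes "vspace_pair K U Z" "bilinear K V W (tensor K U Z) \<beta>" "X \<in> carrier (tensor K V W)"
  shows "tensor_lift (tensor_group (carrier K) U Z (\<lambda>x c. c \<odot>\<^bsub>U\<^esub> x) (smult Z)) \<beta> X =
    pair_sum (tensor K U Z) \<beta> (terms K V W X)"
proof -
  interpret UZ: vspace_pair K U Z by fact
  have bal: "balanced (carrier K) V W (\<lambda>x c. c \<odot>\<^bsub>V\<^esub> x) (smult W) UZ.T.T \<beta>"
    using bilinear_balanced[OF assms(2)] by (simp add: balanced_def additive_map_tensor)
  show ?thesis
    using T.tensor_lift_pair_sum[OF UZ.T.abelian_group_T bal terms(1)[OF assms(3)]] terms(2)[OF assms(3)]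
    by (simp add: pure_elementary pair_sum_tensor)
qed

end

lemma linear_mult_left: "\<lbrakk>k_algebra K A; a \<in> carrier A; \<phi> \<in> linear_maps K V A\<rbrakk> \<Longrightarrow>
    (\<lambda>v. a \<otimes>\<^bsub>A\<^esub> \<phi> v) \<in> linear_maps K V A"
  by (rule linear_bilinear_right[OF bilinear_mult])

lemma linear_mult_right: "\<lbrakk>k_algebra K A; a \<in> carrier A; \<phi> \<in> linear_maps K V A\<rbrakk> \<Longrightarrow>
    (\<lambda>v. \<phi> v \<otimes>\<^bsub>A\<^esub> a) \<in> linear_maps K V A"
  by (rule linear_bilinear_left[OF bilinear_mult])


section \<open>The tensor product of two algebras\<close>

locale algebra_pair = A: k_algebra K A + B: k_algebra K B
  for K :: "'k ring" and A :: "('k, 'a) module" and B :: "('k, 'b) module"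
begin

sublocale vspace_pair K A B ..

abbreviation AB where "AB \<equiv> tensor K A B"
abbreviation pr where "pr \<equiv> pure K A B"
abbreviation tms where "tms \<equiv> terms K A B"

lemmas A_alg = A.k_algebra_axioms
lemmas B_alg = B.k_algebra_axioms

lemma pure_mult_bilinear:
  assumes "v \<in> carrier A" "w \<in> carrier B"
  shows "bilinear K A B AB (\<lambda>v' w'. pr (v \<otimes>\<^bsub>A\<^esub> v') (w \<otimes>\<^bsub>B\<^esub> w'))"
  using assms
  by (intro bilinearI linear_bilinear_right[OF pure_bilinear] linear_bilinear_left[OF pure_bilinear]
      linear_mult_left[OF A_alg] linear_mult_left[OF B_alg] linear_id) auto

lemma pure_mult_bilinear':
  assumes "v' \<in> carrier A" "w' \<in> carrier B"
  shows "bilinear K A B AB (\<lambda>v w. pr (v \<otimes>\<^bsub>A\<^esub> v') (w \<otimes>\<^bsub>B\<^esub> w'))"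
  using assms
  by (intro bilinearI linear_bilinear_right[OF pure_bilinear] linear_bilinear_left[OF pure_bilinear]
      linear_mult_right[OF A_alg] linear_mult_right[OF B_alg] linear_id) auto

lemma pure_mult_bilinear_sum:
  assumes "Y \<in> carrier AB"
  shows "bilinear K A B AB (\<lambda>v w. pair_sum AB (\<lambda>v' w'. pr (v \<otimes>\<^bsub>A\<^esub> v') (w \<otimes>\<^bsub>B\<^esub> w')) (tms Y))"
  by (intro bilinearI linear_sum[OF tensor_vspace terms(1)[OF assms]] bilinear_right[OF pure_mult_bilinear']
      bilinear_left[OF pure_mult_bilinear']) auto

lemma tensor_mult_terms:
  assumes X: "X \<in> carrier AB" and Y: "Y \<in> carrier AB"
  shows "X \<otimes>\<^bsub>AB\<^esub> Y = pair_sum AB (\<lambda>v w. pair_sum AB (\<lambda>v' w'. pr (v \<otimes>\<^bsub>A\<^esub> v') (w \<otimes>\<^bsub>B\<^esub> w')) (tms Y)) (tms X)"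
proof -
  let ?in = "\<lambda>v w. tensor_lift T.T (\<lambda>v' w'. pr (v \<otimes>\<^bsub>A\<^esub> v') (w \<otimes>\<^bsub>B\<^esub> w')) Y"
  have eq: "?in v w = pair_sum AB (\<lambda>v' w'. pr (v \<otimes>\<^bsub>A\<^esub> v') (w \<otimes>\<^bsub>B\<^esub> w')) (tms Y)"
    if "v \<in> carrier A" "w \<in> carrier B" for v w
    by (rule tensor_lift_into_group[OF vspace_pair_axioms pure_mult_bilinear[OF that] Y])
  have "bilinear K A B AB ?in"
    using pure_mult_bilinear_sum[OF Y] unfolding bilinear_def
    by (auto intro: linear_maps_cong[OF A.vspace_axioms] linear_maps_cong[OF B.vspace_axioms] simp: eq)
  from tensor_lift_into_group[OF vspace_pair_axioms this X]
  have "X \<otimes>\<^bsub>AB\<^esub> Y = pair_sum AB ?in (tms X)"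
    by (simp add: tensor_def Let_def)
  also have "\<dots> = pair_sum AB (\<lambda>v w. pair_sum AB (\<lambda>v' w'. pr (v \<otimes>\<^bsub>A\<^esub> v') (w \<otimes>\<^bsub>B\<^esub> w')) (tms Y)) (tms X)"
    by (rule pair_sum_cong[OF terms(1)[OF X]]) (rule eq)
  finally show ?thesis .
qed

lemma pure_mult:
  assumes "v \<in> carrier A" "w \<in> carrier B" "v' \<in> carrier A" "w' \<in> carrier B"
  shows "pr v w \<otimes>\<^bsub>AB\<^esub> pr v' w' = pr (v \<otimes>\<^bsub>A\<^esub> v') (w \<otimes>\<^bsub>B\<^esub> w')"
  unfolding tensor_mult_terms[OF pure_closed[OF assms(1,2)] pure_closed[OF assms(3,4)]]
  using assms
  by (simp add: pair_sum_terms_pure[OF tensor_vspace pure_mult_bilinear_sum] pure_closed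
      pair_sum_terms_pure[OF tensor_vspace pure_mult_bilinear])

lemma tensor_mult_bilinear: "bilinear K AB AB AB (mult AB)"
proof (rule bilinearI)
  fix X assume X: "X \<in> carrier AB"
  have "(\<lambda>Y. pair_sum AB (\<lambda>v w. pair_sum AB (\<lambda>v' w'. pr (v \<otimes>\<^bsub>A\<^esub> v') (w \<otimes>\<^bsub>B\<^esub> w')) (tms Y)) (tms X))
    \<in> linear_maps K AB AB"
    by (intro linear_sum[OF tensor_vspace terms(1)[OF X]] linear_sum_terms[OF tensor_vspace tensor_vspace]
        pure_mult_bilinear linear_id)
  then show "mult AB X \<in> linear_maps K AB AB"
    by (rule linear_maps_cong[OF tensor_vspace]) (simp add: tensor_mult_terms X)
next
  fix Y assume Y: "Y \<in> carrier AB"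
  have "(\<lambda>X. pair_sum AB (\<lambda>v w. pair_sum AB (\<lambda>v' w'. pr (v \<otimes>\<^bsub>A\<^esub> v') (w \<otimes>\<^bsub>B\<^esub> w')) (tms Y)) (tms X))
    \<in> linear_maps K AB AB"
    by (intro linear_sum_terms[OF tensor_vspace tensor_vspace pure_mult_bilinear_sum[OF Y]] linear_id)
  then show "(\<lambda>X. X \<otimes>\<^bsub>AB\<^esub> Y) \<in> linear_maps K AB AB"
    by (rule linear_maps_cong[OF tensor_vspace]) (simp add: tensor_mult_terms Y)
qed

lemmas mult_lin_right = linear_bilinear_right[OF tensor_mult_bilinear]
lemmas mult_lin_left = linear_bilinear_left[OF tensor_mult_bilinear]
lemmas mult_closed = bilinear_closed[OF tensor_mult_bilinear]

text \<open>All three factors enter linearly, so each can be replaced by an elementary tensor in turn.\<close>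

lemma tensor_mult_assoc:
  assumes "X \<in> carrier AB" "Y \<in> carrier AB" "Z \<in> carrier AB"
  shows "(X \<otimes>\<^bsub>AB\<^esub> Y) \<otimes>\<^bsub>AB\<^esub> Z = X \<otimes>\<^bsub>AB\<^esub> (Y \<otimes>\<^bsub>AB\<^esub> Z)"
proof -
  have 1: "(pr a b \<otimes>\<^bsub>AB\<^esub> pr a' b') \<otimes>\<^bsub>AB\<^esub> Z = pr a b \<otimes>\<^bsub>AB\<^esub> (pr a' b' \<otimes>\<^bsub>AB\<^esub> Z)"
    if "a \<in> carrier A" "b \<in> carrier B" "a' \<in> carrier A" "b' \<in> carrier B" for a b a' b'
    by (rule linear_eq_on_pure[OF tensor_vspace _ _ _ assms(3)])
      (use that in \<open>auto intro!: mult_lin_right linear_id pure_closed mult_closed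
        simp: pure_mult A.m_assoc B.m_assoc\<close>)
  have 2: "(pr a b \<otimes>\<^bsub>AB\<^esub> Y) \<otimes>\<^bsub>AB\<^esub> Z = pr a b \<otimes>\<^bsub>AB\<^esub> (Y \<otimes>\<^bsub>AB\<^esub> Z)"
    if "a \<in> carrier A" "b \<in> carrier B" for a b
    by (rule linear_eq_on_pure[OF tensor_vspace _ _ _ assms(2)])
      (use that assms in \<open>auto intro!: mult_lin_right mult_lin_left linear_id pure_closed mult_closed simp: 1\<close>)
  show ?thesis
    by (rule linear_eq_on_pure[OF tensor_vspace _ _ _ assms(1)])
      (use assms in \<open>auto intro!: mult_lin_right mult_lin_left linear_id pure_closed mult_closed simp: 2\<close>)
qed

lemma tensor_one: "\<one>\<^bsub>AB\<^esub> = pr \<one>\<^bsub>A\<^esub> \<one>\<^bsub>B\<^esub>"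
  by (simp add: tensor_def Let_def)

lemma tensor_algebra: "k_algebra K AB"
proof -
  have one: "\<one>\<^bsub>AB\<^esub> \<in> carrier AB" by (simp add: tensor_one pure_closed)
  have l_one: "\<one>\<^bsub>AB\<^esub> \<otimes>\<^bsub>AB\<^esub> X = X" if "X \<in> carrier AB" for X
    by (rule linear_eq_on_pure[OF tensor_vspace _ _ _ that])
      (auto intro!: mult_lin_right linear_id pure_closed simp: tensor_one pure_mult)
  have r_one: "X \<otimes>\<^bsub>AB\<^esub> \<one>\<^bsub>AB\<^esub> = X" if "X \<in> carrier AB" for X
    by (rule linear_eq_on_pure[OF tensor_vspace _ _ _ that])
      (auto intro!: mult_lin_left linear_id pure_closed simp: tensor_one pure_mult)
  have "ring AB"
  proof (rule ringI)
    show "monoid AB"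
      by (rule monoidI) (simp_all add: mult_closed one l_one r_one tensor_mult_assoc)
  qed (simp_all add: tensor_abelian_group linear_maps_add[OF bilinear_left[OF tensor_mult_bilinear]]
      linear_maps_add[OF bilinear_right[OF tensor_mult_bilinear]])
  then show ?thesis
    by (simp add: k_algebra_def k_algebra_axioms_def tensor_vspace
        linear_maps_smult[OF bilinear_left[OF tensor_mult_bilinear]]
        linear_maps_smult[OF bilinear_right[OF tensor_mult_bilinear]])
qed

end


section \<open>Quotient spaces\<close>

text \<open>The map induced on cosets; the image is a singleton when \<open>\<phi>\<close> is linear and vanishes on
  the subspace.\<close>

definition quotient_lift :: "('v \<Rightarrow> 'w) \<Rightarrow> 'v set \<Rightarrow> 'w" where
  "quotient_lift \<phi> X = the_elem (\<phi> ` X)"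

locale quotient_space = vspace K V for K :: "'k ring" and V :: "('k, 'v) module" +
  fixes N :: "'v set"
  assumes submodule_N: "submodule N K V"
begin

abbreviation Q where "Q \<equiv> quotient_module V N"

sublocale N: abelian_subgroup N V
  using submodule.axioms(1)[OF submodule_N] 
  by (intro abelian_subgroupI3 additive_subgroup.intro) (auto intro: M.abelian_group_axioms)

lemma N_smult: "\<lbrakk>c \<in> carrier K; x \<in> N\<rbrakk> \<Longrightarrow> c \<odot>\<^bsub>V\<^esub> x \<in> N"
  by (rule submodule.smult_closed[OF submodule_N])

lemma coset_eqI:
  assumes "x \<in> carrier V" "y \<in> carrier V" "x \<ominus>\<^bsub>V\<^esub> y \<in> N"
  shows "N +>\<^bsub>V\<^esub> x = N +>\<^bsub>V\<^esub> y"
  using N.a_rcos_module_rev[OF assms(2,1)] assms(3) a_repr_independence[OF _ assms(2) N.a_subgroup]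
  by (simp add: M.minus_eq)

lemma quotient_carrier: "carrier Q = (\<lambda>x. N +>\<^bsub>V\<^esub> x) ` carrier V"
  by (auto simp: quotient_module_def A_RCOSETS_def')

lemma quotient_add: "\<lbrakk>x \<in> carrier V; y \<in> carrier V\<rbrakk> \<Longrightarrow>
    (N +>\<^bsub>V\<^esub> x) \<oplus>\<^bsub>Q\<^esub> (N +>\<^bsub>V\<^esub> y) = N +>\<^bsub>V\<^esub> (x \<oplus>\<^bsub>V\<^esub> y)"
  by (simp add: quotient_module_def N.a_rcos_sum)

lemma quotient_zero: "\<zero>\<^bsub>Q\<^esub> = N +>\<^bsub>V\<^esub> \<zero>\<^bsub>V\<^esub>"
  by (simp add: quotient_module_def N.a_subset)

lemma quotient_smult:
  assumes "c \<in> carrier K" "x \<in> carrier V"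
  shows "c \<odot>\<^bsub>Q\<^esub> (N +>\<^bsub>V\<^esub> x) = N +>\<^bsub>V\<^esub> (c \<odot>\<^bsub>V\<^esub> x)"
proof -
  have "N +>\<^bsub>V\<^esub> (c \<odot>\<^bsub>V\<^esub> y) = N +>\<^bsub>V\<^esub> (c \<odot>\<^bsub>V\<^esub> x)" if y: "y \<in> N +>\<^bsub>V\<^esub> x" for y
  proof -
    obtain n where n: "n \<in> N" "y = n \<oplus>\<^bsub>V\<^esub> x" using y by (auto simp: a_r_coset_def')
    have nV: "n \<in> carrier V" using n(1) N.a_subset by blast
    have "c \<odot>\<^bsub>V\<^esub> y \<ominus>\<^bsub>V\<^esub> c \<odot>\<^bsub>V\<^esub> x = c \<odot>\<^bsub>V\<^esub> n"
      using assms nV by (simp add: n(2) smult_r_distr M.minus_eq M.a_assoc M.r_neg)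
    then show ?thesis
      using assms nV N_smult[OF assms(1) n(1)] n(2) by (intro coset_eqI) auto
  qed
  moreover have "x \<in> N +>\<^bsub>V\<^esub> x" using assms(2) by (rule N.a_rcos_self)
  ultimately show ?thesis
    unfolding quotient_module_def module.simps by (intro UN_constant_eq) blast+
qed

lemma quotient_abelian_group: "abelian_group Q"
proof (rule abelian_groupI)
  show "\<exists>Y\<in>carrier Q. Y \<oplus>\<^bsub>Q\<^esub> X = \<zero>\<^bsub>Q\<^esub>" if X: "X \<in> carrier Q" for X
  proof -
    obtain x where x: "x \<in> carrier V" "X = N +>\<^bsub>V\<^esub> x" using X by (auto simp: quotient_carrier)
    then show ?thesis
      by (intro bexI[of _ "N +>\<^bsub>V\<^esub> (\<ominus>\<^bsub>V\<^esub> x)"]) (auto simp: quotient_carrier quotient_add quotient_zero M.l_neg)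
  qed
  show "X \<oplus>\<^bsub>Q\<^esub> Y = Y \<oplus>\<^bsub>Q\<^esub> X" if "X \<in> carrier Q" "Y \<in> carrier Q" for X Y
    using that M.a_comm by (auto simp: quotient_carrier quotient_add)
qed (auto simp: quotient_carrier quotient_add quotient_zero M.a_assoc)

lemma quotient_vspace: "vspace K Q"
proof -
  have "module K Q"
    by (rule moduleI[OF is_cring quotient_abelian_group])
      (auto simp: quotient_carrier quotient_add quotient_smult smult_l_distr smult_r_distr smult_assoc1)
  then show ?thesis by (simp add: vspace_def field_axioms)
qed

lemma coset_linear: "(\<lambda>x. N +>\<^bsub>V\<^esub> x) \<in> linear_maps K V Q"
  by (rule linear_mapsI) (auto simp: quotient_carrier quotient_add quotient_smult)

lemma quotient_lift_coset:
  assumes W: "vspace K W" and \<phi>: "\<phi> \<in> linear_maps K V W" and N: "\<And>n. n \<in> N \<Longrightarrow> \<phi> n = \<zero>\<^bsub>W\<^esub>"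
    and x: "x \<in> carrier V"
  shows "quotient_lift \<phi> (N +>\<^bsub>V\<^esub> x) = \<phi> x"
proof -
  interpret W: vspace K W by fact
  have "\<phi> y = \<phi> x" if y: "y \<in> N +>\<^bsub>V\<^esub> x" for y
  proof -
    obtain n where n: "n \<in> N" "y = n \<oplus>\<^bsub>V\<^esub> x" using y by (auto simp: a_r_coset_def')
    have nV: "n \<in> carrier V" using n(1) N.a_subset by blast
    show ?thesis using linear_maps_add[OF \<phi> nV x] N[OF n(1)] linear_maps_closed[OF \<phi> x] n(2) by simp
  qed
  moreover have "x \<in> N +>\<^bsub>V\<^esub> x" using x by (rule N.a_rcos_self)
  ultimately show ?thesis
    unfolding quotient_lift_def by (intro the_elem_image_unique) blast+
qed

lemma quotient_lift_linear:
  assumes W: "vspace K W" and \<phi>: "\<phi> \<in> linear_maps K V W" and N: "\<And>n. n \<in> N \<Longrightarrow> \<phi> n = \<zero>\<^bsub>W\<^esub>"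
  shows "quotient_lift \<phi> \<in> linear_maps K Q W"
  by (rule linear_mapsI)
    (auto simp: quotient_carrier quotient_add quotient_smult quotient_lift_coset[OF assms]
      linear_maps_closed[OF \<phi>] linear_maps_add[OF \<phi>] linear_maps_smult[OF \<phi>])

end


section \<open>Sweedler calculus\<close>

definition trilinear ::
  "'k ring \<Rightarrow> ('k, 'u) module \<Rightarrow> ('k, 'v) module \<Rightarrow> ('k, 'w) module \<Rightarrow> ('k, 'b) module
    \<Rightarrow> ('u \<Rightarrow> 'v \<Rightarrow> 'w \<Rightarrow> 'b) \<Rightarrow> bool" where
  "trilinear K U V W G \<gamma> \<longleftrightarrow> (\<forall>u\<in>carrier U. bilinear K V W G (\<gamma> u)) \<and>
     (\<forall>v\<in>carrier V. \<forall>w\<in>carrier W. (\<lambda>u. \<gamma> u v w) \<in> linear_maps K U G)"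

lemma trilinearI:
  assumes "\<And>u v. \<lbrakk>u \<in> carrier U; v \<in> carrier V\<rbrakk> \<Longrightarrow> \<gamma> u v \<in> linear_maps K W G"
    "\<And>u w. \<lbrakk>u \<in> carrier U; w \<in> carrier W\<rbrakk> \<Longrightarrow> (\<lambda>v. \<gamma> u v w) \<in> linear_maps K V G"
    "\<And>v w. \<lbrakk>v \<in> carrier V; w \<in> carrier W\<rbrakk> \<Longrightarrow> (\<lambda>u. \<gamma> u v w) \<in> linear_maps K U G"
  shows "trilinear K U V W G \<gamma>"
  using assms by (simp add: trilinear_def bilinear_def)

lemma trilinear_bilinear: "\<lbrakk>trilinear K U V W G \<gamma>; u \<in> carrier U\<rbrakk> \<Longrightarrow> bilinear K V W G (\<gamma> u)"
  and trilinear_linear: "\<lbrakk>trilinear K U V W G \<gamma>; v \<in> carrier V; w \<in> carrier W\<rbrakk> \<Longrightarrow>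
    (\<lambda>u. \<gamma> u v w) \<in> linear_maps K U G"
  by (simp_all add: trilinear_def)

lemma trilinear_bilinear_left:
  assumes "trilinear K U V W G \<gamma>" "w \<in> carrier W"
  shows "bilinear K U V G (\<lambda>u v. \<gamma> u v w)"
  using assms by (simp add: trilinear_def bilinear_def)

text \<open>A coalgebra coacts on itself, so the rules for coactions below also serve for the
  comultiplication.\<close>

lemma (in coalgebra) coalgebra_right_comodule: "right_comodule K H \<Delta> \<epsilon> H \<Delta>"
  by (simp add: right_comodule_def right_comodule_axioms_def coalgebra_axioms vspace_axioms
      comult_linear coassoc counit_right)

context right_comodule
begin

text \<open>Presentations of \<open>\<Delta> h\<close> and \<open>\<rho> m\<close>: a sum of \<open>\<beta> x y\<close> over \<open>cm h\<close> is what Sweedler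
  notation writes as \<open>\<beta>(h\<^sup>1, h\<^sup>2)\<close>, and a sum over \<open>cc m\<close> is the analogue for the coaction.\<close>

abbreviation cm where "cm h \<equiv> terms K H H (\<Delta> h)"
abbreviation cc where "cc m \<equiv> terms K M H (\<rho> m)"

lemma pair_HH: "vspace_pair K H H"
  and pair_MH: "vspace_pair K M H"
  by (simp_all add: vspace_pair_def vspace_axioms M.vspace_axioms)

lemma pair_M_HH: "vspace_pair K M (tensor K H H)"
  by (simp add: vspace_pair_def vspace_pair.tensor_vspace[OF pair_HH] M.vspace_axioms)

lemma comult_closed: "h \<in> carrier H \<Longrightarrow> \<Delta> h \<in> carrier (tensor K H H)"
  by (rule linear_maps_closed[OF comult_linear])

lemma coaction_closed: "m \<in> carrier M \<Longrightarrow> \<rho> m \<in> carrier (tensor K M H)"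
  by (rule linear_maps_closed[OF coaction_linear])

lemma cm_subset: "h \<in> carrier H \<Longrightarrow> set (cm h) \<subseteq> carrier H \<times> carrier H"
  by (rule vspace_pair.terms(1)[OF pair_HH comult_closed])

lemma cc_subset: "m \<in> carrier M \<Longrightarrow> set (cc m) \<subseteq> carrier M \<times> carrier H"
  by (rule vspace_pair.terms(1)[OF pair_MH coaction_closed])

text \<open>Coassociativity is an identity in \<open>M \<otimes> (H \<otimes> H)\<close>. Applying to both sides the linear map
  induced by \<open>\<gamma>\<close> gives the identity for every trilinear \<open>\<gamma>\<close>.\<close>

lemma coaction_coassoc_terms:
  assumes G: "vspace K G" and \<gamma>: "trilinear K M H H G \<gamma>" and m: "m \<in> carrier M"
  shows "pair_sum G (\<lambda>x y. pair_sum G (\<gamma> x) (cm y)) (cc m) =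
    pair_sum G (\<lambda>x y. pair_sum G (\<lambda>u v. \<gamma> u v y) (cc x)) (cc m)"
proof -
  let ?HH = "tensor K H H" and ?T = "tensor K M (tensor K H H)"
  interpret HH: vspace_pair K H H by (rule pair_HH)
  interpret MH: vspace_pair K M H by (rule pair_MH)
  interpret MHH: vspace_pair K M ?HH by (rule pair_M_HH)
  let ?L = "tensor_lift G (\<lambda>x. tensor_lift G (\<gamma> x))"
  have in_lin: "tensor_lift G (\<gamma> x) \<in> linear_maps K ?HH G" if "x \<in> carrier M" for x
    by (rule HH.tensor_lift_linear[OF G trilinear_bilinear[OF \<gamma> that]])
  have L_bil: "bilinear K M ?HH G (\<lambda>x. tensor_lift G (\<gamma> x))"
  proof (rule bilinearI[OF in_lin])
    fix Y assume Y: "Y \<in> carrier ?HH"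
    have "(\<lambda>x. pair_sum G (\<gamma> x) (terms K H H Y)) \<in> linear_maps K M G"
      by (rule linear_sum[OF G HH.terms(1)[OF Y]]) (rule trilinear_linear[OF \<gamma>])
    then show "(\<lambda>x. tensor_lift G (\<gamma> x) Y) \<in> linear_maps K M G"
      by (rule linear_maps_cong[OF M.vspace_axioms])
        (simp add: HH.tensor_lift_terms[OF G trilinear_bilinear[OF \<gamma>] Y])
  qed
  note L_lin = MHH.tensor_lift_linear[OF G L_bil]
  have left_bil: "bilinear K M H ?T (\<lambda>x y. pure K M ?HH x (\<Delta> y))"
    by (intro bilinearI linear_bilinear_right[OF MHH.pure_bilinear] linear_bilinear_left[OF MHH.pure_bilinear]
        comult_linear linear_id comult_closed)
  have "?L (tensor_lift ?T (\<lambda>x y. pure K M ?HH x (\<Delta> y)) (\<rho> m)) =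
      pair_sum G (\<lambda>x y. ?L (pure K M ?HH x (\<Delta> y))) (cc m)"
    unfolding MH.tensor_lift_terms[OF MHH.tensor_vspace left_bil coaction_closed[OF m]]
    by (rule linear_pair_sum[OF MHH.tensor_vspace G L_lin cc_subset[OF m] bilinear_closed[OF left_bil]])
  also have "\<dots> = pair_sum G (\<lambda>x y. pair_sum G (\<gamma> x) (cm y)) (cc m)"
    by (rule pair_sum_cong[OF cc_subset[OF m]])
      (simp add: MHH.tensor_lift_pure[OF G L_bil] comult_closed HH.tensor_lift_terms[OF G trilinear_bilinear[OF \<gamma>]])
  finally have left: "?L (tensor_lift ?T (\<lambda>x y. pure K M ?HH x (\<Delta> y)) (\<rho> m)) = \<dots>" .
  let ?R = "\<lambda>x y. tensor_lift ?T (\<lambda>x0 x1. pure K M ?HH x0 (pure K H H x1 y)) (\<rho> x)"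
  have tri: "trilinear K M H H ?T (\<lambda>x0 x1 y. pure K M ?HH x0 (pure K H H x1 y))"
    by (intro trilinearI linear_bilinear_right[OF MHH.pure_bilinear] linear_bilinear_left[OF MHH.pure_bilinear]
      linear_bilinear_right[OF HH.pure_bilinear] linear_bilinear_left[OF HH.pure_bilinear] linear_id HH.pure_closed)
  note R_bil0 = trilinear_bilinear_left[OF tri]
  have R_eq: "?R x y = pair_sum ?T (\<lambda>x0 x1. pure K M ?HH x0 (pure K H H x1 y)) (cc x)"
    if "x \<in> carrier M" "y \<in> carrier H" for x y
    by (rule MH.tensor_lift_terms[OF MHH.tensor_vspace R_bil0[OF that(2)] coaction_closed[OF that(1)]])
  have R_bil: "bilinear K M H ?T (\<lambda>x y. pair_sum ?T (\<lambda>x0 x1. pure K M ?HH x0 (pure K H H x1 y)) (cc x))"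
  proof (rule bilinearI)
    show "(\<lambda>y. pair_sum ?T (\<lambda>x0 x1. pure K M ?HH x0 (pure K H H x1 y)) (cc x)) \<in> linear_maps K H ?T"
      if "x \<in> carrier M" for x
      by (rule linear_sum[OF MHH.tensor_vspace cc_subset[OF that]])
        (rule bilinear_right[OF trilinear_bilinear[OF tri]])
    show "(\<lambda>x. pair_sum ?T (\<lambda>x0 x1. pure K M ?HH x0 (pure K H H x1 y)) (cc x)) \<in> linear_maps K M ?T"
      if "y \<in> carrier H" for y
      by (rule MH.linear_sum_terms[OF M.vspace_axioms MHH.tensor_vspace R_bil0[OF that] coaction_linear])
  qed
  have "tensor_lift ?T ?R (\<rho> m) =
      pair_sum ?T (\<lambda>x y. pair_sum ?T (\<lambda>x0 x1. pure K M ?HH x0 (pure K H H x1 y)) (cc x)) (cc m)"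
    by (rule MH.tensor_lift_terms_cong[OF MHH.tensor_vspace R_bil coaction_closed[OF m] R_eq])
  then have "?L (tensor_lift ?T ?R (\<rho> m)) =
    pair_sum G (\<lambda>x y. ?L (pair_sum ?T (\<lambda>x0 x1. pure K M ?HH x0 (pure K H H x1 y)) (cc x))) (cc m)"
    by (simp only:) (rule linear_pair_sum[OF MHH.tensor_vspace G L_lin cc_subset[OF m] bilinear_closed[OF R_bil]])
  also have "\<dots> = pair_sum G (\<lambda>x y. pair_sum G (\<lambda>u v. \<gamma> u v y) (cc x)) (cc m)"
  proof (rule pair_sum_cong[OF cc_subset[OF m]])
    fix x y assume xy: "x \<in> carrier M" "y \<in> carrier H"
    have "?L (pair_sum ?T (\<lambda>x0 x1. pure K M ?HH x0 (pure K H H x1 y)) (cc x)) =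
        pair_sum G (\<lambda>x0 x1. ?L (pure K M ?HH x0 (pure K H H x1 y))) (cc x)"
      by (rule linear_pair_sum[OF MHH.tensor_vspace G L_lin cc_subset[OF xy(1)]])
        (simp add: MHH.pure_closed HH.pure_closed xy)
    also have "\<dots> = pair_sum G (\<lambda>u v. \<gamma> u v y) (cc x)"
      by (rule pair_sum_cong[OF cc_subset[OF xy(1)]])
        (simp add: MHH.tensor_lift_pure[OF G L_bil] HH.pure_closed xy
          HH.tensor_lift_pure[OF G trilinear_bilinear[OF \<gamma>]])
    finally show "?L (pair_sum ?T (\<lambda>x0 x1. pure K M ?HH x0 (pure K H H x1 y)) (cc x)) = \<dots>" .
  qed
  finally have right: "?L (tensor_lift ?T ?R (\<rho> m)) = \<dots>" .
  show ?thesis using left right coaction_coassoc[OF m] by simp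
qed

lemma coaction_counit_terms:
  assumes G: "vspace K G" and \<phi>: "\<phi> \<in> linear_maps K M G" and m: "m \<in> carrier M"
  shows "pair_sum G (\<lambda>x y. \<epsilon> y \<odot>\<^bsub>G\<^esub> \<phi> x) (cc m) = \<phi> m"
proof -
  interpret MH: vspace_pair K M H by (rule pair_MH)
  have e: "\<epsilon> y \<in> carrier (ground_module K)" "\<epsilon> y \<in> carrier K" if "y \<in> carrier H" for y
    using linear_maps_closed[OF counit_linear that] by (simp_all add: ground_module_def)
  have bil: "bilinear K M H M (\<lambda>x y. \<epsilon> y \<odot>\<^bsub>M\<^esub> x)"
    by (intro bilinearI linear_bilinear_right[OF bilinear_smult[OF M.vspace_axioms]]
        linear_bilinear_left[OF bilinear_smult[OF M.vspace_axioms]] counit_linear linear_id e)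
  have "\<phi> m = \<phi> (pair_sum M (\<lambda>x y. \<epsilon> y \<odot>\<^bsub>M\<^esub> x) (cc m))"
    using coaction_counit[OF m] MH.tensor_lift_terms[OF M.vspace_axioms bil coaction_closed[OF m]] by simp
  also have "\<dots> = pair_sum G (\<lambda>x y. \<phi> (\<epsilon> y \<odot>\<^bsub>M\<^esub> x)) (cc m)"
    by (rule linear_pair_sum[OF M.vspace_axioms G \<phi> cc_subset[OF m] bilinear_closed[OF bil]])
  also have "\<dots> = pair_sum G (\<lambda>x y. \<epsilon> y \<odot>\<^bsub>G\<^esub> \<phi> x) (cc m)"
    by (rule pair_sum_cong[OF cc_subset[OF m]]) (simp add: linear_maps_smult[OF \<phi>] e)
  finally show ?thesis by simp
qed

end

context coalgebra
begin

lemmas coassoc_terms = right_comodule.coaction_coassoc_terms[OF coalgebra_right_comodule]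
lemmas counit_right_terms = right_comodule.coaction_counit_terms[OF coalgebra_right_comodule]

lemma counit_left_terms:
  assumes G: "vspace K G" and \<phi>: "\<phi> \<in> linear_maps K H G" and h: "h \<in> carrier H"
  shows "pair_sum G (\<lambda>x y. \<epsilon> x \<odot>\<^bsub>G\<^esub> \<phi> y) (terms K H H (\<Delta> h)) = \<phi> h"
proof -
  interpret HH: vspace_pair K H H by (rule right_comodule.pair_HH[OF coalgebra_right_comodule])
  have e: "\<epsilon> y \<in> carrier (ground_module K)" "\<epsilon> y \<in> carrier K" if "y \<in> carrier H" for y
    using linear_maps_closed[OF counit_linear that] by (simp_all add: ground_module_def)
  note cl = linear_maps_closed[OF comult_linear h]
  have bil: "bilinear K H H H (\<lambda>x y. \<epsilon> x \<odot>\<^bsub>H\<^esub> y)"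
    by (intro bilinearI linear_bilinear_right[OF bilinear_smult[OF vspace_axioms]]
        linear_bilinear_left[OF bilinear_smult[OF vspace_axioms]] counit_linear linear_id e)
  have "\<phi> h = \<phi> (pair_sum H (\<lambda>x y. \<epsilon> x \<odot>\<^bsub>H\<^esub> y) (terms K H H (\<Delta> h)))"
    using counit_left[OF h] HH.tensor_lift_terms[OF vspace_axioms bil cl] by simp
  also have "\<dots> = pair_sum G (\<lambda>x y. \<phi> (\<epsilon> x \<odot>\<^bsub>H\<^esub> y)) (terms K H H (\<Delta> h))"
    by (rule linear_pair_sum[OF vspace_axioms G \<phi> HH.terms(1)[OF cl] bilinear_closed[OF bil]])
  also have "\<dots> = pair_sum G (\<lambda>x y. \<epsilon> x \<odot>\<^bsub>G\<^esub> \<phi> y) (terms K H H (\<Delta> h))"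
    by (rule pair_sum_cong[OF HH.terms(1)[OF cl]]) (simp add: linear_maps_smult[OF \<phi>] e)
  finally show ?thesis by simp
qed

text \<open>In the convolution algebra of linear maps from \<open>H\<close> to \<open>R\<close> a left inverse \<open>p\<close> and a right
  inverse \<open>s\<close> of \<open>q\<close> coincide: \<open>p = p * (q * s) = (p * q) * s = s\<close>.\<close>

lemma convolution_inverse_unique:
  assumes R: "k_algebra K R"
    and p: "p \<in> linear_maps K H R" and q: "q \<in> linear_maps K H R" and s: "s \<in> linear_maps K H R"
    and pq: "\<And>h. h \<in> carrier H \<Longrightarrow> pair_sum R (\<lambda>x y. p x \<otimes>\<^bsub>R\<^esub> q y) (terms K H H (\<Delta> h)) = \<epsilon> h \<odot>\<^bsub>R\<^esub> \<one>\<^bsub>R\<^esub>"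
    and qs: "\<And>h. h \<in> carrier H \<Longrightarrow> pair_sum R (\<lambda>x y. q x \<otimes>\<^bsub>R\<^esub> s y) (terms K H H (\<Delta> h)) = \<epsilon> h \<odot>\<^bsub>R\<^esub> \<one>\<^bsub>R\<^esub>"
    and h: "h \<in> carrier H"
  shows "p h = s h"
proof -
  interpret R: k_algebra K R by fact
  let ?d = "\<lambda>h. terms K H H (\<Delta> h)"
  note d = right_comodule.cm_subset[OF coalgebra_right_comodule]
  note cl = linear_maps_closed[OF p] linear_maps_closed[OF q] linear_maps_closed[OF s]
  note Rv = R.vspace_axioms
  have e: "\<epsilon> y \<in> carrier K" if "y \<in> carrier H" for y
    using linear_maps_closed[OF counit_linear that] by (simp add: ground_module_def)
  have tri: "trilinear K H H H R (\<lambda>u v w. p u \<otimes>\<^bsub>R\<^esub> q v \<otimes>\<^bsub>R\<^esub> s w)"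
    by (intro trilinearI linear_mult_left[OF R] linear_mult_right[OF R] p q s cl R.m_closed)
  have "p h = pair_sum R (\<lambda>x y. \<epsilon> y \<odot>\<^bsub>R\<^esub> p x) (?d h)"
    by (rule counit_right_terms[OF Rv p h, symmetric])
  also have "\<dots> = pair_sum R (\<lambda>x y. pair_sum R (\<lambda>u v. p x \<otimes>\<^bsub>R\<^esub> q u \<otimes>\<^bsub>R\<^esub> s v) (?d y)) (?d h)"
  proof (rule pair_sum_cong[OF d[OF h]])
    fix x y assume xy: "x \<in> carrier H" "y \<in> carrier H"
    have "\<epsilon> y \<odot>\<^bsub>R\<^esub> p x = p x \<otimes>\<^bsub>R\<^esub> (\<epsilon> y \<odot>\<^bsub>R\<^esub> \<one>\<^bsub>R\<^esub>)"
      using xy by (simp add: R.smult_mult_right cl e)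
    also have "\<dots> = pair_sum R (\<lambda>u v. p x \<otimes>\<^bsub>R\<^esub> (q u \<otimes>\<^bsub>R\<^esub> s v)) (?d y)"
      unfolding qs[OF xy(2), symmetric]
      by (rule linear_pair_sum[OF Rv Rv linear_mult_left[OF R _ linear_id] d[OF xy(2)]])
        (simp_all add: cl xy)
    also have "\<dots> = pair_sum R (\<lambda>u v. p x \<otimes>\<^bsub>R\<^esub> q u \<otimes>\<^bsub>R\<^esub> s v) (?d y)"
      by (rule pair_sum_cong[OF d[OF xy(2)]]) (simp add: R.A.m_assoc cl xy)
    finally show "\<epsilon> y \<odot>\<^bsub>R\<^esub> p x = \<dots>" .
  qed
  also have "\<dots> = pair_sum R (\<lambda>x y. pair_sum R (\<lambda>u v. p u \<otimes>\<^bsub>R\<^esub> q v \<otimes>\<^bsub>R\<^esub> s y) (?d x)) (?d h)"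
    by (rule coassoc_terms[OF Rv tri h])
  also have "\<dots> = pair_sum R (\<lambda>x y. \<epsilon> x \<odot>\<^bsub>R\<^esub> s y) (?d h)"
  proof (rule pair_sum_cong[OF d[OF h]])
    fix x y assume xy: "x \<in> carrier H" "y \<in> carrier H"
    have "pair_sum R (\<lambda>u v. p u \<otimes>\<^bsub>R\<^esub> q v \<otimes>\<^bsub>R\<^esub> s y) (?d x) =
        pair_sum R (\<lambda>u v. p u \<otimes>\<^bsub>R\<^esub> q v) (?d x) \<otimes>\<^bsub>R\<^esub> s y"
      by (rule linear_pair_sum[OF Rv Rv linear_mult_right[OF R _ linear_id] d[OF xy(1)], symmetric])
        (simp_all add: cl xy)
    also have "\<dots> = \<epsilon> x \<odot>\<^bsub>R\<^esub> s y"
      unfolding pq[OF xy(1)] using xy by (simp add: R.smult_mult_left cl e)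
    finally show "pair_sum R (\<lambda>u v. p u \<otimes>\<^bsub>R\<^esub> q v \<otimes>\<^bsub>R\<^esub> s y) (?d x) = \<dots>" .
  qed
  also have "\<dots> = s h" by (rule counit_left_terms[OF Rv s h])
  finally show ?thesis .
qed

end

context algebra_pair
begin

text \<open>The product \<open>X Y\<close> is presented by the products of the terms of \<open>X\<close> and of \<open>Y\<close>; this
  turns multiplicativity of the coaction into a rule for Sweedler sums.\<close>

lemma pair_sum_terms_mult:
  assumes G: "vspace K G" and \<beta>: "bilinear K A B G \<beta>" and X: "X \<in> carrier AB" and Y: "Y \<in> carrier AB"
  shows "pair_sum G \<beta> (tms (X \<otimes>\<^bsub>AB\<^esub> Y)) =
    pair_sum G (\<lambda>x y. pair_sum G (\<lambda>u v. \<beta> (x \<otimes>\<^bsub>A\<^esub> u) (y \<otimes>\<^bsub>B\<^esub> v)) (tms Y)) (tms X)"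
proof -
  note L = tensor_lift_linear[OF G \<beta>]
  have "pair_sum G \<beta> (tms (X \<otimes>\<^bsub>AB\<^esub> Y)) = tensor_lift G \<beta> (X \<otimes>\<^bsub>AB\<^esub> Y)"
    by (rule tensor_lift_terms[OF G \<beta> mult_closed[OF X Y], symmetric])
  also have "\<dots> = pair_sum G (\<lambda>x y. tensor_lift G \<beta>
      (pair_sum AB (\<lambda>u v. pr (x \<otimes>\<^bsub>A\<^esub> u) (y \<otimes>\<^bsub>B\<^esub> v)) (tms Y))) (tms X)"
    unfolding tensor_mult_terms[OF X Y]
    by (rule linear_pair_sum[OF tensor_vspace G L terms(1)[OF X] bilinear_closed[OF pure_mult_bilinear_sum[OF Y]]])
  also have "\<dots> = pair_sum G (\<lambda>x y. pair_sum G (\<lambda>u v. \<beta> (x \<otimes>\<^bsub>A\<^esub> u) (y \<otimes>\<^bsub>B\<^esub> v)) (tms Y)) (tms X)"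
    by (rule pair_sum_cong[OF terms(1)[OF X]], rule tensor_lift_sum_pure[OF G \<beta> terms(1)[OF Y]]) auto
  finally show ?thesis .
qed

end


section \<open>The translation map of a cleft extension\<close>

text \<open>Here \<open>f\<close> is the total integral and \<open>g\<close> its convolution inverse.\<close>

locale cleft_extension = hopf_galois_extension K H \<Delta> \<epsilon> S A \<rho>
  for K :: "'k ring" and H :: "('k, 'h) module"
    and \<Delta> :: "'h \<Rightarrow> ('h \<times> 'h \<Rightarrow>\<^sub>0 int) set" and \<epsilon> :: "'h \<Rightarrow> 'k" and S :: "'h \<Rightarrow> 'h"
    and A :: "('k, 'a) module" and \<rho> :: "'a \<Rightarrow> ('a \<times> 'h \<Rightarrow>\<^sub>0 int) set" +
  fixes f g :: "'h \<Rightarrow> 'a"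
  assumes total_integral: "total_integral K H \<Delta> A \<rho> f"
    and convolution_inverse: "convolution_inverse K H \<Delta> \<epsilon> A f g"
begin

lemma A_alg: "k_algebra K A" and H_alg: "k_algebra K H"
  by (rule A.k_algebra_axioms) (rule k_algebra_axioms)

lemma AH_pair: "algebra_pair K A H" and HH_pair: "algebra_pair K H H"
  by (simp_all add: algebra_pair_def A_alg H_alg)

sublocale AH: algebra_pair K A H by (rule AH_pair)
sublocale HH: algebra_pair K H H by (rule HH_pair)

abbreviation "AH \<equiv> tensor K A H"

lemma A_vspace [simp]: "vspace K A" and H_vspace [simp]: "vspace K H" and AH_vspace [simp]: "vspace K AH"
  using A_alg H_alg AH.tensor_vspace by (simp_all add: k_algebra_def)

lemma f_linear: "f \<in> linear_maps K H A" and f_one: "f \<one>\<^bsub>H\<^esub> = \<one>\<^bsub>A\<^esub>"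
  using total_integral by (simp_all add: total_integral_def)

lemma g_linear: "g \<in> linear_maps K H A"
  using convolution_inverse by (simp add: convolution_inverse_def)

lemma A_mult_closed [simp]: "\<lbrakk>a \<in> carrier A; b \<in> carrier A\<rbrakk> \<Longrightarrow> a \<otimes>\<^bsub>A\<^esub> b \<in> carrier A"
  and A_one_closed [simp]: "\<one>\<^bsub>A\<^esub> \<in> carrier A"
  and A_assoc: "\<lbrakk>a \<in> carrier A; b \<in> carrier A; c \<in> carrier A\<rbrakk> \<Longrightarrow> a \<otimes>\<^bsub>A\<^esub> b \<otimes>\<^bsub>A\<^esub> c = a \<otimes>\<^bsub>A\<^esub> (b \<otimes>\<^bsub>A\<^esub> c)"
  and A_l_one [simp]: "a \<in> carrier A \<Longrightarrow> \<one>\<^bsub>A\<^esub> \<otimes>\<^bsub>A\<^esub> a = a"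
  and A_r_one [simp]: "a \<in> carrier A \<Longrightarrow> a \<otimes>\<^bsub>A\<^esub> \<one>\<^bsub>A\<^esub> = a"
proof -
  have "monoid A" using A_alg by (simp add: k_algebra_def ring.is_monoid)
  then show "\<lbrakk>a \<in> carrier A; b \<in> carrier A\<rbrakk> \<Longrightarrow> a \<otimes>\<^bsub>A\<^esub> b \<in> carrier A" "\<one>\<^bsub>A\<^esub> \<in> carrier A"
    "\<lbrakk>a \<in> carrier A; b \<in> carrier A; c \<in> carrier A\<rbrakk> \<Longrightarrow> a \<otimes>\<^bsub>A\<^esub> b \<otimes>\<^bsub>A\<^esub> c = a \<otimes>\<^bsub>A\<^esub> (b \<otimes>\<^bsub>A\<^esub> c)"
    "a \<in> carrier A \<Longrightarrow> \<one>\<^bsub>A\<^esub> \<otimes>\<^bsub>A\<^esub> a = a" "a \<in> carrier A \<Longrightarrow> a \<otimes>\<^bsub>A\<^esub> \<one>\<^bsub>A\<^esub> = a"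
    by (simp_all add: monoid.m_closed monoid.one_closed monoid.m_assoc monoid.l_one monoid.r_one)
qed

lemma H_mult_closed [simp]: "\<lbrakk>a \<in> carrier H; b \<in> carrier H\<rbrakk> \<Longrightarrow> a \<otimes>\<^bsub>H\<^esub> b \<in> carrier H"
  and H_one_closed [simp]: "\<one>\<^bsub>H\<^esub> \<in> carrier H"
  and H_l_one [simp]: "a \<in> carrier H \<Longrightarrow> \<one>\<^bsub>H\<^esub> \<otimes>\<^bsub>H\<^esub> a = a"
  and H_r_one [simp]: "a \<in> carrier H \<Longrightarrow> a \<otimes>\<^bsub>H\<^esub> \<one>\<^bsub>H\<^esub> = a"
proof -
  have "monoid H" using H_alg by (simp add: k_algebra_def ring.is_monoid)
  then show "\<lbrakk>a \<in> carrier H; b \<in> carrier H\<rbrakk> \<Longrightarrow> a \<otimes>\<^bsub>H\<^esub> b \<in> carrier H" "\<one>\<^bsub>H\<^esub> \<in> carrier H"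
    "a \<in> carrier H \<Longrightarrow> \<one>\<^bsub>H\<^esub> \<otimes>\<^bsub>H\<^esub> a = a" "a \<in> carrier H \<Longrightarrow> a \<otimes>\<^bsub>H\<^esub> \<one>\<^bsub>H\<^esub> = a"
    by (simp_all add: monoid.m_closed monoid.one_closed monoid.m_assoc monoid.l_one monoid.r_one)
qed

lemma f_closed [simp]: "h \<in> carrier H \<Longrightarrow> f h \<in> carrier A"
  and g_closed [simp]: "h \<in> carrier H \<Longrightarrow> g h \<in> carrier A"
  and S_closed [simp]: "h \<in> carrier H \<Longrightarrow> S h \<in> carrier H"
  by (rule linear_maps_closed[OF f_linear] linear_maps_closed[OF g_linear] linear_maps_closed[OF antipode_linear], assumption)+

lemma eps_closed [simp]: "h \<in> carrier H \<Longrightarrow> \<epsilon> h \<in> carrier K"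
  using linear_maps_closed[OF counit_linear] by (simp add: ground_module_def)

lemmas [simp] = AH.pure_closed coaction_closed comult_closed

lemmas lin_f = linear_comp[OF f_linear]
  and lin_g = linear_comp[OF g_linear]
  and lin_S = linear_comp[OF antipode_linear]
  and lin_rho = linear_comp[OF coaction_linear]

lemma lin_cm:
  assumes "vspace K G" "h \<in> carrier H"
    "\<And>x y. \<lbrakk>x \<in> carrier H; y \<in> carrier H\<rbrakk> \<Longrightarrow> (\<lambda>v. \<beta> v x y) \<in> linear_maps K V G"
  shows "(\<lambda>v. pair_sum G (\<beta> v) (cm h)) \<in> linear_maps K V G"
  by (rule linear_sum[OF assms(1) cm_subset[OF assms(2)] assms(3)])

lemma lin_cc:
  assumes "vspace K G" "a \<in> carrier A"
    "\<And>x y. \<lbrakk>x \<in> carrier A; y \<in> carrier H\<rbrakk> \<Longrightarrow> (\<lambda>v. \<beta> v x y) \<in> linear_maps K V G"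
  shows "(\<lambda>v. pair_sum G (\<beta> v) (cc a)) \<in> linear_maps K V G"
  by (rule linear_sum[OF assms(1) cc_subset[OF assms(2)] assms(3)])

lemma lin_cm':
  assumes "vspace K V" "vspace K G" "bilinear K H H G \<beta>" "\<phi> \<in> linear_maps K V H"
  shows "(\<lambda>v. pair_sum G \<beta> (cm (\<phi> v))) \<in> linear_maps K V G"
  by (rule HH.linear_sum_terms[OF assms(1-3) linear_comp[OF comult_linear assms(4)]])

lemma lin_cc':
  assumes "vspace K V" "vspace K G" "bilinear K A H G \<beta>" "\<phi> \<in> linear_maps K V A"
  shows "(\<lambda>v. pair_sum G \<beta> (cc (\<phi> v))) \<in> linear_maps K V G"
  by (rule AH.linear_sum_terms[OF assms(1-3) linear_comp[OF coaction_linear assms(4)]])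

text \<open>Linearity in a single variable of a Sweedler expression, by following its syntax. The
  variable may occur in the summand or in the argument whose presentation is summed over.\<close>

lemmas lins = linear_id lin_f lin_g lin_S lin_rho
  linear_mult_left[OF A_alg] linear_mult_right[OF A_alg] linear_mult_left[OF H_alg] linear_mult_right[OF H_alg]
  linear_bilinear_right[OF AH.pure_bilinear] linear_bilinear_left[OF AH.pure_bilinear]
  lin_cm lin_cc lin_cm' lin_cc' bilinearI trilinearI

lemma cm_sum_closed [simp]:
  assumes "vspace K G" "h \<in> carrier H" "\<And>x y. \<lbrakk>x \<in> carrier H; y \<in> carrier H\<rbrakk> \<Longrightarrow> \<beta> x y \<in> carrier G"
  shows "pair_sum G \<beta> (cm h) \<in> carrier G"
  by (rule abelian_group.pair_sum_closed[OF vspace_abelian_group[OF assms(1)] cm_subset[OF assms(2)] assms(3)])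

lemma cc_sum_closed [simp]:
  assumes "vspace K G" "a \<in> carrier A" "\<And>x y. \<lbrakk>x \<in> carrier A; y \<in> carrier H\<rbrakk> \<Longrightarrow> \<beta> x y \<in> carrier G"
  shows "pair_sum G \<beta> (cc a) \<in> carrier G"
  by (rule abelian_group.pair_sum_closed[OF vspace_abelian_group[OF assms(1)] cc_subset[OF assms(2)] assms(3)])

lemmas cm_cong = pair_sum_cong[OF cm_subset]
  and cc_cong = pair_sum_cong[OF cc_subset]

lemma push_cm:
  assumes "vspace K V" "vspace K G" "\<phi> \<in> linear_maps K V G" "h \<in> carrier H"
    "\<And>x y. \<lbrakk>x \<in> carrier H; y \<in> carrier H\<rbrakk> \<Longrightarrow> \<beta> x y \<in> carrier V"
  shows "\<phi> (pair_sum V \<beta> (cm h)) = pair_sum G (\<lambda>x y. \<phi> (\<beta> x y)) (cm h)"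
  by (rule linear_pair_sum[OF assms(1-3) cm_subset[OF assms(4)] assms(5)])

lemma convolution_right:
  assumes h: "h \<in> carrier H"
  shows "pair_sum A (\<lambda>x y. f x \<otimes>\<^bsub>A\<^esub> g y) (cm h) = \<epsilon> h \<odot>\<^bsub>A\<^esub> \<one>\<^bsub>A\<^esub>"
proof -
  have "bilinear K H H A (\<lambda>x y. f x \<otimes>\<^bsub>A\<^esub> g y)" by (intro lins) simp_all
  from HH.tensor_lift_terms[OF A_vspace this comult_closed[OF h]]
  show ?thesis using convolution_inverse h by (simp add: convolution_inverse_def)
qed

lemma convolution_left:
  assumes h: "h \<in> carrier H"
  shows "pair_sum A (\<lambda>x y. g x \<otimes>\<^bsub>A\<^esub> f y) (cm h) = \<epsilon> h \<odot>\<^bsub>A\<^esub> \<one>\<^bsub>A\<^esub>"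
proof -
  have "bilinear K H H A (\<lambda>x y. g x \<otimes>\<^bsub>A\<^esub> f y)" by (intro lins) simp_all
  from HH.tensor_lift_terms[OF A_vspace this comult_closed[OF h]]
  show ?thesis using convolution_inverse h by (simp add: convolution_inverse_def)
qed

lemma antipode_right_terms:
  assumes h: "h \<in> carrier H"
  shows "pair_sum H (\<lambda>x y. x \<otimes>\<^bsub>H\<^esub> S y) (cm h) = \<epsilon> h \<odot>\<^bsub>H\<^esub> \<one>\<^bsub>H\<^esub>"
proof -
  have "bilinear K H H H (\<lambda>x y. x \<otimes>\<^bsub>H\<^esub> S y)" by (intro lins) simp_all
  from HH.tensor_lift_terms[OF H_vspace this comult_closed[OF h]]
  show ?thesis using antipode_right[OF h] by simp
qed

lemma coaction_f:
  assumes h: "h \<in> carrier H"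
  shows "\<rho> (f h) = pair_sum AH (\<lambda>x y. pure K A H (f x) y) (cm h)"
proof -
  have "bilinear K H H AH (\<lambda>x y. pure K A H (f x) y)" by (intro lins) simp_all
  from HH.tensor_lift_terms[OF AH_vspace this comult_closed[OF h]]
  show ?thesis using total_integral h by (simp add: total_integral_def)
qed

lemma cc_f:
  assumes "vspace K G" "bilinear K A H G \<beta>" "h \<in> carrier H"
  shows "pair_sum G \<beta> (cc (f h)) = pair_sum G (\<lambda>x y. \<beta> (f x) y) (cm h)"
  by (rule AH.pair_sum_terms_sum_pure[OF assms(1,2) cm_subset[OF assms(3)] _ _ coaction_f[OF assms(3)]]) simp_all

lemma coaction_mult: "\<lbrakk>a \<in> carrier A; b \<in> carrier A\<rbrakk> \<Longrightarrow> \<rho> (a \<otimes>\<^bsub>A\<^esub> b) = \<rho> a \<otimes>\<^bsub>AH\<^esub> \<rho> b"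
  by (rule ring_hom_mult[OF coaction_ring_hom])

lemma coaction_one: "\<rho> \<one>\<^bsub>A\<^esub> = pure K A H \<one>\<^bsub>A\<^esub> \<one>\<^bsub>H\<^esub>"
  using ring_hom_one[OF coaction_ring_hom] by (simp add: AH.tensor_one)

lemma cc_mult:
  assumes "vspace K G" "bilinear K A H G \<beta>" "a \<in> carrier A" "b \<in> carrier A"
  shows "pair_sum G \<beta> (cc (a \<otimes>\<^bsub>A\<^esub> b)) =
    pair_sum G (\<lambda>x y. pair_sum G (\<lambda>u v. \<beta> (x \<otimes>\<^bsub>A\<^esub> u) (y \<otimes>\<^bsub>H\<^esub> v)) (cc b)) (cc a)"
  unfolding coaction_mult[OF assms(3,4)]
  by (rule AH.pair_sum_terms_mult[OF assms(1,2)]) (simp_all add: assms)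

lemma cm_one:
  assumes "vspace K G" "bilinear K H H G \<beta>"
  shows "pair_sum G \<beta> (cm \<one>\<^bsub>H\<^esub>) = \<beta> \<one>\<^bsub>H\<^esub> \<one>\<^bsub>H\<^esub>"
  using HH.pair_sum_terms_pure[OF assms] ring_hom_one[OF comult_ring_hom] by (simp add: HH.tensor_one)

lemma g_one: "g \<one>\<^bsub>H\<^esub> = \<one>\<^bsub>A\<^esub>"
proof -
  have "bilinear K H H A (\<lambda>x y. f x \<otimes>\<^bsub>A\<^esub> g y)" by (intro lins) simp_all
  from cm_one[OF A_vspace this] have "g \<one>\<^bsub>H\<^esub> = \<epsilon> \<one>\<^bsub>H\<^esub> \<odot>\<^bsub>A\<^esub> \<one>\<^bsub>A\<^esub>"
    using convolution_right[of "\<one>\<^bsub>H\<^esub>"] by (simp add: f_one)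
  also have "\<dots> = \<one>\<^bsub>A\<^esub>"
    using ring_hom_one[OF counit_ring_hom] module.smult_one[OF vspace_module[OF A_vspace]] by simp
  finally show ?thesis .
qed

text \<open>The coaction on the convolution inverse: \<open>\<rho>(g(h)) = g(h\<^sup>2) \<otimes> S(h\<^sup>1)\<close>. Both sides are
  convolution inverse to \<open>\<rho> \<circ> f\<close> in the linear maps from \<open>H\<close> to \<open>A \<otimes> H\<close>, the left-hand side since \<open>\<rho>\<close> is an
  algebra map, the right-hand side since
  \<open>f(h\<^sup>1) g(h\<^sup>4) \<otimes> h\<^sup>2 S(h\<^sup>3)\<close> collapses first by the antipode and then by the inverse.\<close>

lemma coaction_g:
  assumes "h \<in> carrier H"
  shows "\<rho> (g h) = pair_sum AH (\<lambda>x y. pure K A H (g y) (S x)) (cm h)"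
proof (rule convolution_inverse_unique[OF AH.tensor_algebra, where p = "\<lambda>h. \<rho> (g h)" and q = "\<lambda>h. \<rho> (f h)", OF _ _ _ _ _ assms])
  show "(\<lambda>h. \<rho> (g h)) \<in> linear_maps K H AH" "(\<lambda>h. \<rho> (f h)) \<in> linear_maps K H AH"
    "(\<lambda>h. pair_sum AH (\<lambda>x y. pure K A H (g y) (S x)) (cm h)) \<in> linear_maps K H AH"
    by (intro lins; simp)+
next
  fix h assume h: "h \<in> carrier H"
  have "pair_sum AH (\<lambda>x y. \<rho> (g x) \<otimes>\<^bsub>AH\<^esub> \<rho> (f y)) (cm h) = pair_sum AH (\<lambda>x y. \<rho> (g x \<otimes>\<^bsub>A\<^esub> f y)) (cm h)"
    by (rule cm_cong[OF h]) (simp add: coaction_mult)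
  also have "\<dots> = \<rho> (\<epsilon> h \<odot>\<^bsub>A\<^esub> \<one>\<^bsub>A\<^esub>)"
    unfolding convolution_left[OF h, symmetric]
    by (rule push_cm[OF A_vspace AH_vspace coaction_linear h, symmetric]) simp
  also have "\<dots> = \<epsilon> h \<odot>\<^bsub>AH\<^esub> \<one>\<^bsub>AH\<^esub>"
    using h by (simp add: linear_maps_smult[OF coaction_linear] coaction_one AH.tensor_one)
  finally show "pair_sum AH (\<lambda>x y. \<rho> (g x) \<otimes>\<^bsub>AH\<^esub> \<rho> (f y)) (cm h) = \<dots>" .
next
  fix h assume h: "h \<in> carrier H"
  let ?s = "\<lambda>h. pair_sum AH (\<lambda>x y. pure K A H (g y) (S x)) (cm h)"
  let ?\<gamma> = "\<lambda>x u z w. pure K A H (f x \<otimes>\<^bsub>A\<^esub> g w) (u \<otimes>\<^bsub>H\<^esub> S z)"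
  have "pair_sum AH (\<lambda>x y. \<rho> (f x) \<otimes>\<^bsub>AH\<^esub> ?s y) (cm h) =
      pair_sum AH (\<lambda>x y. pair_sum AH (\<lambda>u v. pair_sum AH (?\<gamma> u v) (cm y)) (cm x)) (cm h)"
  proof (rule cm_cong[OF h])
    fix x y assume xy: "x \<in> carrier H" "y \<in> carrier H"
    have s: "?s y \<in> carrier AH" using xy by simp
    have "\<rho> (f x) \<otimes>\<^bsub>AH\<^esub> ?s y = pair_sum AH (\<lambda>u v. pure K A H (f u) v \<otimes>\<^bsub>AH\<^esub> ?s y) (cm x)"
      unfolding coaction_f[OF xy(1)]
      by (rule push_cm[OF AH_vspace AH_vspace AH.mult_lin_left[OF s linear_id] xy(1)]) simp
    also have "\<dots> = pair_sum AH (\<lambda>u v. pair_sum AH (?\<gamma> u v) (cm y)) (cm x)"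
    proof (rule cm_cong[OF xy(1)])
      fix u v assume uv: "u \<in> carrier H" "v \<in> carrier H"
      have "pure K A H (f u) v \<otimes>\<^bsub>AH\<^esub> ?s y =
          pair_sum AH (\<lambda>z w. pure K A H (f u) v \<otimes>\<^bsub>AH\<^esub> pure K A H (g w) (S z)) (cm y)"
        by (rule push_cm[OF AH_vspace AH_vspace AH.mult_lin_right[OF _ linear_id] xy(2)]) (simp_all add: uv)
      also have "\<dots> = pair_sum AH (?\<gamma> u v) (cm y)"
        by (rule cm_cong[OF xy(2)]) (simp add: AH.pure_mult uv)
      finally show "pure K A H (f u) v \<otimes>\<^bsub>AH\<^esub> ?s y = \<dots>" .
    qed
    finally show "\<rho> (f x) \<otimes>\<^bsub>AH\<^esub> ?s y = \<dots>" .
  qed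
  also have "\<dots> = pair_sum AH (\<lambda>x y. pair_sum AH (\<lambda>u v. pair_sum AH (?\<gamma> x u) (cm v)) (cm y)) (cm h)"
    by (rule coassoc_terms[symmetric, OF AH_vspace _ h]) (intro lins; simp)
  also have "\<dots> = pair_sum AH (\<lambda>x y. pure K A H (f x \<otimes>\<^bsub>A\<^esub> g y) \<one>\<^bsub>H\<^esub>) (cm h)"
  proof (rule cm_cong[OF h])
    fix x y assume xy: "x \<in> carrier H" "y \<in> carrier H"
    have "pair_sum AH (\<lambda>u v. pair_sum AH (?\<gamma> x u) (cm v)) (cm y) =
        pair_sum AH (\<lambda>u v. pair_sum AH (\<lambda>a b. ?\<gamma> x a b v) (cm u)) (cm y)"
      by (rule coassoc_terms[OF AH_vspace _ xy(2)]) (intro lins; simp add: xy)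
    also have "\<dots> = pair_sum AH (\<lambda>u v. \<epsilon> u \<odot>\<^bsub>AH\<^esub> pure K A H (f x \<otimes>\<^bsub>A\<^esub> g v) \<one>\<^bsub>H\<^esub>) (cm y)"
    proof (rule cm_cong[OF xy(2)])
      fix u v assume uv: "u \<in> carrier H" "v \<in> carrier H"
      \<comment> \<open>The two middle factors meet as \<open>a S(b)\<close>.\<close>
      have l: "pure K A H (f x \<otimes>\<^bsub>A\<^esub> g v) \<in> linear_maps K H AH"
        by (rule bilinear_right[OF AH.pure_bilinear]) (simp add: xy uv)
      have "pair_sum AH (\<lambda>a b. ?\<gamma> x a b v) (cm u) = pure K A H (f x \<otimes>\<^bsub>A\<^esub> g v) (\<epsilon> u \<odot>\<^bsub>H\<^esub> \<one>\<^bsub>H\<^esub>)"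
        unfolding antipode_right_terms[OF uv(1), symmetric]
        by (rule push_cm[OF H_vspace AH_vspace l uv(1), symmetric]) simp
      also have "\<dots> = \<epsilon> u \<odot>\<^bsub>AH\<^esub> pure K A H (f x \<otimes>\<^bsub>A\<^esub> g v) \<one>\<^bsub>H\<^esub>"
        by (rule linear_maps_smult[OF l]) (simp_all add: uv)
      finally show "pair_sum AH (\<lambda>a b. ?\<gamma> x a b v) (cm u) = \<dots>" .
    qed
    also have "\<dots> = pure K A H (f x \<otimes>\<^bsub>A\<^esub> g y) \<one>\<^bsub>H\<^esub>"
      by (rule counit_left_terms[OF AH_vspace _ xy(2)]) (intro lins; simp add: xy)
    finally show "pair_sum AH (\<lambda>u v. pair_sum AH (?\<gamma> x u) (cm v)) (cm y) = \<dots>" .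
  qed
  also have "\<dots> = pure K A H (\<epsilon> h \<odot>\<^bsub>A\<^esub> \<one>\<^bsub>A\<^esub>) \<one>\<^bsub>H\<^esub>"
    unfolding convolution_right[OF h, symmetric]
    by (rule push_cm[OF A_vspace AH_vspace bilinear_left[OF AH.pure_bilinear] h, symmetric]) simp_all
  also have "\<dots> = \<epsilon> h \<odot>\<^bsub>AH\<^esub> \<one>\<^bsub>AH\<^esub>"
    using h by (simp add: AH.tensor_one AH.smult_pure)
  finally show "pair_sum AH (\<lambda>x y. \<rho> (f x) \<otimes>\<^bsub>AH\<^esub> ?s y) (cm h) = \<dots>" .
qed

lemma cc_g:
  assumes "vspace K G" "bilinear K A H G \<beta>" "h \<in> carrier H"
  shows "pair_sum G \<beta> (cc (g h)) = pair_sum G (\<lambda>x y. \<beta> (g y) (S x)) (cm h)"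
  by (rule AH.pair_sum_terms_sum_pure[OF assms(1,2) cm_subset[OF assms(3)] _ _ coaction_g[OF assms(3)]]) simp_all

text \<open>The canonical map on the elementary tensor of \<open>a\<close> and \<open>a'\<close>.\<close>

definition can :: "'a \<Rightarrow> 'a \<Rightarrow> ('a \<times> 'h \<Rightarrow>\<^sub>0 int) set" where
  "can a a' = pair_sum AH (\<lambda>x y. pure K A H (a \<otimes>\<^bsub>A\<^esub> x) y) (cc a')"

lemma can_closed [simp]: "\<lbrakk>a \<in> carrier A; a' \<in> carrier A\<rbrakk> \<Longrightarrow> can a a' \<in> carrier AH"
  by (simp add: can_def)

lemma can_one:
  assumes "a \<in> carrier A" shows "can \<one>\<^bsub>A\<^esub> a = \<rho> a"
proof -
  have "can \<one>\<^bsub>A\<^esub> a = pair_sum AH (pure K A H) (cc a)"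
    unfolding can_def by (rule cc_cong[OF assms]) simp
  then show ?thesis using AH.terms(2)[OF coaction_closed[OF assms]] by simp
qed

text \<open>By colinearity of \<open>f\<close> the left-hand side is
  \<open>c g(h\<^sup>1) f(h\<^sup>2) e\<^sub>0 \<otimes> h\<^sup>3 e\<^sub>1\<close>, and the product of \<open>g\<close> and \<open>f\<close> collapses. For
  \<open>c = e = 1\<close> this says that \<open>g(h\<^sup>1) \<otimes> f(h\<^sup>2)\<close> is the preimage of \<open>1 \<otimes> h\<close> under the
  canonical map; the factors \<open>c\<close> and \<open>e\<close> allow all later identities to be compared after
  applying that map.\<close>

lemma can_translation:
  assumes c: "c \<in> carrier A" and e: "e \<in> carrier A" and h: "h \<in> carrier H"
  shows "pair_sum AH (\<lambda>x y. can (c \<otimes>\<^bsub>A\<^esub> g x) (f y \<otimes>\<^bsub>A\<^esub> e)) (cm h) =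
    pair_sum AH (\<lambda>u v. pure K A H (c \<otimes>\<^bsub>A\<^esub> u) (h \<otimes>\<^bsub>H\<^esub> v)) (cc e)"
proof -
  let ?\<tau> = "\<lambda>x p q. pair_sum AH (\<lambda>u v. pure K A H (c \<otimes>\<^bsub>A\<^esub> g x \<otimes>\<^bsub>A\<^esub> (f p \<otimes>\<^bsub>A\<^esub> u)) (q \<otimes>\<^bsub>H\<^esub> v)) (cc e)"
  \<comment> \<open>What remains once \<open>g\<close> and \<open>f\<close> have cancelled, as a function of the last factor of \<open>h\<close>.\<close>
  let ?\<phi> = "\<lambda>y. pair_sum AH (\<lambda>u v. pure K A H (c \<otimes>\<^bsub>A\<^esub> u) (y \<otimes>\<^bsub>H\<^esub> v)) (cc e)"
  have "pair_sum AH (\<lambda>x y. can (c \<otimes>\<^bsub>A\<^esub> g x) (f y \<otimes>\<^bsub>A\<^esub> e)) (cm h) =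
      pair_sum AH (\<lambda>x y. pair_sum AH (?\<tau> x) (cm y)) (cm h)"
  proof (rule cm_cong[OF h])
    fix x y assume xy: "x \<in> carrier H" "y \<in> carrier H"
    have "can (c \<otimes>\<^bsub>A\<^esub> g x) (f y \<otimes>\<^bsub>A\<^esub> e) = pair_sum AH (\<lambda>p q.
        pair_sum AH (\<lambda>u v. pure K A H (c \<otimes>\<^bsub>A\<^esub> g x \<otimes>\<^bsub>A\<^esub> (p \<otimes>\<^bsub>A\<^esub> u)) (q \<otimes>\<^bsub>H\<^esub> v)) (cc e)) (cc (f y))"
      unfolding can_def by (rule cc_mult[OF AH_vspace]) ((intro lins)?; simp add: c e xy)+
    also have "\<dots> = pair_sum AH (?\<tau> x) (cm y)"
      by (rule cc_f[OF AH_vspace _ xy(2)]) (intro lins; simp add: c e xy)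
    finally show "can (c \<otimes>\<^bsub>A\<^esub> g x) (f y \<otimes>\<^bsub>A\<^esub> e) = \<dots>" .
  qed
  also have "\<dots> = pair_sum AH (\<lambda>x y. pair_sum AH (\<lambda>u v. ?\<tau> u v y) (cm x)) (cm h)"
    by (rule coassoc_terms[OF AH_vspace _ h]) (intro lins; simp add: c e)
  also have "\<dots> = pair_sum AH (\<lambda>x y. \<epsilon> x \<odot>\<^bsub>AH\<^esub> ?\<phi> y) (cm h)"
  proof (rule cm_cong[OF h])
    fix x y assume xy: "x \<in> carrier H" "y \<in> carrier H"
    let ?\<chi> = "\<lambda>z. pair_sum AH (\<lambda>u v. pure K A H (c \<otimes>\<^bsub>A\<^esub> z \<otimes>\<^bsub>A\<^esub> u) (y \<otimes>\<^bsub>H\<^esub> v)) (cc e)"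
    have \<chi>: "?\<chi> \<in> linear_maps K A AH" by (intro lins; simp add: c e xy)
    have "pair_sum AH (\<lambda>u v. ?\<tau> u v y) (cm x) = pair_sum AH (\<lambda>u v. ?\<chi> (g u \<otimes>\<^bsub>A\<^esub> f v)) (cm x)"
      by (rule cm_cong[OF xy(1)], rule cc_cong[OF e]) (simp add: A_assoc c)
    also have "\<dots> = ?\<chi> (\<epsilon> x \<odot>\<^bsub>A\<^esub> \<one>\<^bsub>A\<^esub>)"
      unfolding convolution_left[OF xy(1), symmetric]
      by (rule push_cm[OF A_vspace AH_vspace \<chi> xy(1), symmetric]) simp
    also have "\<dots> = \<epsilon> x \<odot>\<^bsub>AH\<^esub> ?\<chi> \<one>\<^bsub>A\<^esub>"
      by (rule linear_maps_smult[OF \<chi>]) (simp_all add: xy)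
    also have "?\<chi> \<one>\<^bsub>A\<^esub> = ?\<phi> y"
      by (rule cc_cong[OF e]) (simp add: c)
    finally show "pair_sum AH (\<lambda>u v. ?\<tau> u v y) (cm x) = \<epsilon> x \<odot>\<^bsub>AH\<^esub> ?\<phi> y" .
  qed
  also have "\<dots> = ?\<phi> h"
    by (rule counit_left_terms[OF AH_vspace _ h]) (intro lins; simp add: c e)
  finally show ?thesis .
qed

end


section \<open>Linear spans\<close>

lemma linear_span_submodule:
  assumes "module K V" "X \<subseteq> carrier V"
  shows "submodule (linear_span K V X) K V"
proof -
  interpret module K V by fact
  have c: "linear_span K V X \<subseteq> carrier V"
    using carrier_is_submodule assms(2) by (auto simp: linear_span_def)
  show ?thesis
  proof (rule submoduleI[OF c])
    show "\<zero>\<^bsub>V\<^esub> \<in> linear_span K V X"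
      using submodule.axioms(1) subgroup.one_closed unfolding linear_span_def by fastforce
  qed (auto simp: linear_span_def submoduleE)
qed

lemma linear_span_incl: "X \<subseteq> linear_span K V X"
  by (auto simp: linear_span_def)

text \<open>The kernel is a subspace that contains the spanning set.\<close>

lemma linear_map_zero_on_span:
  assumes V: "vspace K V" and W: "vspace K W" and \<phi>: "\<phi> \<in> linear_maps K V W"
    and X: "X \<subseteq> carrier V" and zero: "\<And>x. x \<in> X \<Longrightarrow> \<phi> x = \<zero>\<^bsub>W\<^esub>" and n: "n \<in> linear_span K V X"
  shows "\<phi> n = \<zero>\<^bsub>W\<^esub>"
proof -
  interpret V: vspace K V by fact
  interpret W: vspace K W by fact
  have "submodule {x \<in> carrier V. \<phi> x = \<zero>\<^bsub>W\<^esub>} K V"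
    by (rule V.submoduleI)
      (auto simp: linear_maps_zero[OF V W \<phi>] linear_maps_minus[OF V W \<phi>] linear_maps_add[OF \<phi>] linear_maps_smult[OF \<phi>])
  then show ?thesis using n X zero by (auto simp: linear_span_def)
qed


section \<open>Maps factoring through the canonical map\<close>

context cleft_extension
begin

abbreviation "B \<equiv> coinvariants K H A \<rho>"

lemma B_subset: "b \<in> B \<Longrightarrow> b \<in> carrier A"
  and B_coaction: "b \<in> B \<Longrightarrow> \<rho> b = pure K A H b \<one>\<^bsub>H\<^esub>"
  by (simp_all add: coinvariants_def)

lemma A_abelian_group: "abelian_group A" and AH_abelian_group: "abelian_group AH"
  by (simp_all add: vspace_abelian_group[of K])

sublocale BT: tensor_factors A A B "mult A" "mult A"
  by (simp add: tensor_factors_def tensor_factors_axioms_def A_abelian_group B_subset)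

lemma can_bilinear: "bilinear K A A AH can"
  unfolding can_def by (intro lins; simp)

text \<open>A coinvariant \<open>b\<close> has \<open>\<rho>(b a') = b a'\<^sub>0 \<otimes> a'\<^sub>1\<close>.\<close>

lemma can_middle:
  assumes a: "a \<in> carrier A" and b: "b \<in> B" and a': "a' \<in> carrier A"
  shows "can (a \<otimes>\<^bsub>A\<^esub> b) a' = can a (b \<otimes>\<^bsub>A\<^esub> a')"
proof -
  note bA = B_subset[OF b]
  have "can a (b \<otimes>\<^bsub>A\<^esub> a') =
      pair_sum AH (\<lambda>p q. pair_sum AH (\<lambda>u v. pure K A H (a \<otimes>\<^bsub>A\<^esub> (p \<otimes>\<^bsub>A\<^esub> u)) (q \<otimes>\<^bsub>H\<^esub> v)) (cc a')) (cc b)"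
    unfolding can_def by (rule cc_mult[OF AH_vspace _ bA a']) (intro lins; simp add: a)
  also have "\<dots> = pair_sum AH (\<lambda>u v. pure K A H (a \<otimes>\<^bsub>A\<^esub> (b \<otimes>\<^bsub>A\<^esub> u)) (\<one>\<^bsub>H\<^esub> \<otimes>\<^bsub>H\<^esub> v)) (cc a')"
    unfolding B_coaction[OF b]
    by (rule AH.pair_sum_terms_pure[OF AH_vspace _ bA H_one_closed]) (intro lins; simp add: a a')
  also have "\<dots> = can (a \<otimes>\<^bsub>A\<^esub> b) a'"
    unfolding can_def by (rule cc_cong[OF a']) (simp add: A_assoc a bA)
  finally show ?thesis by simp
qed

lemma can_balanced: "balanced B A A (mult A) (mult A) AH can"
  using can_bilinear can_middle
  by (auto simp: balanced_def bilinear_def intro: linear_maps_additive)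

lemma canonical_map_et: "\<lbrakk>a \<in> carrier A; a' \<in> carrier A\<rbrakk> \<Longrightarrow>
    canonical_map K H A \<rho> (BT.et a a') = can a a'"
  and canonical_map_additive: "additive_map BT.T AH (canonical_map K H A \<rho>)"
proof -
  let ?c = "\<lambda>a a'. tensor_lift AH (\<lambda>x y. pure K A H (a \<otimes>\<^bsub>A\<^esub> x) y) (\<rho> a')"
  have eq: "?c a a' = can a a'" if "a \<in> carrier A" "a' \<in> carrier A" for a a'
    unfolding can_def
    by (rule AH.tensor_lift_terms[OF AH_vspace _ coaction_closed[OF that(2)]]) (intro lins; simp add: that)
  have bal: "balanced B A A (mult A) (mult A) AH ?c"
    using can_balanced module.axioms(2)[OF vspace_module[OF A_vspace]]
    by (simp add: balanced_def additive_map_def eq B_subset Pi_def abelian_monoid.a_closed abelian_group.axioms(1))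
  show "canonical_map K H A \<rho> (BT.et a a') = can a a'" if "a \<in> carrier A" "a' \<in> carrier A"
    unfolding canonical_map_def BT.tensor_lift_et[OF AH_abelian_group bal that] by (rule eq[OF that])
  show "additive_map BT.T AH (canonical_map K H A \<rho>)"
    unfolding canonical_map_def by (rule BT.tensor_lift_additive[OF AH_abelian_group bal])
qed

text \<open>This is how the Galois condition enters: a balanced map is a map on \<open>A \<otimes>\<^sub>B A\<close>, hence
  after composition with the inverse of the canonical map a map on \<open>A \<otimes> H\<close>. Two sums with the
  same image under \<open>can\<close> therefore have the same image under every balanced map.\<close>

lemma balanced_factors_through_can:
  assumes G: "abelian_group G" and \<gamma>: "balanced B A A (mult A) (mult A) G \<gamma>"
  obtains \<theta> where "additive_map AH G \<theta>"
    "\<And>a a'. \<lbrakk>a \<in> carrier A; a' \<in> carrier A\<rbrakk> \<Longrightarrow> \<theta> (can a a') = \<gamma> a a'"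
proof
  let ?can = "canonical_map K H A \<rho>"
  let ?inv = "inv_into (carrier BT.T) ?can"
  let ?\<theta> = "\<lambda>Z. tensor_lift G \<gamma> (?inv Z)"
  interpret T: abelian_group BT.T by (rule BT.abelian_group_T)
  have inj: "inj_on ?can (carrier BT.T)" and surj: "?can ` carrier BT.T = carrier AH"
    using canonical_bij by (auto simp: bij_betw_def)
  have inv: "?inv (?can X) = X" if "X \<in> carrier BT.T" for X
    by (rule inv_into_f_f[OF inj that])
  have can_add: "additive_map BT.T AH ?can"
    by (rule canonical_map_additive)
  note lift = BT.tensor_lift_additive[OF G \<gamma>]
  show "additive_map AH G ?\<theta>"
    unfolding additive_map_def
  proof (intro conjI ballI funcsetI)
    show "?\<theta> Z \<in> carrier G" if Z: "Z \<in> carrier AH" for Z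
    proof -
      obtain X where "X \<in> carrier BT.T" "Z = ?can X" using Z surj by blast
      then show ?thesis using lift inv by (auto simp: additive_map_def)
    qed
    fix Z Z' assume Z: "Z \<in> carrier AH" "Z' \<in> carrier AH"
    obtain X where X: "X \<in> carrier BT.T" "Z = ?can X" using Z(1) surj by blast
    obtain X' where X': "X' \<in> carrier BT.T" "Z' = ?can X'" using Z(2) surj by blast
    have s: "Z \<oplus>\<^bsub>AH\<^esub> Z' = ?can (X \<oplus>\<^bsub>BT.T\<^esub> X')"
      using can_add X X' by (simp add: additive_map_def)
    have "?inv (Z \<oplus>\<^bsub>AH\<^esub> Z') = X \<oplus>\<^bsub>BT.T\<^esub> X'" "?inv Z = X" "?inv Z' = X'"
      unfolding s using inv[OF T.a_closed[OF X(1) X'(1)]] inv[OF X(1)] inv[OF X'(1)]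
      by (simp_all add: X(2) X'(2))
    then show "?\<theta> (Z \<oplus>\<^bsub>AH\<^esub> Z') = ?\<theta> Z \<oplus>\<^bsub>G\<^esub> ?\<theta> Z'"
      using lift X(1) X'(1) by (simp add: additive_map_def)
  qed
  show "?\<theta> (can a a') = \<gamma> a a'" if a: "a \<in> carrier A" "a' \<in> carrier A" for a a'
    unfolding canonical_map_et[OF a, symmetric] inv[OF BT.et_closed[OF a]]
    by (rule BT.tensor_lift_et[OF G \<gamma> a])
qed


section \<open>The quotient by the commutators\<close>

abbreviation "N \<equiv> commutator_space K A B"
abbreviation "commutators \<equiv> {a \<otimes>\<^bsub>A\<^esub> b \<ominus>\<^bsub>A\<^esub> b \<otimes>\<^bsub>A\<^esub> a | a b. a \<in> carrier A \<and> b \<in> B}"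

lemma commutators_subset: "commutators \<subseteq> carrier A"
  using abelian_group.minus_closed[OF A_abelian_group] B_subset by auto

sublocale QA: quotient_space K A N
  using linear_span_submodule[OF vspace_module[OF A_vspace] commutators_subset]
  by (simp add: quotient_space_def quotient_space_axioms_def commutator_space_def)

abbreviation "Q \<equiv> quotient_module A N"
abbreviation "QH \<equiv> tensor K Q H"
abbreviation cls where "cls a \<equiv> N +>\<^bsub>A\<^esub> a"

lemma Q_vspace [simp]: "vspace K Q" by (rule QA.quotient_vspace)

sublocale QH: vspace_pair K Q H by (simp add: vspace_pair_def)

lemma QH_vspace [simp]: "vspace K QH" by (rule QH.tensor_vspace)

lemmas [simp] = QH.pure_closed

lemma cls_closed [simp]: "a \<in> carrier A \<Longrightarrow> cls a \<in> carrier Q"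
  by (rule linear_maps_closed[OF QA.coset_linear])

lemma cls_commute:
  assumes "a \<in> carrier A" "b \<in> B"
  shows "cls (a \<otimes>\<^bsub>A\<^esub> b) = cls (b \<otimes>\<^bsub>A\<^esub> a)"
  by (rule QA.coset_eqI)
    (use assms B_subset linear_span_incl[of commutators K A] in \<open>auto simp: commutator_space_def\<close>)

text \<open>The criterion for a linear map to descend to the quotient.\<close>

lemma linear_maps_vanish_N:
  assumes W: "vspace K W" and \<phi>: "\<phi> \<in> linear_maps K A W"
    and comm: "\<And>a b. \<lbrakk>a \<in> carrier A; b \<in> B\<rbrakk> \<Longrightarrow> \<phi> (a \<otimes>\<^bsub>A\<^esub> b) = \<phi> (b \<otimes>\<^bsub>A\<^esub> a)"
    and n: "n \<in> N"
  shows "\<phi> n = \<zero>\<^bsub>W\<^esub>"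
proof (rule linear_map_zero_on_span[OF A_vspace W \<phi> commutators_subset])
  show "n \<in> linear_span K A commutators" using n by (simp add: commutator_space_def)
next
  interpret W: vspace K W by fact
  fix x assume "x \<in> commutators"
  then obtain a b where x: "x = a \<otimes>\<^bsub>A\<^esub> b \<ominus>\<^bsub>A\<^esub> b \<otimes>\<^bsub>A\<^esub> a" and ab: "a \<in> carrier A" "b \<in> B" by blast
  note bA = B_subset[OF ab(2)]
  have "\<phi> x = \<phi> (a \<otimes>\<^bsub>A\<^esub> b) \<oplus>\<^bsub>W\<^esub> \<ominus>\<^bsub>W\<^esub> \<phi> (b \<otimes>\<^bsub>A\<^esub> a)"
    using ab bA abelian_group.a_inv_closed[OF A_abelian_group]
    by (simp add: x a_minus_def linear_maps_add[OF \<phi>] linear_maps_minus[OF A_vspace W \<phi>])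
  then show "\<phi> x = \<zero>\<^bsub>W\<^esub>"
    using comm[OF ab] linear_maps_closed[OF \<phi>] ab bA by (simp add: W.r_neg)
qed

lemmas lin_cls = linear_comp[OF QA.coset_linear]

lemmas qlins = lins lin_cls linear_bilinear_right[OF QH.pure_bilinear] linear_bilinear_left[OF QH.pure_bilinear]


section \<open>The induced action\<close>

text \<open>The action before passing to the quotient. It is in general not a module structure on
  \<open>A\<close>, because \<open>f\<close> need not be multiplicative; the module law holds only modulo \<open>N\<close>.\<close>

definition act0 :: "'h \<Rightarrow> 'a \<Rightarrow> 'a" where
  "act0 h a = pair_sum A (\<lambda>x y. f y \<otimes>\<^bsub>A\<^esub> a \<otimes>\<^bsub>A\<^esub> g x) (cm h)"

lemma act0_closed [simp]: "\<lbrakk>h \<in> carrier H; a \<in> carrier A\<rbrakk> \<Longrightarrow> act0 h a \<in> carrier A"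
  by (simp add: act0_def)

lemma act0_linear: "h \<in> carrier H \<Longrightarrow> act0 h \<in> linear_maps K A A"
  unfolding act0_def[abs_def] by (intro lins; simp)

lemma act0_linear_left: "a \<in> carrier A \<Longrightarrow> (\<lambda>h. act0 h a) \<in> linear_maps K H A"
  unfolding act0_def[abs_def] by (intro lins; simp)

text \<open>The map \<open>x \<otimes> y \<mapsto> y a x\<close> is balanced modulo commutators: moving a coinvariant \<open>b\<close> from
  \<open>x b\<close> to \<open>b y\<close> changes \<open>y a x b\<close> into \<open>b y a x\<close>. Applied to
  \<open>g(h\<^sup>1) \<otimes> f(h\<^sup>2)\<close> it gives the action of \<open>h\<close> on the class of \<open>a\<close>.\<close>

lemma sandwich_factors:
  assumes a: "a \<in> carrier A"
  obtains \<theta> where "additive_map AH Q \<theta>"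
    "\<And>x y. \<lbrakk>x \<in> carrier A; y \<in> carrier A\<rbrakk> \<Longrightarrow> \<theta> (can x y) = cls (y \<otimes>\<^bsub>A\<^esub> a \<otimes>\<^bsub>A\<^esub> x)"
proof -
  have bil: "bilinear K A A Q (\<lambda>x y. cls (y \<otimes>\<^bsub>A\<^esub> a \<otimes>\<^bsub>A\<^esub> x))"
    by (intro qlins; simp add: a)
  have mid: "cls (y \<otimes>\<^bsub>A\<^esub> a \<otimes>\<^bsub>A\<^esub> (x \<otimes>\<^bsub>A\<^esub> b)) = cls (b \<otimes>\<^bsub>A\<^esub> y \<otimes>\<^bsub>A\<^esub> a \<otimes>\<^bsub>A\<^esub> x)"
    if "x \<in> carrier A" "y \<in> carrier A" "b \<in> B" for x y b
    using cls_commute[of "y \<otimes>\<^bsub>A\<^esub> a \<otimes>\<^bsub>A\<^esub> x" b] that B_subset[OF that(3)] a by (simp add: A_assoc)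
  have "balanced B A A (mult A) (mult A) Q (\<lambda>x y. cls (y \<otimes>\<^bsub>A\<^esub> a \<otimes>\<^bsub>A\<^esub> x))"
    using bil mid by (auto simp: balanced_def bilinear_def intro: linear_maps_additive)
  from balanced_factors_through_can[OF vspace_abelian_group[OF Q_vspace] this] that show thesis by blast
qed

lemma push_additive_cm:
  assumes "additive_map AH Q \<theta>" "h \<in> carrier H"
    "\<And>x y. \<lbrakk>x \<in> carrier H; y \<in> carrier H\<rbrakk> \<Longrightarrow> \<beta> x y \<in> carrier AH"
  shows "\<theta> (pair_sum AH \<beta> (cm h)) = pair_sum Q (\<lambda>x y. \<theta> (\<beta> x y)) (cm h)"
  by (rule additive_map_pair_sum[OF AH_abelian_group vspace_abelian_group[OF Q_vspace] assms(1) cm_subset[OF assms(2)] assms(3)])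

lemma push_additive_cc:
  assumes "additive_map AH Q \<theta>" "a \<in> carrier A"
    "\<And>x y. \<lbrakk>x \<in> carrier A; y \<in> carrier H\<rbrakk> \<Longrightarrow> \<beta> x y \<in> carrier AH"
  shows "\<theta> (pair_sum AH \<beta> (cc a)) = pair_sum Q (\<lambda>x y. \<theta> (\<beta> x y)) (cc a)"
  by (rule additive_map_pair_sum[OF AH_abelian_group vspace_abelian_group[OF Q_vspace] assms(1) cc_subset[OF assms(2)] assms(3)])

lemma cls_act0:
  assumes "h \<in> carrier H" "a \<in> carrier A"
  shows "cls (act0 h a) = pair_sum Q (\<lambda>x y. cls (f y \<otimes>\<^bsub>A\<^esub> a \<otimes>\<^bsub>A\<^esub> g x)) (cm h)"
  unfolding act0_def
  by (rule push_cm[OF A_vspace Q_vspace QA.coset_linear assms(1)]) (simp add: assms)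

text \<open>The sandwich of \<open>e a c\<close> between \<open>f(h\<^sup>2)\<close> and \<open>g(h\<^sup>1)\<close> is computed from the
  value of \<open>can\<close> alone, which \<open>can_translation\<close> provides. The module law,
  the stability and the passage to the quotient all follow by suitable choices of
  \<open>c\<close>, \<open>e\<close> and \<open>a\<close>.\<close>

lemma theta_translation:
  assumes \<theta>: "additive_map AH Q \<theta>"
    "\<And>x y. \<lbrakk>x \<in> carrier A; y \<in> carrier A\<rbrakk> \<Longrightarrow> \<theta> (can x y) = cls (y \<otimes>\<^bsub>A\<^esub> a \<otimes>\<^bsub>A\<^esub> x)"
    and a: "a \<in> carrier A" and c: "c \<in> carrier A" and e: "e \<in> carrier A" and h: "h \<in> carrier H"
  shows "pair_sum Q (\<lambda>x y. cls (f y \<otimes>\<^bsub>A\<^esub> e \<otimes>\<^bsub>A\<^esub> a \<otimes>\<^bsub>A\<^esub> (c \<otimes>\<^bsub>A\<^esub> g x))) (cm h) =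
    \<theta> (pair_sum AH (\<lambda>u v. pure K A H (c \<otimes>\<^bsub>A\<^esub> u) (h \<otimes>\<^bsub>H\<^esub> v)) (cc e))"
proof -
  have "\<theta> (pair_sum AH (\<lambda>x y. can (c \<otimes>\<^bsub>A\<^esub> g x) (f y \<otimes>\<^bsub>A\<^esub> e)) (cm h)) =
    pair_sum Q (\<lambda>x y. \<theta> (can (c \<otimes>\<^bsub>A\<^esub> g x) (f y \<otimes>\<^bsub>A\<^esub> e))) (cm h)"
    by (rule push_additive_cm[OF \<theta>(1) h]) (simp add: c e)
  also have "\<dots> = pair_sum Q (\<lambda>x y. cls (f y \<otimes>\<^bsub>A\<^esub> e \<otimes>\<^bsub>A\<^esub> a \<otimes>\<^bsub>A\<^esub> (c \<otimes>\<^bsub>A\<^esub> g x))) (cm h)"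
    by (rule cm_cong[OF h]) (simp add: \<theta>(2) c e)
  finally show ?thesis by (simp add: can_translation[OF c e h])
qed

lemma cc_coinvariant:
  assumes "vspace K G" "bilinear K A H G \<beta>" "b \<in> B"
  shows "pair_sum G \<beta> (cc b) = \<beta> b \<one>\<^bsub>H\<^esub>"
  using AH.pair_sum_terms_pure[OF assms(1,2) B_subset[OF assms(3)] H_one_closed] B_coaction[OF assms(3)] by simp

lemma theta_translation_coinvariant:
  assumes \<theta>: "additive_map AH Q \<theta>"
    "\<And>x y. \<lbrakk>x \<in> carrier A; y \<in> carrier A\<rbrakk> \<Longrightarrow> \<theta> (can x y) = cls (y \<otimes>\<^bsub>A\<^esub> a \<otimes>\<^bsub>A\<^esub> x)"
    and a: "a \<in> carrier A" and c: "c \<in> carrier A" and b: "b \<in> B" and h: "h \<in> carrier H"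
  shows "pair_sum Q (\<lambda>x y. cls (f y \<otimes>\<^bsub>A\<^esub> b \<otimes>\<^bsub>A\<^esub> a \<otimes>\<^bsub>A\<^esub> (c \<otimes>\<^bsub>A\<^esub> g x))) (cm h) =
    \<theta> (pure K A H (c \<otimes>\<^bsub>A\<^esub> b) h)"
proof -
  have "bilinear K A H AH (\<lambda>u v. pure K A H (c \<otimes>\<^bsub>A\<^esub> u) (h \<otimes>\<^bsub>H\<^esub> v))"
    by (intro lins; simp add: h c)
  from cc_coinvariant[OF AH_vspace this b] theta_translation[OF \<theta> a c B_subset[OF b] h]
  show ?thesis using h by simp
qed

lemma one_in_B: "\<one>\<^bsub>A\<^esub> \<in> B"
  by (simp add: coinvariants_def coaction_one)

text \<open>Both sides come from tensors with the same canonical image \<open>b \<otimes> h\<close>: take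
  \<open>c = b\<close>, \<open>e = 1\<close> on the left and \<open>c = 1\<close>, \<open>e = b\<close> on the right.\<close>

lemma act0_commute:
  assumes h: "h \<in> carrier H" and a: "a \<in> carrier A" and b: "b \<in> B"
  shows "cls (act0 h (a \<otimes>\<^bsub>A\<^esub> b)) = cls (act0 h (b \<otimes>\<^bsub>A\<^esub> a))"
proof -
  note bA = B_subset[OF b]
  obtain \<theta> where \<theta>: "additive_map AH Q \<theta>"
    "\<And>x y. \<lbrakk>x \<in> carrier A; y \<in> carrier A\<rbrakk> \<Longrightarrow> \<theta> (can x y) = cls (y \<otimes>\<^bsub>A\<^esub> a \<otimes>\<^bsub>A\<^esub> x)"
    using sandwich_factors[OF a] by blast
  have "cls (act0 h (a \<otimes>\<^bsub>A\<^esub> b)) =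
      pair_sum Q (\<lambda>x y. cls (f y \<otimes>\<^bsub>A\<^esub> \<one>\<^bsub>A\<^esub> \<otimes>\<^bsub>A\<^esub> a \<otimes>\<^bsub>A\<^esub> (b \<otimes>\<^bsub>A\<^esub> g x))) (cm h)"
    unfolding cls_act0[OF h A_mult_closed[OF a bA]] by (rule cm_cong[OF h]) (simp add: A_assoc a bA)
  also have "\<dots> = \<theta> (pure K A H b h)"
    using theta_translation_coinvariant[OF \<theta> a bA one_in_B h] bA by simp
  also have "\<dots> = pair_sum Q (\<lambda>x y. cls (f y \<otimes>\<^bsub>A\<^esub> b \<otimes>\<^bsub>A\<^esub> a \<otimes>\<^bsub>A\<^esub> (\<one>\<^bsub>A\<^esub> \<otimes>\<^bsub>A\<^esub> g x))) (cm h)"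
    using theta_translation_coinvariant[OF \<theta> a A_one_closed b h] bA by simp
  also have "\<dots> = cls (act0 h (b \<otimes>\<^bsub>A\<^esub> a))"
    unfolding cls_act0[OF h A_mult_closed[OF bA a]] by (rule cm_cong[OF h]) (simp add: A_assoc a bA)
  finally show ?thesis .
qed

text \<open>The tensors \<open>g(k\<^sup>1) g(h\<^sup>1) \<otimes> f(h\<^sup>2) f(k\<^sup>2)\<close> and
  \<open>g((h k)\<^sup>1) \<otimes> f((h k)\<^sup>2)\<close> both have canonical image \<open>1 \<otimes> h k\<close>, although \<open>f\<close> need not
  be multiplicative.\<close>

lemma act0_mult:
  assumes h: "h \<in> carrier H" and k: "k \<in> carrier H" and a: "a \<in> carrier A"
  shows "cls (act0 (h \<otimes>\<^bsub>H\<^esub> k) a) = cls (act0 h (act0 k a))"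
proof -
  obtain \<theta> where \<theta>: "additive_map AH Q \<theta>"
    "\<And>x y. \<lbrakk>x \<in> carrier A; y \<in> carrier A\<rbrakk> \<Longrightarrow> \<theta> (can x y) = cls (y \<otimes>\<^bsub>A\<^esub> a \<otimes>\<^bsub>A\<^esub> x)"
    using sandwich_factors[OF a] by blast
  have hk: "h \<otimes>\<^bsub>H\<^esub> k \<in> carrier H" using h k by simp
  have bil: "bilinear K A H AH (\<lambda>u v. pure K A H (c \<otimes>\<^bsub>A\<^esub> u) (l \<otimes>\<^bsub>H\<^esub> v))"
    if "c \<in> carrier A" "l \<in> carrier H" for c l
    by (intro lins; simp add: that)
  have "cls (act0 (h \<otimes>\<^bsub>H\<^esub> k) a) =
      pair_sum Q (\<lambda>x y. cls (f y \<otimes>\<^bsub>A\<^esub> \<one>\<^bsub>A\<^esub> \<otimes>\<^bsub>A\<^esub> a \<otimes>\<^bsub>A\<^esub> (\<one>\<^bsub>A\<^esub> \<otimes>\<^bsub>A\<^esub> g x))) (cm (h \<otimes>\<^bsub>H\<^esub> k))"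
    unfolding cls_act0[OF hk a] by (rule cm_cong[OF hk]) (simp add: a)
  also have "\<dots> = \<theta> (pure K A H \<one>\<^bsub>A\<^esub> (h \<otimes>\<^bsub>H\<^esub> k))"
    using theta_translation_coinvariant[OF \<theta> a A_one_closed one_in_B hk] by simp
  finally have left: "cls (act0 (h \<otimes>\<^bsub>H\<^esub> k) a) = \<theta> (pure K A H \<one>\<^bsub>A\<^esub> (h \<otimes>\<^bsub>H\<^esub> k))" .
  have inner: "pair_sum AH (\<lambda>u v. pair_sum AH (\<lambda>p q. pure K A H (g u \<otimes>\<^bsub>A\<^esub> p) (h \<otimes>\<^bsub>H\<^esub> q)) (cc (f v))) (cm k) =
      pure K A H \<one>\<^bsub>A\<^esub> (h \<otimes>\<^bsub>H\<^esub> k)"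
  proof -
    have "pair_sum AH (\<lambda>u v. pair_sum AH (\<lambda>p q. pure K A H (g u \<otimes>\<^bsub>A\<^esub> p) (h \<otimes>\<^bsub>H\<^esub> q)) (cc (f v))) (cm k) =
        pair_sum AH (\<lambda>u v. pair_sum AH (\<lambda>p q. pure K A H (g u \<otimes>\<^bsub>A\<^esub> f p) (h \<otimes>\<^bsub>H\<^esub> q)) (cm v)) (cm k)"
      by (rule cm_cong[OF k], rule cc_f[OF AH_vspace bil[OF _ h]]) simp_all
    also have "\<dots> = pair_sum AH (\<lambda>u v. pair_sum AH (\<lambda>p q. pure K A H (g p \<otimes>\<^bsub>A\<^esub> f q) (h \<otimes>\<^bsub>H\<^esub> v)) (cm u)) (cm k)"
      by (rule coassoc_terms[OF AH_vspace _ k]) (intro lins; simp add: h)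
    also have "\<dots> = pair_sum AH (\<lambda>u v. \<epsilon> u \<odot>\<^bsub>AH\<^esub> pure K A H \<one>\<^bsub>A\<^esub> (h \<otimes>\<^bsub>H\<^esub> v)) (cm k)"
    proof (rule cm_cong[OF k])
      fix u v assume uv: "u \<in> carrier H" "v \<in> carrier H"
      have "pair_sum AH (\<lambda>p q. pure K A H (g p \<otimes>\<^bsub>A\<^esub> f q) (h \<otimes>\<^bsub>H\<^esub> v)) (cm u) =
          pure K A H (\<epsilon> u \<odot>\<^bsub>A\<^esub> \<one>\<^bsub>A\<^esub>) (h \<otimes>\<^bsub>H\<^esub> v)"
        unfolding convolution_left[OF uv(1), symmetric]
        by (rule push_cm[OF A_vspace AH_vspace bilinear_left[OF AH.pure_bilinear] uv(1), symmetric]) (simp_all add: h uv)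
      then show "pair_sum AH (\<lambda>p q. pure K A H (g p \<otimes>\<^bsub>A\<^esub> f q) (h \<otimes>\<^bsub>H\<^esub> v)) (cm u) =
          \<epsilon> u \<odot>\<^bsub>AH\<^esub> pure K A H \<one>\<^bsub>A\<^esub> (h \<otimes>\<^bsub>H\<^esub> v)"
        using uv h by (simp add: AH.smult_pure)
    qed
    also have "\<dots> = pure K A H \<one>\<^bsub>A\<^esub> (h \<otimes>\<^bsub>H\<^esub> k)"
      by (rule counit_left_terms[OF AH_vspace _ k]) (intro lins; simp add: h)
    finally show ?thesis .
  qed
  have expand: "act0 h (act0 k a) =
      pair_sum A (\<lambda>u v. pair_sum A (\<lambda>x y. f y \<otimes>\<^bsub>A\<^esub> (f v \<otimes>\<^bsub>A\<^esub> a \<otimes>\<^bsub>A\<^esub> g u) \<otimes>\<^bsub>A\<^esub> g x) (cm h)) (cm k)"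
    unfolding act0_def[of k] using push_cm[OF A_vspace A_vspace act0_linear[OF h] k] a
    by (simp add: act0_def)
  have "cls (act0 h (act0 k a)) =
      pair_sum Q (\<lambda>u v. cls (pair_sum A (\<lambda>x y. f y \<otimes>\<^bsub>A\<^esub> (f v \<otimes>\<^bsub>A\<^esub> a \<otimes>\<^bsub>A\<^esub> g u) \<otimes>\<^bsub>A\<^esub> g x) (cm h))) (cm k)"
    unfolding expand by (rule push_cm[OF A_vspace Q_vspace QA.coset_linear k]) (simp add: a h)
  also have "\<dots> = pair_sum Q (\<lambda>u v. \<theta> (pair_sum AH (\<lambda>p q. pure K A H (g u \<otimes>\<^bsub>A\<^esub> p) (h \<otimes>\<^bsub>H\<^esub> q)) (cc (f v)))) (cm k)"
  proof (rule cm_cong[OF k])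
    fix u v assume uv: "u \<in> carrier H" "v \<in> carrier H"
    have "cls (pair_sum A (\<lambda>x y. f y \<otimes>\<^bsub>A\<^esub> (f v \<otimes>\<^bsub>A\<^esub> a \<otimes>\<^bsub>A\<^esub> g u) \<otimes>\<^bsub>A\<^esub> g x) (cm h)) =
        pair_sum Q (\<lambda>x y. cls (f y \<otimes>\<^bsub>A\<^esub> (f v \<otimes>\<^bsub>A\<^esub> a \<otimes>\<^bsub>A\<^esub> g u) \<otimes>\<^bsub>A\<^esub> g x)) (cm h)"
      by (rule push_cm[OF A_vspace Q_vspace QA.coset_linear h]) (simp add: a uv)
    also have "\<dots> = pair_sum Q (\<lambda>x y. cls (f y \<otimes>\<^bsub>A\<^esub> f v \<otimes>\<^bsub>A\<^esub> a \<otimes>\<^bsub>A\<^esub> (g u \<otimes>\<^bsub>A\<^esub> g x))) (cm h)"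
      by (rule cm_cong[OF h]) (simp add: A_assoc a uv)
    also have "\<dots> = \<theta> (pair_sum AH (\<lambda>p q. pure K A H (g u \<otimes>\<^bsub>A\<^esub> p) (h \<otimes>\<^bsub>H\<^esub> q)) (cc (f v)))"
      by (rule theta_translation[OF \<theta> a _ _ h]) (simp_all add: uv)
    finally show "cls (pair_sum A (\<lambda>x y. f y \<otimes>\<^bsub>A\<^esub> (f v \<otimes>\<^bsub>A\<^esub> a \<otimes>\<^bsub>A\<^esub> g u) \<otimes>\<^bsub>A\<^esub> g x) (cm h)) = \<dots>" .
  qed
  also have "\<dots> = \<theta> (pure K A H \<one>\<^bsub>A\<^esub> (h \<otimes>\<^bsub>H\<^esub> k))"
    unfolding inner[symmetric]
    by (rule push_additive_cm[OF \<theta>(1) k, symmetric]) (simp add: h)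
  finally show ?thesis using left by simp
qed

lemma act0_one: "a \<in> carrier A \<Longrightarrow> act0 \<one>\<^bsub>H\<^esub> a = a"
proof -
  assume a: "a \<in> carrier A"
  have "bilinear K H H A (\<lambda>x y. f y \<otimes>\<^bsub>A\<^esub> a \<otimes>\<^bsub>A\<^esub> g x)" by (intro lins; simp add: a)
  from cm_one[OF A_vspace this] show ?thesis by (simp add: act0_def f_one g_one a)
qed

text \<open>The tensor \<open>a\<^sub>0 g((a\<^sub>1)\<^sup>1) \<otimes> f((a\<^sub>1)\<^sup>2)\<close> has the same canonical image
  \<open>\<rho> a\<close> as \<open>1 \<otimes> a\<close>, and the reversed product sends the latter to \<open>a\<close>.\<close>

lemma act0_stable:
  assumes a: "a \<in> carrier A"
  shows "pair_sum Q (\<lambda>x y. cls (act0 y x)) (cc a) = cls a"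
proof -
  obtain \<theta> where \<theta>: "additive_map AH Q \<theta>"
    "\<And>x y. \<lbrakk>x \<in> carrier A; y \<in> carrier A\<rbrakk> \<Longrightarrow> \<theta> (can x y) = cls (y \<otimes>\<^bsub>A\<^esub> \<one>\<^bsub>A\<^esub> \<otimes>\<^bsub>A\<^esub> x)"
    using sandwich_factors[OF A_one_closed] by blast
  have "pair_sum Q (\<lambda>x y. cls (act0 y x)) (cc a) = pair_sum Q (\<lambda>x y. \<theta> (pure K A H x y)) (cc a)"
  proof (rule cc_cong[OF a])
    fix x y assume xy: "x \<in> carrier A" "y \<in> carrier H"
    have "cls (act0 y x) =
        pair_sum Q (\<lambda>u v. cls (f v \<otimes>\<^bsub>A\<^esub> \<one>\<^bsub>A\<^esub> \<otimes>\<^bsub>A\<^esub> \<one>\<^bsub>A\<^esub> \<otimes>\<^bsub>A\<^esub> (x \<otimes>\<^bsub>A\<^esub> g u))) (cm y)"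
      unfolding cls_act0[OF xy(2,1)] by (rule cm_cong[OF xy(2)]) (simp add: A_assoc xy)
    also have "\<dots> = \<theta> (pure K A H x y)"
      using theta_translation_coinvariant[OF \<theta> A_one_closed xy(1) one_in_B xy(2)] xy by simp
    finally show "cls (act0 y x) = \<theta> (pure K A H x y)" .
  qed
  also have "\<dots> = \<theta> (pair_sum AH (pure K A H) (cc a))"
    by (rule push_additive_cc[OF \<theta>(1) a, symmetric]) simp
  also have "pair_sum AH (pure K A H) (cc a) = can \<one>\<^bsub>A\<^esub> a"
    using AH.terms(2)[OF coaction_closed[OF a]] can_one[OF a] by simp
  also have "\<theta> (can \<one>\<^bsub>A\<^esub> a) = cls a" by (simp add: \<theta>(2) a)
  finally show ?thesis .
qed

end


section \<open>The stable anti Yetter-Drinfeld structure\<close>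

context cleft_extension
begin

abbreviation "pQ \<equiv> pure K Q H"

definition coact0 :: "'a \<Rightarrow> ('a set \<times> 'h \<Rightarrow>\<^sub>0 int) set" where
  "coact0 a = pair_sum QH (\<lambda>x y. pQ (cls x) y) (cc a)"

definition act :: "'h \<Rightarrow> 'a set \<Rightarrow> 'a set" where
  "act h = quotient_lift (\<lambda>a. cls (act0 h a))"

definition coact :: "'a set \<Rightarrow> ('a set \<times> 'h \<Rightarrow>\<^sub>0 int) set" where
  "coact = quotient_lift coact0"

lemma Q_cases:
  assumes "m \<in> carrier Q" obtains a where "a \<in> carrier A" "m = cls a"
  using assms by (auto simp: QA.quotient_carrier)

lemma cls_act0_linear: "h \<in> carrier H \<Longrightarrow> (\<lambda>a. cls (act0 h a)) \<in> linear_maps K A Q"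
  by (rule lin_cls[OF act0_linear])

lemma cls_act0_vanish: "\<lbrakk>h \<in> carrier H; n \<in> N\<rbrakk> \<Longrightarrow> cls (act0 h n) = \<zero>\<^bsub>Q\<^esub>"
  by (rule linear_maps_vanish_N[OF Q_vspace cls_act0_linear act0_commute])

lemma act_cls [simp]: "\<lbrakk>h \<in> carrier H; a \<in> carrier A\<rbrakk> \<Longrightarrow> act h (cls a) = cls (act0 h a)"
  unfolding act_def
  by (rule QA.quotient_lift_coset[OF Q_vspace cls_act0_linear cls_act0_vanish])

lemma act_linear: "h \<in> carrier H \<Longrightarrow> act h \<in> linear_maps K Q Q"
  unfolding act_def by (rule QA.quotient_lift_linear[OF Q_vspace cls_act0_linear cls_act0_vanish])

lemma act_linear_left:
  assumes "m \<in> carrier Q" shows "(\<lambda>h. act h m) \<in> linear_maps K H Q"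
proof -
  obtain a where a: "a \<in> carrier A" "m = cls a" using assms by (rule Q_cases)
  have "(\<lambda>h. cls (act0 h a)) \<in> linear_maps K H Q" by (rule lin_cls[OF act0_linear_left[OF a(1)]])
  then show ?thesis by (rule linear_maps_cong[OF H_vspace]) (simp add: a)
qed

lemma act_closed [simp]: "\<lbrakk>h \<in> carrier H; m \<in> carrier Q\<rbrakk> \<Longrightarrow> act h m \<in> carrier Q"
  by (rule linear_maps_closed[OF act_linear])

lemma pure_cls_bilinear: "bilinear K A H QH (\<lambda>x y. pQ (cls x) y)"
  by (intro qlins; simp)

lemma coact0_linear: "coact0 \<in> linear_maps K A QH"
  unfolding coact0_def[abs_def] by (rule lin_cc'[OF A_vspace QH_vspace pure_cls_bilinear linear_id])

text \<open>Since \<open>\<rho> b = b \<otimes> 1\<close>, the two sides are \<open>a\<^sub>0 b \<otimes> a\<^sub>1\<close> and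
  \<open>b a\<^sub>0 \<otimes> a\<^sub>1\<close>, whose left factors agree modulo commutators.\<close>

lemma coact0_commute:
  assumes a: "a \<in> carrier A" and b: "b \<in> B"
  shows "coact0 (a \<otimes>\<^bsub>A\<^esub> b) = coact0 (b \<otimes>\<^bsub>A\<^esub> a)"
proof -
  note bA = B_subset[OF b]
  have "coact0 (a \<otimes>\<^bsub>A\<^esub> b) =
      pair_sum QH (\<lambda>x y. pair_sum QH (\<lambda>u v. pQ (cls (x \<otimes>\<^bsub>A\<^esub> u)) (y \<otimes>\<^bsub>H\<^esub> v)) (cc b)) (cc a)"
    unfolding coact0_def by (rule cc_mult[OF QH_vspace pure_cls_bilinear a bA])
  also have "\<dots> = pair_sum QH (\<lambda>x y. pQ (cls (b \<otimes>\<^bsub>A\<^esub> x)) y) (cc a)"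
  proof (rule cc_cong[OF a])
    fix x y assume xy: "x \<in> carrier A" "y \<in> carrier H"
    have "pair_sum QH (\<lambda>u v. pQ (cls (x \<otimes>\<^bsub>A\<^esub> u)) (y \<otimes>\<^bsub>H\<^esub> v)) (cc b) = pQ (cls (x \<otimes>\<^bsub>A\<^esub> b)) (y \<otimes>\<^bsub>H\<^esub> \<one>\<^bsub>H\<^esub>)"
      by (rule cc_coinvariant[OF QH_vspace _ b]) (intro qlins; simp add: xy)
    then show "pair_sum QH (\<lambda>u v. pQ (cls (x \<otimes>\<^bsub>A\<^esub> u)) (y \<otimes>\<^bsub>H\<^esub> v)) (cc b) = pQ (cls (b \<otimes>\<^bsub>A\<^esub> x)) y"
      using xy cls_commute[OF xy(1) b] by simp
  qed
  also have "\<dots> = pair_sum QH (\<lambda>u v. pair_sum QH (\<lambda>x y. pQ (cls (u \<otimes>\<^bsub>A\<^esub> x)) (v \<otimes>\<^bsub>H\<^esub> y)) (cc a)) (cc b)"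
  proof -
    have "pair_sum QH (\<lambda>u v. pair_sum QH (\<lambda>x y. pQ (cls (u \<otimes>\<^bsub>A\<^esub> x)) (v \<otimes>\<^bsub>H\<^esub> y)) (cc a)) (cc b) =
        pair_sum QH (\<lambda>x y. pQ (cls (b \<otimes>\<^bsub>A\<^esub> x)) (\<one>\<^bsub>H\<^esub> \<otimes>\<^bsub>H\<^esub> y)) (cc a)"
      by (rule cc_coinvariant[OF QH_vspace _ b]) (intro qlins; simp add: a)
    also have "\<dots> = pair_sum QH (\<lambda>x y. pQ (cls (b \<otimes>\<^bsub>A\<^esub> x)) y) (cc a)"
      by (rule cc_cong[OF a]) simp
    finally show ?thesis by simp
  qed
  also have "\<dots> = coact0 (b \<otimes>\<^bsub>A\<^esub> a)"
    unfolding coact0_def by (rule cc_mult[OF QH_vspace pure_cls_bilinear bA a, symmetric])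
  finally show ?thesis .
qed

lemma coact0_vanish: "n \<in> N \<Longrightarrow> coact0 n = \<zero>\<^bsub>QH\<^esub>"
  by (rule linear_maps_vanish_N[OF QH_vspace coact0_linear coact0_commute])

lemma coact_cls: "a \<in> carrier A \<Longrightarrow> coact (cls a) = coact0 a"
  unfolding coact_def by (rule QA.quotient_lift_coset[OF QH_vspace coact0_linear coact0_vanish])

lemma coact_linear: "coact \<in> linear_maps K Q QH"
  unfolding coact_def by (rule QA.quotient_lift_linear[OF QH_vspace coact0_linear coact0_vanish])

lemma coact_closed [simp]: "m \<in> carrier Q \<Longrightarrow> coact m \<in> carrier QH"
  by (rule linear_maps_closed[OF coact_linear])

lemma tensor_lift_coact:
  assumes "vspace K G" "bilinear K Q H G \<beta>" "a \<in> carrier A"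
  shows "tensor_lift G \<beta> (coact (cls a)) = pair_sum G (\<lambda>x y. \<beta> (cls x) y) (cc a)"
  unfolding coact_cls[OF assms(3)] coact0_def
  by (rule QH.tensor_lift_sum_pure[OF assms(1,2) cc_subset[OF assms(3)]]) simp_all

lemma left_H_module_Q: "left_H_module K H Q act"
  unfolding left_H_module_def left_H_module_axioms_def
proof (intro conjI allI impI)
  show "act (h \<otimes>\<^bsub>H\<^esub> k) m = act h (act k m)"
    if "h \<in> carrier H" "k \<in> carrier H" "m \<in> carrier Q" for h k m
    using Q_cases[OF that(3)] that by (metis H_mult_closed act0_closed act0_mult act_cls)
  show "act \<one>\<^bsub>H\<^esub> m = m" if "m \<in> carrier Q" for m
    using Q_cases[OF that] by (metis H_one_closed act0_one act_cls)
qed (simp_all add: H_alg act_linear act_linear_left)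

text \<open>Both axioms are the images of those of \<open>A\<close> under the quotient map.\<close>

lemma right_comodule_Q: "right_comodule K H \<Delta> \<epsilon> Q coact"
  unfolding right_comodule_def right_comodule_axioms_def
proof (intro conjI allI impI)
  let ?HH = "tensor K H H"
  interpret QHH: vspace_pair K Q ?HH by (simp add: vspace_pair_def HH.tensor_vspace)
  let ?T = "tensor K Q ?HH"
  have T [simp]: "vspace K ?T" by (rule QHH.tensor_vspace)
  have HHc [simp]: "x \<in> carrier H \<Longrightarrow> y \<in> carrier H \<Longrightarrow> pure K H H x y \<in> carrier ?HH" for x y
    by (rule HH.pure_closed)
  note tlins = qlins linear_bilinear_right[OF QHH.pure_bilinear] linear_bilinear_left[OF QHH.pure_bilinear]
    linear_bilinear_right[OF HH.pure_bilinear] linear_bilinear_left[OF HH.pure_bilinear]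
    linear_comp[OF comult_linear]
  fix m assume "m \<in> carrier Q"
  then obtain a where a: "a \<in> carrier A" "m = cls a" by (rule Q_cases)
  have "tensor_lift ?T (\<lambda>x y. pure K Q ?HH x (\<Delta> y)) (coact (cls a)) =
      pair_sum ?T (\<lambda>x y. pure K Q ?HH (cls x) (\<Delta> y)) (cc a)"
    by (rule tensor_lift_coact[OF T _ a(1)]) (intro tlins; simp)
  also have "\<dots> = pair_sum ?T (\<lambda>x y. pair_sum ?T (\<lambda>u v. pure K Q ?HH (cls x) (pure K H H u v)) (cm y)) (cc a)"
  proof (rule cc_cong[OF a(1)])
    fix x y assume xy: "x \<in> carrier A" "y \<in> carrier H"
    have "pair_sum ?T (\<lambda>u v. pure K Q ?HH (cls x) (pure K H H u v)) (cm y) =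
        pure K Q ?HH (cls x) (pair_sum ?HH (pure K H H) (cm y))"
      by (rule push_cm[OF HH.tensor_vspace T bilinear_right[OF QHH.pure_bilinear] xy(2), symmetric])
        (simp_all add: xy)
    then show "pure K Q ?HH (cls x) (\<Delta> y) = pair_sum ?T (\<lambda>u v. pure K Q ?HH (cls x) (pure K H H u v)) (cm y)"
      using HH.terms(2)[OF comult_closed[OF xy(2)]] by simp
  qed
  also have "\<dots> = pair_sum ?T (\<lambda>x y. pair_sum ?T (\<lambda>u v. pure K Q ?HH (cls u) (pure K H H v y)) (cc x)) (cc a)"
    by (rule coaction_coassoc_terms[OF T _ a(1)]) (intro tlins; simp)
  also have "\<dots> = tensor_lift ?T (\<lambda>x y. tensor_lift ?T (\<lambda>x0 x1. pure K Q ?HH x0 (pure K H H x1 y)) (coact x)) (coact (cls a))"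
  proof -
    let ?R = "\<lambda>x y. tensor_lift ?T (\<lambda>x0 x1. pure K Q ?HH x0 (pure K H H x1 y)) (coact x)"
    have in_bil: "bilinear K Q H ?T (\<lambda>x0 x1. pure K Q ?HH x0 (pure K H H x1 y))" if "y \<in> carrier H" for y
      by (intro tlins; simp add: that)
    have R_eq: "?R (cls x) y = pair_sum ?T (\<lambda>u v. pure K Q ?HH (cls u) (pure K H H v y)) (cc x)"
      if "x \<in> carrier A" "y \<in> carrier H" for x y
      by (rule tensor_lift_coact[OF T in_bil[OF that(2)] that(1)])
    have "bilinear K Q H ?T ?R"
    proof (rule bilinearI)
      fix x assume "x \<in> carrier Q"
      then obtain b where b: "b \<in> carrier A" "x = cls b" by (rule Q_cases)
      have "(\<lambda>y. pair_sum ?T (\<lambda>u v. pure K Q ?HH (cls u) (pure K H H v y)) (cc b)) \<in> linear_maps K H ?T"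
        by (intro tlins; simp add: b)
      then show "(\<lambda>y. ?R x y) \<in> linear_maps K H ?T"
        by (rule linear_maps_cong[OF H_vspace]) (simp add: b R_eq)
    next
      fix y assume y: "y \<in> carrier H"
      show "(\<lambda>x. ?R x y) \<in> linear_maps K Q ?T"
        by (rule linear_comp[OF QH.tensor_lift_linear[OF T in_bil[OF y]] coact_linear])
    qed
    from tensor_lift_coact[OF T this a(1)]
    have "tensor_lift ?T ?R (coact (cls a)) = pair_sum ?T (\<lambda>x y. ?R (cls x) y) (cc a)" .
    also have "\<dots> = pair_sum ?T (\<lambda>x y. pair_sum ?T (\<lambda>u v. pure K Q ?HH (cls u) (pure K H H v y)) (cc x)) (cc a)"
      by (rule cc_cong[OF a(1) R_eq])
    finally show ?thesis by simp
  qed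
  finally show "tensor_lift ?T (\<lambda>x y. pure K Q ?HH x (\<Delta> y)) (coact m) =
      tensor_lift ?T (\<lambda>x y. tensor_lift ?T (\<lambda>x0 x1. pure K Q ?HH x0 (pure K H H x1 y)) (coact x)) (coact m)"
    by (simp only: a(2))
next
  fix m assume "m \<in> carrier Q"
  then obtain a where a: "a \<in> carrier A" "m = cls a" by (rule Q_cases)
  have "bilinear K Q H Q (\<lambda>x y. \<epsilon> y \<odot>\<^bsub>Q\<^esub> x)"
    by (intro bilinearI linear_bilinear_right[OF bilinear_smult[OF Q_vspace]]
        linear_bilinear_left[OF bilinear_smult[OF Q_vspace]] counit_linear linear_id)
      (simp_all add: ground_module_def)
  from tensor_lift_coact[OF Q_vspace this a(1)] coaction_counit_terms[OF Q_vspace QA.coset_linear a(1)]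
  show "tensor_lift Q (\<lambda>x y. \<epsilon> y \<odot>\<^bsub>Q\<^esub> x) (coact m) = m" by (simp add: a(2))
qed (simp_all add: coalgebra_axioms coact_linear)

text \<open>The coaction is multiplicative, and it is known on each of the three factors:
  \<open>f\<close> is colinear and the coaction on \<open>g x\<close> brings in the antipode.\<close>

lemma coact_act0:
  assumes a: "a \<in> carrier A" and x: "x \<in> carrier H" and y: "y \<in> carrier H"
  shows "coact0 (f y \<otimes>\<^bsub>A\<^esub> a \<otimes>\<^bsub>A\<^esub> g x) =
    pair_sum QH (\<lambda>s t. pair_sum QH (\<lambda>p q. pair_sum QH (\<lambda>u v.
      pQ (cls (f p \<otimes>\<^bsub>A\<^esub> u \<otimes>\<^bsub>A\<^esub> g t)) (q \<otimes>\<^bsub>H\<^esub> v \<otimes>\<^bsub>H\<^esub> S s)) (cc a)) (cm y)) (cm x)"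
proof -
  interpret QHg: abelian_group QH by (rule vspace_abelian_group[OF QH_vspace])
  have fa: "f y \<otimes>\<^bsub>A\<^esub> a \<in> carrier A" using a y by simp
  have "coact0 (f y \<otimes>\<^bsub>A\<^esub> a \<otimes>\<^bsub>A\<^esub> g x) =
      pair_sum QH (\<lambda>p q. pair_sum QH (\<lambda>s t. pQ (cls (p \<otimes>\<^bsub>A\<^esub> s)) (q \<otimes>\<^bsub>H\<^esub> t)) (cc (g x))) (cc (f y \<otimes>\<^bsub>A\<^esub> a))"
    unfolding coact0_def by (rule cc_mult[OF QH_vspace pure_cls_bilinear fa]) (simp add: x)
  also have "\<dots> = pair_sum QH (\<lambda>p q. pair_sum QH (\<lambda>s t. pQ (cls (p \<otimes>\<^bsub>A\<^esub> g t)) (q \<otimes>\<^bsub>H\<^esub> S s)) (cm x)) (cc (f y \<otimes>\<^bsub>A\<^esub> a))"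
    by (rule cc_cong[OF fa], rule cc_g[OF QH_vspace _ x]) (intro qlins; simp)
  also have "\<dots> = pair_sum QH (\<lambda>s t. pair_sum QH (\<lambda>p q. pQ (cls (p \<otimes>\<^bsub>A\<^esub> g t)) (q \<otimes>\<^bsub>H\<^esub> S s)) (cc (f y \<otimes>\<^bsub>A\<^esub> a))) (cm x)"
    by (rule QHg.pair_sum_swap[OF cc_subset[OF fa] cm_subset[OF x]]) simp
  also have "\<dots> = pair_sum QH (\<lambda>s t. pair_sum QH (\<lambda>p q. pair_sum QH (\<lambda>u v.
      pQ (cls (f p \<otimes>\<^bsub>A\<^esub> u \<otimes>\<^bsub>A\<^esub> g t)) (q \<otimes>\<^bsub>H\<^esub> v \<otimes>\<^bsub>H\<^esub> S s)) (cc a)) (cm y)) (cm x)"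
  proof (rule cm_cong[OF x])
    fix s t assume st: "s \<in> carrier H" "t \<in> carrier H"
    have "pair_sum QH (\<lambda>p q. pQ (cls (p \<otimes>\<^bsub>A\<^esub> g t)) (q \<otimes>\<^bsub>H\<^esub> S s)) (cc (f y \<otimes>\<^bsub>A\<^esub> a)) =
        pair_sum QH (\<lambda>p q. pair_sum QH (\<lambda>u v. pQ (cls (p \<otimes>\<^bsub>A\<^esub> u \<otimes>\<^bsub>A\<^esub> g t)) (q \<otimes>\<^bsub>H\<^esub> v \<otimes>\<^bsub>H\<^esub> S s)) (cc a)) (cc (f y))"
      by (rule cc_mult[OF QH_vspace _ _ a]) ((intro qlins)?; simp add: st y)+
    also have "\<dots> = pair_sum QH (\<lambda>p q. pair_sum QH (\<lambda>u v. pQ (cls (f p \<otimes>\<^bsub>A\<^esub> u \<otimes>\<^bsub>A\<^esub> g t)) (q \<otimes>\<^bsub>H\<^esub> v \<otimes>\<^bsub>H\<^esub> S s)) (cc a)) (cm y)"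
      by (rule cc_f[OF QH_vspace _ y]) (intro qlins; simp add: st a)
    finally show "pair_sum QH (\<lambda>p q. pQ (cls (p \<otimes>\<^bsub>A\<^esub> g t)) (q \<otimes>\<^bsub>H\<^esub> S s)) (cc (f y \<otimes>\<^bsub>A\<^esub> a)) = \<dots>" .
  qed
  finally show ?thesis .
qed

text \<open>The coaction on \<open>f(h\<^sup>2) a g(h\<^sup>1)\<close> is
  \<open>f(h\<^sup>3) a\<^sub>0 g(h\<^sup>2) \<otimes> h\<^sup>4 a\<^sub>1 S(h\<^sup>1)\<close>. Two applications of
  coassociativity group the second and third factor of \<open>h\<close> together, and these form the action.\<close>

lemma ayd_Q:
  assumes h: "h \<in> carrier H" and m: "m \<in> carrier Q"
  shows "coact (act h m) =
      tensor_lift QH (\<lambda>h1 h'.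
        tensor_lift QH (\<lambda>h2 h3.
          tensor_lift QH (\<lambda>m0 m1. pQ (act h2 m0) (h3 \<otimes>\<^bsub>H\<^esub> m1 \<otimes>\<^bsub>H\<^esub> S h1)) (coact m))
        (\<Delta> h'))
      (\<Delta> h)"
proof -
  interpret QHg: abelian_group QH by (rule vspace_abelian_group[OF QH_vspace])
  obtain a where a: "a \<in> carrier A" "m = cls a" using m by (rule Q_cases)
  \<comment> \<open>The four arguments are the Sweedler factors of \<open>h\<close> in their order, so coassociativity
    only moves brackets.\<close>
  define \<kappa> where "\<kappa> s t p q = pair_sum QH (\<lambda>u v.
    pQ (cls (f p \<otimes>\<^bsub>A\<^esub> u \<otimes>\<^bsub>A\<^esub> g t)) (q \<otimes>\<^bsub>H\<^esub> v \<otimes>\<^bsub>H\<^esub> S s)) (cc a)" for s t p q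
  have lin1: "(\<lambda>z. \<kappa> (\<phi> z) t p q) \<in> linear_maps K H QH"
    if "\<phi> \<in> linear_maps K H H" "t \<in> carrier H" "p \<in> carrier H" "q \<in> carrier H" for \<phi> t p q
    unfolding \<kappa>_def using that by (intro qlins; simp add: a)
  have lin2: "(\<lambda>z. \<kappa> s (\<phi> z) p q) \<in> linear_maps K H QH"
    if "\<phi> \<in> linear_maps K H H" "s \<in> carrier H" "p \<in> carrier H" "q \<in> carrier H" for \<phi> s p q
    unfolding \<kappa>_def using that by (intro qlins; simp add: a)
  have lin3: "(\<lambda>z. \<kappa> s t (\<phi> z) q) \<in> linear_maps K H QH"
    if "\<phi> \<in> linear_maps K H H" "s \<in> carrier H" "t \<in> carrier H" "q \<in> carrier H" for \<phi> s t q
    unfolding \<kappa>_def using that by (intro qlins; simp add: a)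
  have lin4: "(\<lambda>z. \<kappa> s t p (\<phi> z)) \<in> linear_maps K H QH"
    if "\<phi> \<in> linear_maps K H H" "s \<in> carrier H" "t \<in> carrier H" "p \<in> carrier H" for \<phi> s t p
    unfolding \<kappa>_def using that by (intro qlins; simp add: a)
  have \<kappa>_closed [simp]: "\<kappa> s t p q \<in> carrier QH"
    if "s \<in> carrier H" "t \<in> carrier H" "p \<in> carrier H" "q \<in> carrier H" for s t p q
    unfolding \<kappa>_def using that by (simp add: a)
  note \<kappa>lins = lin1 lin2 lin3 lin4 lin_cm lin_cm' linear_id bilinearI trilinearI
  have "coact (act h m) = coact0 (act0 h a)" using h a by (simp add: coact_cls)
  also have "\<dots> = pair_sum QH (\<lambda>x y. coact0 (f y \<otimes>\<^bsub>A\<^esub> a \<otimes>\<^bsub>A\<^esub> g x)) (cm h)"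
    unfolding act0_def by (rule push_cm[OF A_vspace QH_vspace coact0_linear h]) (simp add: a)
  also have "\<dots> = pair_sum QH (\<lambda>x y. pair_sum QH (\<lambda>s t. pair_sum QH (\<kappa> s t) (cm y)) (cm x)) (cm h)"
    by (rule cm_cong[OF h]) (simp add: coact_act0[OF a(1)] \<kappa>_def[abs_def])
  also have "\<dots> = pair_sum QH (\<lambda>x y. pair_sum QH (\<lambda>t w. pair_sum QH (\<kappa> x t) (cm w)) (cm y)) (cm h)"
    by (rule coassoc_terms[symmetric, OF QH_vspace _ h]) (intro \<kappa>lins; simp)
  also have "\<dots> = pair_sum QH (\<lambda>x y. pair_sum QH (\<lambda>w q. pair_sum QH (\<lambda>t p. \<kappa> x t p q) (cm w)) (cm y)) (cm h)"
    by (rule cm_cong[OF h], rule coassoc_terms[OF QH_vspace]) (intro \<kappa>lins; simp)+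
  also have "\<dots> = tensor_lift QH (\<lambda>h1 h'.
        tensor_lift QH (\<lambda>h2 h3.
          tensor_lift QH (\<lambda>m0 m1. pQ (act h2 m0) (h3 \<otimes>\<^bsub>H\<^esub> m1 \<otimes>\<^bsub>H\<^esub> S h1)) (coact m))
        (\<Delta> h'))
      (\<Delta> h)"
  proof -
    have E3: "tensor_lift QH (\<lambda>m0 m1. pQ (act h2 m0) (h3 \<otimes>\<^bsub>H\<^esub> m1 \<otimes>\<^bsub>H\<^esub> S h1)) (coact m) =
        pair_sum QH (\<lambda>t p. \<kappa> h1 t p h3) (cm h2)"
      if hs: "h1 \<in> carrier H" "h2 \<in> carrier H" "h3 \<in> carrier H" for h1 h2 h3
    proof -
      have "tensor_lift QH (\<lambda>m0 m1. pQ (act h2 m0) (h3 \<otimes>\<^bsub>H\<^esub> m1 \<otimes>\<^bsub>H\<^esub> S h1)) (coact m) =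
          pair_sum QH (\<lambda>u v. pQ (act h2 (cls u)) (h3 \<otimes>\<^bsub>H\<^esub> v \<otimes>\<^bsub>H\<^esub> S h1)) (cc a)"
        unfolding a(2) by (rule tensor_lift_coact[OF QH_vspace _ a(1)])
          (intro qlins linear_comp[OF act_linear]; simp add: hs)
      also have "\<dots> = pair_sum QH (\<lambda>u v. pair_sum QH (\<lambda>t p.
          pQ (cls (f p \<otimes>\<^bsub>A\<^esub> u \<otimes>\<^bsub>A\<^esub> g t)) (h3 \<otimes>\<^bsub>H\<^esub> v \<otimes>\<^bsub>H\<^esub> S h1)) (cm h2)) (cc a)"
      proof (rule cc_cong[OF a(1)])
        fix u v assume uv: "u \<in> carrier A" "v \<in> carrier H"
        have l: "(\<lambda>z. pQ (cls z) (h3 \<otimes>\<^bsub>H\<^esub> v \<otimes>\<^bsub>H\<^esub> S h1)) \<in> linear_maps K A QH"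
          by (intro qlins; simp add: hs uv)
        show "pQ (act h2 (cls u)) (h3 \<otimes>\<^bsub>H\<^esub> v \<otimes>\<^bsub>H\<^esub> S h1) =
            pair_sum QH (\<lambda>t p. pQ (cls (f p \<otimes>\<^bsub>A\<^esub> u \<otimes>\<^bsub>A\<^esub> g t)) (h3 \<otimes>\<^bsub>H\<^esub> v \<otimes>\<^bsub>H\<^esub> S h1)) (cm h2)"
          unfolding act_cls[OF hs(2) uv(1)] act0_def
          by (rule push_cm[OF A_vspace QH_vspace l hs(2)]) (simp add: uv)
      qed
      also have "\<dots> = pair_sum QH (\<lambda>t p. \<kappa> h1 t p h3) (cm h2)"
        unfolding \<kappa>_def by (rule QHg.pair_sum_swap[OF cc_subset[OF a(1)] cm_subset[OF hs(2)]]) (simp add: hs)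
      finally show ?thesis .
    qed
    have E2: "tensor_lift QH (\<lambda>h2 h3.
          tensor_lift QH (\<lambda>m0 m1. pQ (act h2 m0) (h3 \<otimes>\<^bsub>H\<^esub> m1 \<otimes>\<^bsub>H\<^esub> S h1)) (coact m)) (\<Delta> h') =
        pair_sum QH (\<lambda>w q. pair_sum QH (\<lambda>t p. \<kappa> h1 t p q) (cm w)) (cm h')"
      if hs: "h1 \<in> carrier H" "h' \<in> carrier H" for h1 h'
      by (rule HH.tensor_lift_terms_cong[OF QH_vspace _ comult_closed[OF hs(2)] E3[OF hs(1)]])
        (intro \<kappa>lins; simp add: hs)
    have "bilinear K H H QH (\<lambda>x y. pair_sum QH (\<lambda>w q. pair_sum QH (\<lambda>t p. \<kappa> x t p q) (cm w)) (cm y))"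
      by (intro \<kappa>lins; simp)
    from HH.tensor_lift_terms_cong[OF QH_vspace this comult_closed[OF h] E2]
    show ?thesis by simp
  qed
  finally show ?thesis .
qed

lemma stable_anti_yetter_drinfeld_Q: "stable_anti_yetter_drinfeld K H \<Delta> \<epsilon> S Q act coact"
  unfolding stable_anti_yetter_drinfeld_def stable_anti_yetter_drinfeld_axioms_def
    anti_yetter_drinfeld_def anti_yetter_drinfeld_axioms_def
proof (intro conjI allI impI)
  fix m assume "m \<in> carrier Q"
  then obtain a where a: "a \<in> carrier A" "m = cls a" by (rule Q_cases)
  have "bilinear K Q H Q (\<lambda>m0 m1. act m1 m0)"
    by (intro bilinearI act_linear act_linear_left)
  from tensor_lift_coact[OF Q_vspace this a(1)]
  have "tensor_lift Q (\<lambda>m0 m1. act m1 m0) (coact m) = pair_sum Q (\<lambda>x y. cls (act0 y x)) (cc a)"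
    using cc_cong[OF a(1), of "\<lambda>x y. act y (cls x)" "\<lambda>x y. cls (act0 y x)"] by (simp add: a(2))
  then show "tensor_lift Q (\<lambda>m0 m1. act m1 m0) (coact m) = m"
    using act0_stable[OF a(1)] a(2) by simp
qed (rule hopf_algebra_axioms left_H_module_Q right_comodule_Q ayd_Q; assumption?)+

lemma coact_formula:
  "a \<in> carrier A \<Longrightarrow> coact (cls a) = tensor_lift QH (\<lambda>a0 a1. pQ (cls a0) a1) (\<rho> a)"
  using AH.tensor_lift_terms[OF QH_vspace pure_cls_bilinear coaction_closed] by (simp add: coact_cls coact0_def)

lemma act_formula:
  assumes "h \<in> carrier H" "a \<in> carrier A"
  shows "act h (cls a) = cls (tensor_lift A (\<lambda>h1 h2. f h2 \<otimes>\<^bsub>A\<^esub> a \<otimes>\<^bsub>A\<^esub> g h1) (\<Delta> h))"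
proof -
  have "bilinear K H H A (\<lambda>x y. f y \<otimes>\<^bsub>A\<^esub> a \<otimes>\<^bsub>A\<^esub> g x)" by (intro lins; simp add: assms)
  from HH.tensor_lift_terms[OF A_vspace this comult_closed[OF assms(1)]]
  show ?thesis using assms by (simp add: act0_def)
qed

end

theorem proposition3p12:
  fixes K :: "'k ring" and H :: "('k, 'h) module" and A :: "('k, 'a) module"
    and \<Delta> :: "'h \<Rightarrow> ('h \<times> 'h \<Rightarrow>\<^sub>0 int) set" and \<epsilon> :: "'h \<Rightarrow> 'k" and S :: "'h \<Rightarrow> 'h"
    and \<rho> :: "'a \<Rightarrow> ('a \<times> 'h \<Rightarrow>\<^sub>0 int) set"
    and f finv :: "'h \<Rightarrow> 'a"
  defines "N \<equiv> commutator_space K A (coinvariants K H A \<rho>)"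
  defines "A\<^sub>B \<equiv> quotient_module A N"
  assumes "hopf_galois_extension K H \<Delta> \<epsilon> S A \<rho>"
    and "total_integral K H \<Delta> A \<rho> f"
    and "convolution_inverse K H \<Delta> \<epsilon> A f finv"
  shows "\<exists>act coact.
    (\<forall>a\<in>carrier A. coact (N +>\<^bsub>A\<^esub> a) =
       tensor_lift (tensor K A\<^sub>B H) (\<lambda>a0 a1. pure K A\<^sub>B H (N +>\<^bsub>A\<^esub> a0) a1) (\<rho> a)) \<and>
    (\<forall>h\<in>carrier H. \<forall>a\<in>carrier A. act h (N +>\<^bsub>A\<^esub> a) =
       N +>\<^bsub>A\<^esub> tensor_lift A (\<lambda>h1 h2. f h2 \<otimes>\<^bsub>A\<^esub> a \<otimes>\<^bsub>A\<^esub> finv h1) (\<Delta> h)) \<and>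
    stable_anti_yetter_drinfeld K H \<Delta> \<epsilon> S A\<^sub>B act coact"
proof -
  interpret cleft_extension K H \<Delta> \<epsilon> S A \<rho> f finv
    using assms(3-5) by (simp add: cleft_extension_def cleft_extension_axioms_def)
  show ?thesis
    unfolding A\<^sub>B_def N_def
    using coact_formula act_formula stable_anti_yetter_drinfeld_Q by blast
qed

end
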